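(* Let $\mu$ be a critical offspring distribution for which there exist $\beta\in(1,2]$ and a constant $c>0$ such that, with $S_n=\sum_{i=1}^n Z_i$, $Z_i$ i.i.d. with law $\mu$, one has $\frac{S_n-n}{c\,n^{1/\beta}}\to X$ in distribution as $n\to\infty$, where $X$ is the $\beta$-stable random variable with $\mathbb{E}[e^{-\lambda X}]=e^{\lambda^\beta}$ for all $\lambda>0$. Let $d=\frac{\beta}{\beta-1}$, $\alpha>d$, let $T_\infty$ be Kesten's tree with offspring distribution $\mu$ and let $\xi$ be an i.i.d. Pareto($\alpha$) potential on $V(T_\infty)$. For $t>0$ and $v\in V(T_\infty)$ let $$\psi_t(v)=\sup_{\rho\in[0,1]}\Big\{(1-\rho)(\xi(v)-\deg(v))-\frac{|v|}{t}\log\Big(\frac{|v|}{\rho e t}\Big)\Big\},$$ $$\hat Z^{(1)}_t=\arg\max_{v\in V(T_\infty)}\psi_t(v),\qquad \hat Z^{(2)}_t=\arg\max_{v\in V(T_\infty)\setminus\{\hat Z^{(1)}_t\}}\psi_t(v).$$ Then for each $i=1,2$, $$\lim_{\lambda\to\infty}\liminf_{t\to\infty}P\big(|\hat Z^{(i)}_t|\in[\lambda^{-1}r(t),\ \lambda r(t)]\big)=1 .$$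
   Context: Tree: a critical offspring distribution $\mu=(\mu_n)_{n\ge0}$ is a probability distribution on $\{0,1,2,\dots\}$ with $\sum_n n\mu_n=1$; its size-biased version is $\mu^*_n=n\mu_n$. Kesten's tree $T_\infty$ (the critical Galton-Watson tree conditioned to survive), with law $\mathbf{P}$, is the random rooted tree in which every individual is normal or special; the root $O$ is special; normal individuals produce normal children with offspring law $\mu$; a special individual produces children with offspring law $\mu^*$, one of which, chosen uniformly, is special and the others normal; all choices are independent. $V(T_\infty)$ is its vertex set, $|v|$ is the graph distance from $O$ to $v$, and $\deg(v)$ is the degree of $v$ in $T_\infty$. Potential: conditionally on $T_\infty$, $(\xi(v))_{v\in V(T_\infty)}$ are i.i.d. with $\mathcal{P}(\xi(v)\ge x)=x^{-\alpha}$ for $x\ge1$. $P$ is the joint law of $(T_\infty,\xi)$. Conventions: in $\psi_t$, the term with $|v|=0$ is read as $0$, and for $|v|>0$ the value at $\rho=0$ is read as $-\infty$. Almost surely the maximisers are well defined for all sufficiently large $t$. Scale: $q=\frac{d}{\alpha-d}$, $r(t)=\left(\frac{t}{\log t}\right)^{q+1}$. *)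

theory Defs
  imports "HOL-Probability.Probability"
begin

definition critical_offspring :: "nat pmf \<Rightarrow> bool" where
  "critical_offspring \<mu> \<longleftrightarrow> (\<lambda>n. real n * pmf \<mu> n) sums 1"

text \<open>Meaningful for critical \<open>\<mu>\<close>, when the masses \<open>n * \<mu> n\<close> add up to one.\<close>

definition size_biased :: "nat pmf \<Rightarrow> nat pmf" where
  "size_biased \<mu> = embed_pmf (\<lambda>n. real n * pmf \<mu> n)"

lemma pmf_size_biased:
  assumes "critical_offspring \<mu>"
  shows "pmf (size_biased \<mu>) n = real n * pmf \<mu> n"
  unfolding size_biased_def
proof (rule pmf_embed_pmf)
  have "(\<integral>\<^sup>+ n. ennreal (real n * pmf \<mu> n) \<partial>count_space UNIV) = (\<Sum>n. ennreal (real n * pmf \<mu> n))"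
    by (rule nn_integral_count_space_nat)
  also have "\<dots> = ennreal (\<Sum>n. real n * pmf \<mu> n)"
    using assms by (intro suminf_ennreal2) (auto simp: critical_offspring_def sums_iff)
  finally show "(\<integral>\<^sup>+ n. ennreal (real n * pmf \<mu> n) \<partial>count_space UNIV) = 1"
    using assms by (simp add: critical_offspring_def sums_iff)
qed simp

text \<open>The law of \<open>(S\<^sub>n - n) / (c n\<^sup>1\<^sup>/\<^sup>\<beta>)\<close> for \<open>S\<^sub>n\<close> a sum of \<open>n\<close> independent variables of law \<open>\<mu>\<close>.\<close>

definition rescaled_walk :: "nat pmf \<Rightarrow> real \<Rightarrow> real \<Rightarrow> nat \<Rightarrow> real measure" where
  "rescaled_walk \<mu> \<beta> c n = distr (measure_pmf (map_pmf sum_list (replicate_pmf n \<mu>))) borel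
     (\<lambda>s. (real s - real n) / (c * real n powr (1 / \<beta>)))"

text \<open>The Laplace transform on the positive half-line determines the law.\<close>

definition stable_law :: "real \<Rightarrow> real measure \<Rightarrow> bool" where
  "stable_law \<beta> \<nu> \<longleftrightarrow> real_distribution \<nu> \<and>
     (\<forall>\<theta>>0. has_bochner_integral \<nu> (\<lambda>x. exp (- \<theta> * x)) (exp (\<theta> powr \<beta>)))"

definition pareto :: "real \<Rightarrow> real measure" where
  "pareto \<alpha> = interval_measure (\<lambda>x. if x < 1 then 0 else 1 - x powr (- \<alpha>))"

text \<open>
  Vertices are Ulam--Harris labels: the root is \<open>[]\<close> and the children of \<open>v\<close> are \<open>v @ [i]\<close>.
  Every label, whether or not it ends up in the tree, independently carries
  a normal offspring number, a special offspring number together with the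
  index of the special child, and a value of the potential. The tree consults only the normal or
  only the special entry of a vertex, so its vertices make independent choices, and the potential
  is i.i.d. given the tree.
\<close>

type_synonym env = "nat list \<Rightarrow> nat \<times> (nat \<times> nat) \<times> real"

definition special_offspring :: "nat pmf \<Rightarrow> (nat \<times> nat) pmf" where
  "special_offspring \<mu> =
     bind_pmf (size_biased \<mu>) (\<lambda>k. map_pmf (Pair k) (pmf_of_set {..<k}))"

lemma pmf_special_offspring:
  assumes "critical_offspring \<mu>"
  shows "pmf (special_offspring \<mu>) (k, j) = (if j < k then pmf \<mu> k else 0)"
proof -
  have "pmf (map_pmf (Pair m) (pmf_of_set {..<m})) (k, j)
      = (if m = k then pmf (pmf_of_set {..<k}) j else 0)" for m
    using pmf_map_inj'[of "Pair k" "pmf_of_set {..<k}" j]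
    by (auto simp: inj_on_def pmf_eq_0_set_pmf)
  then have "pmf (special_offspring \<mu>) (k, j)
      = (\<integral>m. pmf (pmf_of_set {..<k}) j * indicator {k} m \<partial>measure_pmf (size_biased \<mu>))"
    unfolding special_offspring_def pmf_bind
    by (intro Bochner_Integration.integral_cong) (auto simp: indicator_def)
  also have "\<dots> = pmf (pmf_of_set {..<k}) j * (real k * pmf \<mu> k)"
    using pmf_size_biased[OF assms, of k] by (simp add: measure_pmf_single)
  also have "\<dots> = (if j < k then pmf \<mu> k else 0)"
    by (cases "k = 0") (auto simp: pmf_of_set[of "{..<k}"] lessThan_empty_iff)
  finally show ?thesis .
qed

definition kesten :: "nat pmf \<Rightarrow> real \<Rightarrow> env measure" where
  "kesten \<mu> \<alpha> = (\<Pi>\<^sub>M v\<in>UNIV.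
     measure_pmf \<mu> \<Otimes>\<^sub>M (measure_pmf (special_offspring \<mu>) \<Otimes>\<^sub>M pareto \<alpha>))"

definition normal_count :: "env \<Rightarrow> nat list \<Rightarrow> nat" where
  "normal_count \<omega> v = fst (\<omega> v)"

definition special_count :: "env \<Rightarrow> nat list \<Rightarrow> nat" where
  "special_count \<omega> v = fst (fst (snd (\<omega> v)))"

definition special_child :: "env \<Rightarrow> nat list \<Rightarrow> nat" where
  "special_child \<omega> v = snd (fst (snd (\<omega> v)))"

definition potential :: "env \<Rightarrow> nat list \<Rightarrow> real" where
  "potential \<omega> v = snd (snd (\<omega> v))"

inductive special :: "env \<Rightarrow> nat list \<Rightarrow> bool" for \<omega> where
  root: "special \<omega> []"
| child: "special \<omega> v \<Longrightarrow> special \<omega> (v @ [special_child \<omega> v])"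

definition offspring :: "env \<Rightarrow> nat list \<Rightarrow> nat" where
  "offspring \<omega> v = (if special \<omega> v then special_count \<omega> v else normal_count \<omega> v)"

inductive_set vertices :: "env \<Rightarrow> nat list set" for \<omega> where
  root: "[] \<in> vertices \<omega>"
| child: "v \<in> vertices \<omega> \<Longrightarrow> i < offspring \<omega> v \<Longrightarrow> v @ [i] \<in> vertices \<omega>"

definition edges :: "env \<Rightarrow> (nat list \<times> nat list) set" where
  "edges \<omega> = {(v, w). v \<in> vertices \<omega> \<and> w \<in> vertices \<omega> \<and> (\<exists>i. w = v @ [i] \<or> v = w @ [i])}"

definition deg :: "env \<Rightarrow> nat list \<Rightarrow> nat" where
  "deg \<omega> v = card {w. (v, w) \<in> edges \<omega>}"

definition height :: "env \<Rightarrow> nat list \<Rightarrow> nat" where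
  "height \<omega> v = (LEAST n. ([], v) \<in> edges \<omega> ^^ n)"

definition psi_at :: "env \<Rightarrow> real \<Rightarrow> nat list \<Rightarrow> real \<Rightarrow> ereal" where
  "psi_at \<omega> t v \<rho> =
    (if height \<omega> v = 0 then ereal ((1 - \<rho>) * (potential \<omega> v - real (deg \<omega> v)))
     else if \<rho> = 0 then - \<infinity>
     else ereal ((1 - \<rho>) * (potential \<omega> v - real (deg \<omega> v))
            - real (height \<omega> v) / t * ln (real (height \<omega> v) / (\<rho> * exp 1 * t))))"

definition psi :: "env \<Rightarrow> real \<Rightarrow> nat list \<Rightarrow> ereal" where
  "psi \<omega> t v = (SUP \<rho>\<in>{0..1}. psi_at \<omega> t v \<rho>)"

definition Z1 :: "env \<Rightarrow> real \<Rightarrow> nat list" where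
  "Z1 \<omega> t = arg_max_on (psi \<omega> t) (vertices \<omega>)"

definition Z2 :: "env \<Rightarrow> real \<Rightarrow> nat list" where
  "Z2 \<omega> t = arg_max_on (psi \<omega> t) (vertices \<omega> - {Z1 \<omega> t})"

text \<open>
  \<open>arg_max_on\<close> is an arbitrary choice when there is no maximiser or more than one, so that events
  about \<open>Z1\<close> and \<open>Z2\<close> need not be measurable. Hence they are considered only where the
  following hold; at fixed \<open>t\<close> these exclude an event whose probability vanishes as \<open>t \<rightarrow> \<infinity>\<close>.
\<close>

definition Z1_defined :: "env \<Rightarrow> real \<Rightarrow> bool" where
  "Z1_defined \<omega> t \<longleftrightarrow> (\<exists>!z. is_arg_max (psi \<omega> t) (\<lambda>v. v \<in> vertices \<omega>) z)"

definition Z2_defined :: "env \<Rightarrow> real \<Rightarrow> bool" where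
  "Z2_defined \<omega> t \<longleftrightarrow> Z1_defined \<omega> t \<and>
     (\<exists>!z. is_arg_max (psi \<omega> t) (\<lambda>v. v \<in> vertices \<omega> - {Z1 \<omega> t}) z)"

definition scale :: "real \<Rightarrow> real \<Rightarrow> real \<Rightarrow> real" where
  "scale d \<alpha> t = (let q = d / (\<alpha> - d) in (t / ln t) powr (q + 1))"

context
  fixes \<alpha> :: real
  assumes pos: "\<alpha> > 0"
begin

private abbreviation "F \<equiv> (\<lambda>x::real. if x < 1 then 0 else 1 - x powr (- \<alpha>))"

private lemma pareto_mono: "x \<le> y \<Longrightarrow> F x \<le> F y"
proof -
  assume "x \<le> y"
  moreover have "y powr (-\<alpha>) \<le> x powr (-\<alpha>)" if "1 \<le> x"
    using that \<open>x \<le> y\<close> pos by (intro powr_mono2') auto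
  moreover have "y powr (-\<alpha>) \<le> 1 powr (-\<alpha>)" if "1 \<le> y"
    using that pos by (intro powr_mono2') auto
  ultimately show ?thesis by auto
qed

private lemma pareto_cont: "continuous_on UNIV F"
proof -
  have "continuous_on ({..1} \<union> {1..}) F"
  proof (rule continuous_on_closed_Un)
    show "continuous_on {..1} F"
      by (rule continuous_on_eq[where f = "\<lambda>_. 0"]) (auto intro: continuous_intros)
    show "continuous_on {1..} F"
      by (rule continuous_on_eq[where f = "\<lambda>x. 1 - x powr (- \<alpha>)"])
         (auto intro!: continuous_intros)
  qed auto
  moreover have "{..1} \<union> {1..} = (UNIV :: real set)" by auto
  ultimately show ?thesis by simp
qed

private lemma pareto_at_bot: "(F \<longlongrightarrow> 0) at_bot"
  by (rule tendsto_eventually) (auto intro: eventually_mono[OF eventually_gt_at_bot[of 1]])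

private lemma pareto_at_top: "(F \<longlongrightarrow> 1) at_top"
proof -
  have "((\<lambda>x. 1 - x powr (- \<alpha>)) \<longlongrightarrow> 1 - 0) at_top"
    using pos by (intro tendsto_diff tendsto_const tendsto_neg_powr filterlim_ident) auto
  moreover have "eventually (\<lambda>x. 1 - x powr (- \<alpha>) = F x) at_top"
    using eventually_ge_at_top[of 1] by eventually_elim auto
  ultimately show ?thesis by (auto intro: Lim_transform_eventually)
qed

private lemma pareto_cont_at_right: "continuous (at_right a) F"
  using pareto_cont by (meson UNIV_I continuous_on_eq_continuous_within continuous_within_subset subset_UNIV)

lemma real_distribution_pareto: "real_distribution (pareto \<alpha>)"
  unfolding pareto_def
  by (intro real_distribution_interval_measure pareto_mono pareto_cont_at_right
        pareto_at_bot pareto_at_top)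

lemma pareto_tail:
  assumes "x \<ge> 1"
  shows "measure (pareto \<alpha>) {x..} = x powr (- \<alpha>)"
proof -
  interpret P: real_distribution "pareto \<alpha>" by (rule real_distribution_pareto)
  have cdf: "cdf (pareto \<alpha>) = F"
    unfolding pareto_def
    by (intro cdf_interval_measure pareto_mono pareto_cont_at_right pareto_at_bot pareto_at_top)
  have "isCont (cdf (pareto \<alpha>)) x"
    unfolding cdf using pareto_cont by (simp add: continuous_on_eq_continuous_at)
  then have 0: "measure (pareto \<alpha>) {x} = 0" by (simp add: P.isCont_cdf)
  have "measure (pareto \<alpha>) {..x} = measure (pareto \<alpha>) {..<x} + measure (pareto \<alpha>) {x}"
    by (subst P.finite_measure_Union[symmetric]) (auto intro!: arg_cong[where f = "measure _"])
  moreover have "measure (pareto \<alpha>) {..x} = 1 - x powr (- \<alpha>)"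
    using cdf[THEN fun_cong, of x] assms by (simp add: cdf_def)
  moreover have "measure (pareto \<alpha>) {x..} = 1 - measure (pareto \<alpha>) {..<x}"
  proof -
    have "space (pareto \<alpha>) - {..<x} = {x..}" by auto
    then show ?thesis using P.prob_compl[of "{..<x}"] by simp
  qed
  ultimately show ?thesis using 0 by simp
qed

end

lemma prob_space_kesten:
  assumes "\<alpha> > 0"
  shows "prob_space (kesten \<mu> \<alpha>)"
proof -
  interpret P: real_distribution "pareto \<alpha>" by (rule real_distribution_pareto) fact
  interpret A: pair_prob_space "measure_pmf (special_offspring \<mu>)" "pareto \<alpha>" ..
  interpret B: pair_prob_space "measure_pmf \<mu>"
    "measure_pmf (special_offspring \<mu>) \<Otimes>\<^sub>M pareto \<alpha>" ..
  show ?thesis unfolding kesten_def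
    by (intro prob_space_PiM B.prob_space_axioms)
qed

lemma height_eq_length:
  assumes "v \<in> vertices \<omega>"
  shows "height \<omega> v = length v"
  unfolding height_def
proof (rule Least_equality)
  show "([], v) \<in> edges \<omega> ^^ length v"
    using assms
    by induction (auto simp: edges_def intro!: relcompI vertices.intros)
next
  fix n assume "([], v) \<in> edges \<omega> ^^ n"
  then show "length v \<le> n"
    by (induction n arbitrary: v) (fastforce simp: edges_def)+
qed

lemma deg_eq_offspring:
  assumes "v \<in> vertices \<omega>"
  shows "deg \<omega> v = offspring \<omega> v + (if v = [] then 0 else 1)"
proof -
  have down: "i < offspring \<omega> w \<and> w \<in> vertices \<omega>" if "w @ [i] \<in> vertices \<omega>" for w i
    using that by (cases rule: vertices.cases) auto
  let ?C = "(\<lambda>i. v @ [i]) ` {..<offspring \<omega> v}"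
  have C: "card ?C = offspring \<omega> v" by (subst card_image) (auto simp: inj_on_def)
  show ?thesis
  proof (cases v rule: rev_cases)
    case Nil
    then have "{w. (v, w) \<in> edges \<omega>} = ?C"
      using assms by (auto simp: edges_def dest: down[of "[]", simplified] vertices.child)
    with C Nil show ?thesis by (simp add: deg_def)
  next
    case (snoc u j)
    then have "{w. (v, w) \<in> edges \<omega>} = insert u ?C"
      using assms by (auto simp: edges_def dest: down down[of "u @ [j]", simplified] vertices.child)
    moreover have "u \<notin> ?C" using snoc by auto
    ultimately show ?thesis using C snoc by (simp add: deg_def)
  qed
qed

end

theory Submission
  imports Defs "HOL-Real_Asymp.Real_Asymp"
begin

text \<open>
  Write \<open>a = (t / log t)\<^sup>q\<close>, so that \<open>r(t)\<^sup>d = a\<^sup>\<alpha>\<close>. Optimising over \<open>\<rho>\<close>, a vertex at height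
  \<open>n\<close> with \<open>D = \<xi> - deg\<close> has \<open>\<psi>\<^sub>t = D - (n / t) log D\<close> as soon as \<open>D > n / t\<close>, and \<open>\<psi>\<^sub>t \<le> 1\<close>
  otherwise, except at the root. Since balls of radius \<open>R\<close> contain of order \<open>R\<^sup>d\<close> vertices, a ball of radius \<open>k r(t)\<close>
  contains two leaves with \<open>\<xi>\<close> at least \<open>\<delta> a\<close>; with \<open>k = \<delta> / 4 q\<close> the cost \<open>(n / t) log D\<close> is at most
  \<open>\<delta> a / 4\<close>, and as \<open>\<alpha> > d\<close> the expected number of such leaves, of order \<open>\<delta>\<^sup>d\<^sup>-\<^sup>\<alpha>\<close>, is large for small
  \<open>\<delta>\<close>. Below height \<open>r(t) / \<lambda>\<close> the potential stays under \<open>\<delta> a / 8\<close>, and beyond \<open>\<lambda> r(t)\<close> no potential pays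
  for its distance; the latter is a union bound over dyadic shells.

  Volumes are never estimated on their own: the probability that the ball of radius \<open>R\<close> contains a vertex
  whose mark lies in a given set satisfies a recursion in \<open>R\<close> through the subtrees at the root. The stable
  limit enters only through two-sided bounds of order \<open>u\<^sup>\<beta>\<close> on \<open>f(1 - u) - (1 - u)\<close>, with \<open>f\<close> the generating
  function of \<open>\<mu>\<close>, and through the truncated second moment of \<open>\<mu>\<close>.
\<close>

section \<open>The offspring law\<close>


text \<open>For \<beta> < 2 the size-biased law has infinite mean, so a ball has infinite expected
  volume and a plain first-moment bound is void; the upper bound truncates the offspring numbers on
  the spine. For the lower bound, the probability \<open>u\<close> that a normal tree contains a
  suitable leaf grows linearly with the radius until the loss, of order
  \<open>u powr \<beta>\<close>, balances the gain \<open>\<mu>\<^sub>0 * s\<close>, with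
  \<open>s\<close> the mass of the potential window; every spine step multiplies the probability of
  a miss by at most \<open>1 - const * u powr (\<beta> - 1)\<close>. Leaves are used because their
  degree is 1, so that \<open>\<xi> - deg\<close> needs no control of the degree. The second
  maximiser requires a second competitor: the two leaves come from disjoint windows of potential
  values and are therefore distinct. On the branch where \<open>\<psi>\<^sub>t\<close> ignores the
  potential ties cannot be excluded, but there \<open>\<psi>\<^sub>t \<le> 1\<close>; uniqueness is
  asserted only above 1, which suffices because the winning level is
  \<open>\<delta> * a / 4\<close>.\<close>

lemma integral_bind_pmf_complex:
  fixes h :: "'a \<Rightarrow> complex"
  assumes "\<And>a. norm (h a) \<le> 1"
  shows "measure_pmf.expectation (bind_pmf p N) h = (\<integral>x. measure_pmf.expectation (N x) h \<partial>measure_pmf p)"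
proof -
  have int: "integrable (measure_pmf q) h" for q
    using assms by (intro measure_pmf.integrable_const_bound[where B=1]) auto
  have int2: "integrable (measure_pmf p) (\<lambda>x. measure_pmf.expectation (N x) h)"
  proof (intro measure_pmf.integrable_const_bound[where B=1] AE_I2)
    fix x
    have "norm (measure_pmf.expectation (N x) h) \<le> (\<integral>a. norm (h a) \<partial>measure_pmf (N x))"
      by (rule integral_norm_bound)
    also have "\<dots> \<le> (\<integral>a. 1 \<partial>measure_pmf (N x))"
      using assms int by (intro integral_mono) auto
    finally show "norm (measure_pmf.expectation (N x) h) \<le> 1" by simp
  qed auto
  have real: "measure_pmf.expectation (bind_pmf p N) g = (\<integral>x. measure_pmf.expectation (N x) g \<partial>measure_pmf p)"
    if "\<And>a. \<bar>g a\<bar> \<le> 1" for g :: "'a \<Rightarrow> real"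
    unfolding measure_pmf_bind using that measurable_measure_pmf[of N]
    by (subst integral_bind[where K="count_space UNIV" and B'=1 and B=1])
       (auto simp: measure_pmf.emeasure_space_1)
  have "\<bar>Re (h a)\<bar> \<le> 1" "\<bar>Im (h a)\<bar> \<le> 1" for a
    using assms[of a] abs_Re_le_cmod[of "h a"] abs_Im_le_cmod[of "h a"] by linarith+
  then show ?thesis
    by (intro complex_eqI) (simp_all add: real int int2 flip: integral_Re integral_Im)
qed

text \<open>Stated for any bounded homomorphism from addition to multiplication, so that it covers
  exponentials of real argument for the Laplace transform and of imaginary argument for the
  characteristic function.\<close>

lemma expectation_sum_list_replicate:
  fixes h :: "nat \<Rightarrow> complex"
  assumes "h 0 = 1" "\<And>a b. h (a + b) = h a * h b" "\<And>a. norm (h a) \<le> 1"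
  shows "measure_pmf.expectation (map_pmf sum_list (replicate_pmf n p)) h
       = measure_pmf.expectation p h ^ n"
proof (induction n)
  case 0
  then show ?case using assms by simp
next
  case (Suc n)
  have *: "map_pmf sum_list (replicate_pmf (Suc n) p)
      = bind_pmf p (\<lambda>x. map_pmf (\<lambda>s. x + s) (map_pmf sum_list (replicate_pmf n p)))"
    by (simp add: map_bind_pmf map_pmf_def bind_assoc_pmf bind_return_pmf)
  have "measure_pmf.expectation (map_pmf sum_list (replicate_pmf (Suc n) p)) h
      = (\<integral>x. h x * measure_pmf.expectation (map_pmf sum_list (replicate_pmf n p)) h \<partial>measure_pmf p)"
    unfolding * by (subst integral_bind_pmf_complex) (auto simp: assms)
  also have "\<dots> = measure_pmf.expectation p h ^ Suc n"
    unfolding Suc by simp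
  finally show ?case .
qed

lemma expectation_sum_list_replicate_real:
  fixes h :: "nat \<Rightarrow> real"
  assumes "h 0 = 1" "\<And>a b. h (a + b) = h a * h b" "\<And>a. \<bar>h a\<bar> \<le> 1"
  shows "measure_pmf.expectation (map_pmf sum_list (replicate_pmf n p)) h
       = measure_pmf.expectation p h ^ n"
proof -
  have "complex_of_real (measure_pmf.expectation (map_pmf sum_list (replicate_pmf n p)) h)
     = complex_of_real (measure_pmf.expectation p h ^ n)"
    using expectation_sum_list_replicate[of "\<lambda>a. complex_of_real (h a)" n p] assms
    by (simp del: integral_map_pmf)
  then show ?thesis by (simp only: of_real_eq_iff)
qed

lemma
  assumes "critical_offspring \<mu>"
  shows integrable_critical_offspring: "integrable (measure_pmf \<mu>) real"
    and expectation_critical_offspring: "measure_pmf.expectation \<mu> real = 1"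
proof -
  have s: "(\<lambda>n. real n * pmf \<mu> n) sums 1" using assms by (simp add: critical_offspring_def)
  have "(\<integral>\<^sup>+ n. ennreal (real n) \<partial>measure_pmf \<mu>) = (\<integral>\<^sup>+ n. ennreal (real n * pmf \<mu> n) \<partial>count_space UNIV)"
    by (subst nn_integral_measure_pmf) (simp add: ennreal_mult mult.commute)
  also have "\<dots> = (\<Sum>n. ennreal (real n * pmf \<mu> n))"
    by (rule nn_integral_count_space_nat)
  also have "\<dots> = ennreal 1"
    using s by (intro suminf_ennreal_eq) (auto simp: sums_iff)
  finally have nn: "(\<integral>\<^sup>+ n. ennreal (real n) \<partial>measure_pmf \<mu>) = ennreal 1" .
  show "integrable (measure_pmf \<mu>) real" using nn by (intro integrableI_nonneg) auto
  show "measure_pmf.expectation \<mu> real = 1" using nn by (intro integral_eq_nn_integral[THEN trans]) auto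
qed

text \<open>As \<open>1 - cos x = 2 * (sin (x / 2))\<^sup>2\<close> and
  \<open>\<bar>sin\<bar>\<close> is subadditive, \<open>1 - cos\<close> behaves like a squared
  distance, for which the triangle inequality costs a factor 2. This is used to undo the rotation of
  \<open>phi\<close>.\<close>

lemma one_minus_cos_add_le: "1 - cos (a + b) \<le> 2 * (1 - cos a) + 2 * (1 - cos (b::real))"
proof -
  have half: "1 - cos x = 2 * (sin (x / 2))\<^sup>2" for x :: real
    using cos_double_sin[of "x / 2"] by simp
  have "\<bar>sin (a / 2 + b / 2)\<bar> \<le> \<bar>sin (a / 2) * cos (b / 2)\<bar> + \<bar>cos (a / 2) * sin (b / 2)\<bar>"
    unfolding sin_add by (rule abs_triangle_ineq)
  also have "\<dots> \<le> \<bar>sin (a / 2)\<bar> * 1 + 1 * \<bar>sin (b / 2)\<bar>"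
    unfolding abs_mult by (intro add_mono mult_mono) auto
  finally have "(sin (a / 2 + b / 2))\<^sup>2 \<le> (\<bar>sin (a / 2)\<bar> + \<bar>sin (b / 2)\<bar>)\<^sup>2"
    using power_mono[of "\<bar>sin (a / 2 + b / 2)\<bar>" _ 2] by simp
  also have "\<dots> \<le> 2 * (sin (a / 2))\<^sup>2 + 2 * (sin (b / 2))\<^sup>2"
    using sum_squares_bound[of "\<bar>sin (a / 2)\<bar>" "\<bar>sin (b / 2)\<bar>"] by (simp add: power2_sum)
  finally show ?thesis unfolding half by (simp add: add_divide_distrib)
qed

text \<open>With \<open>y = \<bar>x\<bar> / 2\<close> one has \<open>sin y \<ge> 3 / 4 * y\<close>
  on [0, 1/2], and \<open>2 * (3 / 4)\<^sup>2 \<ge> 1\<close>.\<close>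

lemma one_minus_cos_ge:
  assumes "\<bar>x::real\<bar> \<le> 1"
  shows "1 - cos x \<ge> x\<^sup>2 / 4"
proof -
  define y where "y = \<bar>x\<bar> / 2"
  have y: "0 \<le> y" "y \<le> 1/2" using assms by (auto simp: y_def)
  have "\<bar>sin y - y\<bar> \<le> y ^ 3 / 6"
    using Maclaurin_sin_bound[of y 3] y by (simp add: eval_nat_numeral sin_coeff_def)
  moreover have "y * (y * y) \<le> y * (1/2 * (1/2))" using y by (intro mult_mono) auto
  then have "y ^ 3 \<le> y / 4" by (simp add: power3_eq_cube)
  ultimately have "sin y \<ge> 3 / 4 * y" using y by linarith
  then have "(3 / 4 * y)\<^sup>2 \<le> (sin y)\<^sup>2" using y by (intro power_mono) auto
  then have "9 / 16 * y\<^sup>2 \<le> (sin y)\<^sup>2" by (simp add: power_mult_distrib power_divide)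
  then have "y\<^sup>2 \<le> 2 * (sin y)\<^sup>2" using zero_le_power2[of "sin y"] by linarith
  then show ?thesis using cos_double_sin[of y] by (simp add: y_def power_divide)
qed

locale stable_offspring =
  fixes \<mu> :: "nat pmf" and \<nu> :: "real measure" and \<beta> c :: real
  assumes critical: "critical_offspring \<mu>"
    and beta_gt: "1 < \<beta>" and beta_le: "\<beta> \<le> 2" and c_pos: "c > 0"
    and stable: "stable_law \<beta> \<nu>" and weak_conv: "weak_conv_m (rescaled_walk \<mu> \<beta> c) \<nu>"
begin

text \<open>If every subtree at the root succeeds independently with probability \<open>u\<close>,
  then some subtree succeeds with probability \<open>1 - f (1 - u) = u - kap u\<close>, where
  \<open>f\<close> is the generating function: \<open>kap\<close> is what is lost per generation to
  simultaneous successes.\<close>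

definition kap :: "real \<Rightarrow> real" where
  "kap u = measure_pmf.expectation \<mu> (\<lambda>n. (1 - u) ^ n) - (1 - u)"

lemmas integrable_mu = integrable_critical_offspring[OF critical]
lemmas expectation_mu = expectation_critical_offspring[OF critical]

lemma integrable_mu_power: "0 \<le> s \<Longrightarrow> s \<le> 1 \<Longrightarrow> integrable (measure_pmf \<mu>) (\<lambda>n. s ^ n :: real)"
  by (intro measure_pmf.integrable_const_bound[where B=1]) (auto simp: power_le_one)

text \<open>Criticality makes the generating function 1-Lipschitz on the unit interval, while
  \<open>1 - u\<close> has slope exactly -1.\<close>

lemma kap_mono:
  assumes "0 \<le> u" "u \<le> v" "v \<le> 1"
  shows "kap u \<le> kap v"
proof -
  have p: "(1 - u) ^ n - (1 - v) ^ n \<le> real n * (v - u)" for n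
  proof (induction n)
    case (Suc n)
    have "(1 - u) ^ Suc n - (1 - v) ^ Suc n = (1 - u) * ((1 - u) ^ n - (1 - v) ^ n) + (1 - v) ^ n * (v - u)"
      by (simp add: algebra_simps)
    also have "(1 - v) ^ n * (v - u) \<le> 1 * (v - u)"
      using assms by (intro mult_right_mono power_le_one) auto
    also have "(1 - u) * ((1 - u) ^ n - (1 - v) ^ n) \<le> 1 * ((1 - u) ^ n - (1 - v) ^ n)"
      using assms by (intro mult_right_mono) (auto intro: power_mono)
    finally show ?case using Suc by (simp add: algebra_simps)
  qed simp
  have "measure_pmf.expectation \<mu> (\<lambda>n. (1 - u) ^ n) - measure_pmf.expectation \<mu> (\<lambda>n. (1 - v) ^ n)
      = measure_pmf.expectation \<mu> (\<lambda>n. (1 - u) ^ n - (1 - v) ^ n)"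
    using assms by (intro Bochner_Integration.integral_diff[symmetric] integrable_mu_power) auto
  also have "\<dots> \<le> measure_pmf.expectation \<mu> (\<lambda>n. real n * (v - u))"
    using assms p integrable_mu by (intro integral_mono Bochner_Integration.integrable_diff integrable_mu_power) auto
  also have "\<dots> = v - u" using expectation_mu by simp
  finally show ?thesis by (simp add: kap_def)
qed

lemma kap_0: "kap 0 = 0" by (simp add: kap_def)

lemma real_distribution_nu: "real_distribution \<nu>"
  using stable by (simp add: stable_law_def)

lemma real_distribution_walk: "real_distribution (rescaled_walk \<mu> \<beta> c n)"
  unfolding rescaled_walk_def real_distribution_def real_distribution_axioms_def
  by (auto intro!: measure_pmf.prob_space_distr)

lemma integral_rescaled_walk:
  fixes g :: "real \<Rightarrow> 'a :: {banach, second_countable_topology}"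
  assumes "g \<in> borel_measurable borel"
  shows "integral\<^sup>L (rescaled_walk \<mu> \<beta> c n) g =
    measure_pmf.expectation (map_pmf sum_list (replicate_pmf n \<mu>))
      (\<lambda>s. g ((real s - real n) / (c * real n powr (1 / \<beta>))))"
  unfolding rescaled_walk_def using assms by (subst integral_distr) auto

text \<open>
  The exponential is unbounded, so weak convergence only gives a lower bound for Laplace transforms,
  by truncation.
\<close>

lemma exp_min_integral:
  obtains M where "M > 0" "(\<integral>x. min (exp (- x)) M \<partial>\<nu>) > 2"
proof -
  interpret N: real_distribution \<nu> by (rule real_distribution_nu)
  have 1: "has_bochner_integral \<nu> (\<lambda>x. exp (- 1 * x)) (exp (1 powr \<beta>))"
    using stable unfolding stable_law_def by (metis zero_less_one)
  then have i: "integrable \<nu> (\<lambda>x. exp (- x))" "(\<integral>x. exp (- x) \<partial>\<nu>) = exp 1"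
    by (auto simp: has_bochner_integral_iff)
  have "(\<lambda>k. \<integral>x. min (exp (- x)) (real k) \<partial>\<nu>) \<longlonglongrightarrow> (\<integral>x. exp (- x) \<partial>\<nu>)"
  proof (rule integral_dominated_convergence[where w="\<lambda>x. exp (- x)"])
    show "AE x in \<nu>. (\<lambda>k. min (exp (- x)) (real k)) \<longlonglongrightarrow> exp (- x)"
    proof (rule AE_I2)
      fix x
      have "eventually (\<lambda>k. min (exp (- x)) (real k) = exp (- x)) sequentially"
        using eventually_ge_at_top[of "nat \<lceil>exp (- x)\<rceil>"]
        by eventually_elim (simp add: min_def nat_le_iff ceiling_le_iff)
      then show "(\<lambda>k. min (exp (- x)) (real k)) \<longlonglongrightarrow> exp (- x)"
        by (rule tendsto_eventually)
    qed
  qed (use i in auto)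
  moreover have "exp 1 > (2::real)" using exp_lower_Taylor_quadratic[of 1] by simp
  ultimately have "eventually (\<lambda>k. (\<integral>x. min (exp (- x)) (real k) \<partial>\<nu>) > 2) sequentially"
    unfolding i by (simp add: order_tendsto_iff)
  then obtain k where "k > 0" "(\<integral>x. min (exp (- x)) (real k) \<partial>\<nu>) > 2"
    using eventually_conj[OF _ eventually_gt_at_top[of 0]] by (metis (mono_tags, lifting) eventually_sequentially nle_le)
  then show ?thesis using that[of "real k"] by simp
qed

text \<open>With \<open>h\<close> the inverse scale, the mean of
  \<open>exp (- h * (S_n - n))\<close> is an \<open>n\<close>-th power by independence, and the
  limit law has transform \<open>exp 1 > 2\<close> at 1. A lower bound above 1 for the
  \<open>n\<close>-th power puts the base above 1 by order \<open>1 / n\<close>.\<close>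

lemma laplace_walk_large:
  "eventually (\<lambda>n. (let h = 1 / (c * real n powr (1 / \<beta>)) in
     (exp h * measure_pmf.expectation \<mu> (\<lambda>k. exp (- h) ^ k)) ^ n) \<ge> 2) sequentially"
proof -
  obtain M where M: "M > 0" "(\<integral>x. min (exp (- x)) M \<partial>\<nu>) > 2" using exp_min_integral .
  have "(\<lambda>n. \<integral>x. min (exp (- x)) M \<partial>rescaled_walk \<mu> \<beta> c n) \<longlonglongrightarrow> (\<integral>x. min (exp (- x)) M \<partial>\<nu>)"
    by (rule weak_conv_imp_integral_bdd_continuous_conv[OF real_distribution_walk real_distribution_nu weak_conv, where B=M])
       (use M in \<open>auto intro!: continuous_intros\<close>)
  then have "eventually (\<lambda>n. (\<integral>x. min (exp (- x)) M \<partial>rescaled_walk \<mu> \<beta> c n) > 2) sequentially"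
    using M by (simp add: order_tendsto_iff)
  then show ?thesis using eventually_gt_at_top[of 0]
  proof eventually_elim
    case (elim n)
    define h where "h = 1 / (c * real n powr (1 / \<beta>))"
    have h: "h > 0" unfolding h_def using c_pos elim by simp
    let ?S = "map_pmf sum_list (replicate_pmf n \<mu>)"
    have e: "- ((real s - real n) / (c * real n powr (1 / \<beta>))) = real n * h - h * real s" for s
      by (simp add: h_def diff_divide_distrib)
    have bd: "exp (- (h * real s)) \<le> 1" for s :: nat using h by simp
    have int: "integrable (measure_pmf ?S) (\<lambda>s. exp (- (h * real s)))"
      using bd by (intro measure_pmf.integrable_const_bound[where B=1]) (auto simp del: integrable_map_pmf_eq)
    have pw: "measure_pmf.expectation ?S (\<lambda>s. exp (- (h * real s)))
        = measure_pmf.expectation \<mu> (\<lambda>k. exp (- (h * real k))) ^ n"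
      using h by (intro expectation_sum_list_replicate_real) (auto simp: algebra_simps simp flip: exp_add)
    have "2 < (\<integral>x. min (exp (- x)) M \<partial>rescaled_walk \<mu> \<beta> c n)" by fact
    also have "\<dots> = measure_pmf.expectation ?S (\<lambda>s. min (exp (real n * h - h * real s)) M)"
      by (subst integral_rescaled_walk) (auto simp: e simp del: integral_map_pmf)
    also have "\<dots> \<le> measure_pmf.expectation ?S (\<lambda>s. exp (real n * h) * exp (- (h * real s)))"
    proof (rule integral_mono)
      show "integrable (measure_pmf ?S) (\<lambda>s. min (exp (real n * h - h * real s)) M)"
        using M by (intro measure_pmf.integrable_const_bound[where B=M] AE_I2) (auto simp: min_def)
      show "integrable (measure_pmf ?S) (\<lambda>s. exp (real n * h) * exp (- (h * real s)))"
        using int by simp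
    qed (auto simp: exp_diff exp_minus divide_inverse)
    also have "\<dots> = exp h ^ n * measure_pmf.expectation \<mu> (\<lambda>k. exp (- (h * real k))) ^ n"
      unfolding pw[symmetric] by (simp del: integral_map_pmf add: exp_of_nat_mult)
    finally show ?case
      by (simp add: Let_def h_def[symmetric] power_mult_distrib exp_of_nat_mult[symmetric] mult.commute)
  qed
qed

text \<open>For \<open>n\<close> of order \<open>u powr (- \<beta>)\<close> and
  \<open>s = exp (- h)\<close>, the transform bound forces
  \<open>F / s \<ge> 1 + 1 / (2 * n)\<close>, so \<open>kap (1 - s)\<close> is at least of order
  \<open>u powr \<beta>\<close>. Since \<open>1 - s \<le> h \<le> u\<close>, monotonicity of
  \<open>kap\<close> carries this over to \<open>u\<close>.\<close>

lemma kap_lower: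
  obtains C where "C > 0" "\<And>u. 0 \<le> u \<Longrightarrow> u \<le> 1 \<Longrightarrow> kap u \<ge> C * u powr \<beta>"
proof -
  obtain n0 where n0: "\<And>n. n \<ge> n0 \<Longrightarrow> (let h = 1 / (c * real n powr (1 / \<beta>)) in
     (exp h * measure_pmf.expectation \<mu> (\<lambda>k. exp (- h) ^ k)) ^ n) \<ge> 2"
    using laplace_walk_large by (auto simp: eventually_sequentially)
  \<comment> \<open>\<open>K\<close> absorbs the rounding and the threshold \<open>n0\<close>, as
    \<open>u powr (- \<beta>) \<ge> 1\<close>. The factor \<open>exp (- (1 / c))\<close> in
    \<open>C\<close> is a lower bound for \<open>s\<close>, because \<open>n \<ge> 1\<close> gives
    \<open>h \<le> 1 / c\<close>.\<close>
  define K where "K = c powr (- \<beta>) + real n0 + 2"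
  define C where "C = exp (- (1 / c)) / (2 * K)"
  have K: "K > 0" by (simp add: K_def add_nonneg_pos)
  then have C: "C > 0" by (simp add: C_def)
  have "kap u \<ge> C * u powr \<beta>" if u: "0 < u" "u \<le> 1" for u
  proof -
    define n where "n = nat \<lceil>(c * u) powr (- \<beta>)\<rceil> + n0 + 1"
    have n: "n \<ge> n0" "n \<ge> 1" by (simp_all add: n_def)
    have ncu: "real n \<ge> (c * u) powr (- \<beta>)" by (simp add: n_def) linarith
    have "real n \<le> (c * u) powr (- \<beta>) + 1 + real n0 + 1"
      unfolding n_def using real_nat_ceiling_ge[of "(c * u) powr (- \<beta>)"] powr_ge_zero[of "c * u" "- \<beta>"] by simp linarith
    also have "\<dots> = c powr (- \<beta>) * u powr (- \<beta>) + (real n0 + 2)"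
      using c_pos u by (simp add: powr_mult)
    also have "real n0 + 2 \<le> (real n0 + 2) * u powr (- \<beta>)"
      using mult_left_mono[OF powr_mono'[of "- \<beta>" 0 u], of "real n0 + 2"] u beta_gt by simp
    finally have nK: "real n \<le> K * u powr (- \<beta>)" by (simp add: K_def algebra_simps)
    define h where "h = 1 / (c * real n powr (1 / \<beta>))"
    have h: "h > 0" using n c_pos by (simp add: h_def)
    have "((c * u) powr (- \<beta>)) powr (1 / \<beta>) \<le> real n powr (1 / \<beta>)"
      using ncu beta_gt by (intro powr_mono2) auto
    then have "1 / (c * u) \<le> real n powr (1 / \<beta>)"
      using beta_gt c_pos u powr_powr[of "c * u" "- \<beta>" "1 / \<beta>"] by (simp add: powr_minus_divide)
    then have hu: "h \<le> u" unfolding h_def using c_pos u n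
      by (simp add: field_simps)
    have "c * 1 powr (1 / \<beta>) \<le> c * real n powr (1 / \<beta>)"
      using n c_pos beta_gt by (intro mult_left_mono powr_mono2) auto
    then have hc: "h \<le> 1 / c" unfolding h_def using c_pos n by (intro divide_left_mono) auto
    define s where "s = exp (- h)"
    have s: "0 < s" "s \<le> 1" "1 - s \<le> h" using h exp_ge_add_one_self[of "- h"] by (auto simp: s_def)
    define F where "F = measure_pmf.expectation \<mu> (\<lambda>k. s ^ k)"
    have F: "(F / s) ^ n \<ge> 2" using n0[OF n(1)] unfolding Let_def h_def[symmetric] s_def F_def by (simp add: exp_minus divide_inverse mult.commute)
    have F0: "F \<ge> 0" unfolding F_def using s by simp
    have "F / s \<ge> 1 + 1 / (2 * real n)"
    proof (rule ccontr)
      assume "\<not> ?thesis"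
      then have "(F / s) ^ n \<le> (1 + 1 / (2 * real n)) ^ n" using F0 s by (intro power_mono) auto
      also have "\<dots> \<le> exp (1 / (2 * real n)) ^ n"
        by (intro power_mono exp_ge_add_one_self) auto
      also have "\<dots> = exp (1 / 2)" using n by (simp flip: exp_of_nat_mult)
      also have "\<dots> < 2"
      proof -
        have "exp (1 / 2 :: real) ^ 2 = exp 1" by (simp flip: exp_of_nat_mult)
        then have "exp (1 / 2 :: real) ^ 2 < 2 ^ 2" using exp_le by simp
        then show ?thesis by (rule power_less_imp_less_base) simp
      qed
      finally show False using F by simp
    qed
    then have "s / (2 * real n) \<le> F - s" using s n by (simp add: field_simps)
    moreover have "exp (- (1 / c)) / (2 * real n) \<le> s / (2 * real n)"
      using hc unfolding s_def by (intro divide_right_mono) auto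
    moreover have "C * u powr \<beta> \<le> exp (- (1 / c)) / (2 * real n)"
    proof -
      have "real n * u powr \<beta> \<le> K * u powr (- \<beta>) * u powr \<beta>" using nK by (intro mult_right_mono) auto
      also have "\<dots> = K" using u by (simp add: mult.assoc flip: powr_add)
      finally have "u powr \<beta> / K \<le> 1 / real n" using n K by (simp add: field_simps)
      then have "exp (- (1 / c)) / 2 * (u powr \<beta> / K) \<le> exp (- (1 / c)) / 2 * (1 / real n)"
        by (intro mult_left_mono) auto
      then show ?thesis by (simp add: C_def field_simps)
    qed
    moreover have "F - s = kap (1 - s)" by (simp add: kap_def F_def)
    moreover have "kap (1 - s) \<le> kap u" using s hu u by (intro kap_mono) auto
    ultimately show ?thesis by linarith
  qed
  then have "kap u \<ge> C * u powr \<beta>" if "0 \<le> u" "u \<le> 1" for u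
    using that kap_0 by (cases "u = 0") auto
  with C that show ?thesis by blast
qed

text \<open>The generating function at 0 is \<open>kap 1\<close>, so this is the lower bound at
  \<open>u = 1\<close>. Both the rotation estimate for \<open>phi\<close> and the supply of leaves
  rest on this mass.\<close>

lemma pmf_mu_0_pos: "pmf \<mu> 0 > 0"
proof -
  obtain C where C: "C > 0" "\<And>u. 0 \<le> u \<Longrightarrow> u \<le> 1 \<Longrightarrow> kap u \<ge> C * u powr \<beta>" using kap_lower by blast
  have "kap 1 = measure_pmf.expectation \<mu> (\<lambda>n. indicator {0} n)"
    unfolding kap_def by (auto simp: indicator_def power_0_left intro!: Bochner_Integration.integral_cong)
  also have "\<dots> = pmf \<mu> 0" by (simp add: measure_pmf_single)
  finally show ?thesis using C(1) C(2)[of 1] by simp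
qed

section \<open>Characteristic function and truncated moments of the offspring law\<close>

definition phi :: "real \<Rightarrow> complex" where
  "phi \<theta> = measure_pmf.expectation \<mu> (\<lambda>k. cis (\<theta> * real k))"

lemma integrable_cis: "integrable (measure_pmf \<mu>) (\<lambda>k. cis (g k))"
  by (intro measure_pmf.integrable_const_bound[where B=1]) auto

lemma integrable_cos: "integrable (measure_pmf \<mu>) (\<lambda>k. cos (g k) :: real)"
  by (intro measure_pmf.integrable_const_bound[where B=1]) auto

text \<open>
  Symmetrisation in disguise: rotating \<open>phi \<theta>\<close> to the positive axis, the atom of \<open>\<mu>\<close> at \<open>0\<close> controls the
  rotation angle.
\<close>

lemma one_minus_cos_expectation:
  "pmf \<mu> 0 * measure_pmf.expectation \<mu> (\<lambda>k. 1 - cos (\<theta> * real k)) \<le> 4 * (1 - norm (phi \<theta>))"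
proof -
  define \<gamma> where "\<gamma> = Arg (phi \<theta>)"
  define p where "p = pmf \<mu> 0"
  have p: "0 \<le> p" "p \<le> 1" by (auto simp: p_def pmf_le_1)
  have "cis (- \<gamma>) * phi \<theta> = of_real (norm (phi \<theta>))"
    unfolding \<gamma>_def by (subst (2) rcis_cmod_Arg[symmetric]) (simp add: rcis_def cis_mult mult.left_commute)
  then have "norm (phi \<theta>) = Re (cis (- \<gamma>) * phi \<theta>)" by simp
  also have "cis (- \<gamma>) * phi \<theta> = measure_pmf.expectation \<mu> (\<lambda>k. cis (\<theta> * real k - \<gamma>))"
    unfolding phi_def by (simp add: cis_mult flip: integral_mult_right_zero)
  also have "Re \<dots> = measure_pmf.expectation \<mu> (\<lambda>k. cos (\<theta> * real k - \<gamma>))"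
    by (subst integral_Re[symmetric]) (auto intro: integrable_cis)
  finally have eq: "1 - norm (phi \<theta>) = measure_pmf.expectation \<mu> (\<lambda>k. 1 - cos (\<theta> * real k - \<gamma>))"
    by (simp add: integrable_cos)
  have "p * (1 - cos \<gamma>) = measure_pmf.expectation \<mu> (\<lambda>k. (1 - cos \<gamma>) * indicator {0} k)"
    by (simp add: p_def measure_pmf_single)
  also have "\<dots> \<le> measure_pmf.expectation \<mu> (\<lambda>k. 1 - cos (\<theta> * real k - \<gamma>))"
    by (intro integral_mono measure_pmf.integrable_const_bound[where B=2]) (auto simp: integrable_cos indicator_def abs_le_iff)
  finally have 1: "p * (1 - cos \<gamma>) \<le> 1 - norm (phi \<theta>)" using eq by simp
  have "measure_pmf.expectation \<mu> (\<lambda>k. 1 - cos (\<theta> * real k))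
      \<le> measure_pmf.expectation \<mu> (\<lambda>k. 2 * (1 - cos (\<theta> * real k - \<gamma>)) + 2 * (1 - cos \<gamma>))"
    using one_minus_cos_add_le[of "\<theta> * real k - \<gamma>" \<gamma> for k]
    by (intro integral_mono) (auto simp: integrable_cos)
  also have "\<dots> = 2 * (1 - norm (phi \<theta>)) + 2 * (1 - cos \<gamma>)"
    unfolding eq by (simp add: integrable_cos)
  finally have "p * measure_pmf.expectation \<mu> (\<lambda>k. 1 - cos (\<theta> * real k)) \<le> p * (2 * (1 - norm (phi \<theta>)) + 2 * (1 - cos \<gamma>))"
    using p by (intro mult_left_mono) auto
  also have "\<dots> = p * (2 * (1 - norm (phi \<theta>))) + 2 * (p * (1 - cos \<gamma>))" by (simp add: algebra_simps)
  also have "\<dots> \<le> 1 * (2 * (1 - norm (phi \<theta>))) + 2 * (1 - norm (phi \<theta>))"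
  proof (intro add_mono mult_right_mono mult_left_mono)
    show "0 \<le> 2 * (1 - norm (phi \<theta>))"
      unfolding eq by (auto intro!: integral_nonneg_AE)
  qed (use p 1 in auto)
  finally show ?thesis by (simp add: p_def)
qed

text \<open>Centring by \<open>n\<close> contributes a phase only, so it disappears in absolute
  value.\<close>

lemma norm_char_walk:
  "norm (char (rescaled_walk \<mu> \<beta> c n) t) = norm (phi (t / (c * real n powr (1 / \<beta>)))) ^ n"
proof -
  define \<theta> where "\<theta> = t / (c * real n powr (1 / \<beta>))"
  let ?S = "map_pmf sum_list (replicate_pmf n \<mu>)"
  have "char (rescaled_walk \<mu> \<beta> c n) t = measure_pmf.expectation ?S (\<lambda>s. cis (- \<theta> * real n) * cis (\<theta> * real s))"
    unfolding char_def
    by (subst integral_rescaled_walk)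
       (auto simp: \<theta>_def cis_conv_exp algebra_simps diff_divide_distrib simp del: integral_map_pmf simp flip: exp_add
         intro!: Bochner_Integration.integral_cong)
  also have "\<dots> = cis (- \<theta> * real n) * measure_pmf.expectation ?S (\<lambda>s. cis (\<theta> * real s))"
    by (rule integral_mult_right_zero)
  also have "measure_pmf.expectation ?S (\<lambda>s. cis (\<theta> * real s)) = phi \<theta> ^ n"
    unfolding phi_def
    by (intro expectation_sum_list_replicate) (auto simp: algebra_simps cis_mult)
  finally show ?thesis by (simp add: norm_mult norm_power \<theta>_def)
qed

text \<open>The characteristic function of the limit is continuous with value 1 at 0, so one fixed
  frequency \<open>t\<close> serves for all large \<open>n\<close>; varying \<open>n\<close> then
  reaches every small scale of \<open>\<theta> = t / (c * n powr (1 / \<beta>))\<close>.\<close>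

lemma char_walk_large:
  obtains t where "t > 0" "eventually (\<lambda>n. norm (phi (t / (c * real n powr (1 / \<beta>)))) ^ n \<ge> 1 / 2) sequentially"
proof -
  interpret N: real_distribution \<nu> by (rule real_distribution_nu)
  have "isCont (\<lambda>t. norm (char \<nu> t)) 0" by (intro continuous_intros N.isCont_char)
  then have "((\<lambda>t. norm (char \<nu> t)) \<longlongrightarrow> 1) (at 0)" by (simp add: isCont_def N.char_zero)
  then have "eventually (\<lambda>t. norm (char \<nu> t) > 1 / 2) (at 0)" by (rule order_tendstoD) simp
  then have "eventually (\<lambda>t. norm (char \<nu> t) > 1 / 2) (at_right 0)"
    by (simp add: eventually_at_split)
  then have "eventually (\<lambda>t. norm (char \<nu> t) > 1 / 2 \<and> t > 0) (at_right 0)"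
    using eventually_at_right_less[of 0] by (rule eventually_conj)
  then obtain t where t: "t > 0" "norm (char \<nu> t) > 1 / 2"
    using eventually_happens'[OF trivial_limit_at_right_real] by blast
  have "(\<lambda>n. norm (char (rescaled_walk \<mu> \<beta> c n) t)) \<longlonglongrightarrow> norm (char \<nu> t)"
    by (intro tendsto_norm levy_continuity1 real_distribution_walk real_distribution_nu weak_conv)
  then have "eventually (\<lambda>n. norm (char (rescaled_walk \<mu> \<beta> c n) t) > 1 / 2) sequentially"
    using t(2) by (rule order_tendstoD)
  then have "eventually (\<lambda>n. norm (phi (t / (c * real n powr (1 / \<beta>)))) ^ n \<ge> 1 / 2) sequentially"
    unfolding norm_char_walk by (auto elim: eventually_mono)
  with t that show ?thesis by blast
qed

text \<open>If \<open>\<theta> * y \<le> 1\<close>, then \<open>1 - cos (\<theta> * k)\<close>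
  dominates \<open>(\<theta> * k)\<^sup>2 / 4\<close> for \<open>k \<le> y\<close>, while its mean
  is at most \<open>4 / (p * n)\<close> at the frequency belonging to \<open>n\<close> steps. For
  \<open>n\<close> of order \<open>y powr \<beta>\<close> the quotient
  \<open>1 / (n * \<theta>\<^sup>2)\<close> is of order \<open>y powr (2 - \<beta>)\<close>.\<close>

lemma truncated_second_moment:
  obtains C where "C > 0"
    "\<And>y. 1 \<le> y \<Longrightarrow> measure_pmf.expectation \<mu> (\<lambda>k. (real k)\<^sup>2 * indicator {k. real k \<le> y} k) \<le> C * y powr (2 - \<beta>)"
proof -
  obtain t where t: "t > 0" "eventually (\<lambda>n. norm (phi (t / (c * real n powr (1 / \<beta>)))) ^ n \<ge> 1 / 2) sequentially"
    using char_walk_large by blast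
  then obtain n0 where n0: "\<And>n. n \<ge> n0 \<Longrightarrow> norm (phi (t / (c * real n powr (1 / \<beta>)))) ^ n \<ge> 1 / 2"
    by (auto simp: eventually_sequentially)
  define p where "p = pmf \<mu> 0"
  have p: "p > 0" using pmf_mu_0_pos by (simp add: p_def)
  define K where "K = (t / c) powr \<beta> + real n0 + 2"
  have K: "K > 0" by (simp add: K_def add_nonneg_pos)
  define C where "C = 16 / p * (c / t)\<^sup>2 * K powr (2 / \<beta> - 1)"
  have C: "C > 0" using p K c_pos t by (simp add: C_def)
  have main: "measure_pmf.expectation \<mu> (\<lambda>k. (real k)\<^sup>2 * indicator {k. real k \<le> y} k) \<le> C * y powr (2 - \<beta>)"
    if y: "1 \<le> y" for y
  proof -
    define n where "n = nat \<lceil>(t * y / c) powr \<beta>\<rceil> + n0 + 1"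
    have n: "n \<ge> n0" "n \<ge> 1" by (simp_all add: n_def)
    have nge: "real n \<ge> (t * y / c) powr \<beta>" by (simp add: n_def) linarith
    have "real n \<le> (t * y / c) powr \<beta> + 1 + real n0 + 1"
      unfolding n_def using powr_ge_zero[of "t * y / c" \<beta>] by simp linarith
    also have "\<dots> = (t / c) powr \<beta> * y powr \<beta> + (real n0 + 2)"
      using c_pos t y by (simp flip: powr_mult)
    also have "real n0 + 2 \<le> (real n0 + 2) * y powr \<beta>"
      using mult_left_mono[OF ge_one_powr_ge_zero[of y \<beta>], of "real n0 + 2"] y beta_gt by simp
    finally have nK: "real n \<le> K * y powr \<beta>" by (simp add: K_def algebra_simps)
    define \<theta> where "\<theta> = t / (c * real n powr (1 / \<beta>))"
    have \<theta>: "\<theta> > 0" using t n c_pos by (simp add: \<theta>_def)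
    have "((t * y / c) powr \<beta>) powr (1 / \<beta>) \<le> real n powr (1 / \<beta>)"
      using nge beta_gt by (intro powr_mono2) auto
    then have "t * y / c \<le> real n powr (1 / \<beta>)"
      using beta_gt c_pos t y by (simp add: powr_powr)
    then have \<theta>y: "\<theta> * y \<le> 1" unfolding \<theta>_def using c_pos n t by (simp add: field_simps)
    \<comment> \<open>This linearises \<open>norm (phi \<theta>) ^ n \<ge> 1 / 2\<close>: comparing
      1/2 with \<open>exp (- 1)\<close> leaves
      \<open>n * (1 - norm (phi \<theta>)) \<le> 1\<close>.\<close>
    have "norm (phi \<theta>) \<le> exp (norm (phi \<theta>) - 1)" using exp_ge_add_one_self[of "norm (phi \<theta>) - 1"] by simp
    then have "norm (phi \<theta>) ^ n \<le> exp (norm (phi \<theta>) - 1) ^ n" by (intro power_mono) auto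
    then have "1 / 2 \<le> exp (real n * (norm (phi \<theta>) - 1))"
      using n0[OF n(1)] by (simp add: \<theta>_def exp_of_nat_mult)
    moreover have "exp (- 1) < (1 / 2 :: real)"
      using exp_lower_Taylor_quadratic[of 1] by (simp add: exp_minus field_simps)
    ultimately have "exp (- 1) < exp (real n * (norm (phi \<theta>) - 1))" by linarith
    then have n1: "real n * (1 - norm (phi \<theta>)) \<le> 1" by (simp add: algebra_simps)
    have pw: "real n powr (2 / \<beta> - 1) \<le> (K * y powr \<beta>) powr (2 / \<beta> - 1)"
      using nK beta_le beta_gt by (intro powr_mono2) auto
    define A where "A = 16 / p * (c / t)\<^sup>2"
    have A: "A \<ge> 0" using p by (simp add: A_def)
    have "p * (\<theta>\<^sup>2 / 4 * measure_pmf.expectation \<mu> (\<lambda>k. (real k)\<^sup>2 * indicator {k. real k \<le> y} k))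
       = p * measure_pmf.expectation \<mu> (\<lambda>k. (\<theta> * real k)\<^sup>2 / 4 * indicator {k. real k \<le> y} k)"
      by (simp add: power_mult_distrib mult.assoc flip: integral_mult_right_zero)
    also have "\<dots> \<le> p * measure_pmf.expectation \<mu> (\<lambda>k. 1 - cos (\<theta> * real k))"
    proof (intro mult_left_mono integral_mono)
      show "integrable (measure_pmf \<mu>) (\<lambda>k. (\<theta> * real k)\<^sup>2 / 4 * indicator {k. real k \<le> y} k)"
      proof (intro measure_pmf.integrable_const_bound[where B="(\<theta> * y)\<^sup>2 / 4"] AE_I2)
        fix k show "norm ((\<theta> * real k)\<^sup>2 / 4 * indicator {k. real k \<le> y} k) \<le> (\<theta> * y)\<^sup>2 / 4"
          using \<theta> by (auto simp: indicator_def intro!: power_mono)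
      qed auto
      fix k show "(\<theta> * real k)\<^sup>2 / 4 * indicator {k. real k \<le> y} k \<le> 1 - cos (\<theta> * real k)"
      proof (cases "real k \<le> y")
        case True
        then have "\<theta> * real k \<le> 1" using \<theta> \<theta>y mult_left_mono[of "real k" y \<theta>] by linarith
        then have "\<bar>\<theta> * real k\<bar> \<le> 1" using \<theta> by simp
        from one_minus_cos_ge[OF this] True show ?thesis by simp
      qed simp
    qed (use p in \<open>auto simp: integrable_cos\<close>)
    also have "\<dots> \<le> 4 * (1 - norm (phi \<theta>))" unfolding p_def by (rule one_minus_cos_expectation)
    also have "\<dots> \<le> 4 / real n" using n1 n by (simp add: field_simps)
    finally have "measure_pmf.expectation \<mu> (\<lambda>k. (real k)\<^sup>2 * indicator {k. real k \<le> y} k) \<le> 16 / p / (real n * \<theta>\<^sup>2)"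
      using p \<theta> n by (simp add: field_simps)
    also have "\<dots> = A * ((real n powr (1 / \<beta>))\<^sup>2 / real n)"
      by (simp add: A_def \<theta>_def power_divide power_mult_distrib ac_simps)
    also have "(real n powr (1 / \<beta>))\<^sup>2 / real n = real n powr (2 / \<beta> - 1)"
      using n by (simp add: powr_diff powr_power)
    also have "A * real n powr (2 / \<beta> - 1) \<le> A * (K * y powr \<beta>) powr (2 / \<beta> - 1)"
      by (rule mult_left_mono[OF pw A])
    also have "(K * y powr \<beta>) powr (2 / \<beta> - 1) = K powr (2 / \<beta> - 1) * y powr (2 - \<beta>)"
      using K y beta_gt by (simp add: powr_mult powr_powr right_diff_distrib)
    also have "A * (K powr (2 / \<beta> - 1) * y powr (2 - \<beta>)) = C * y powr (2 - \<beta>)"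
      by (simp add: C_def A_def)
    finally show ?thesis .
  qed
  with C that show ?thesis by blast
qed

text \<open>The mass that the size-biased law gives to numbers above \<open>y\<close>.\<close>

definition tail_mean :: "real \<Rightarrow> real" where
  "tail_mean y = measure_pmf.expectation \<mu> (\<lambda>k. real k * indicator {k. y < real k} k)"

lemma integrable_tail_mean: "integrable (measure_pmf \<mu>) (\<lambda>k. real k * indicator A k)"
  using integrable_mu by (rule Bochner_Integration.integrable_bound) (auto simp: indicator_def)

lemma tail_mean_tendsto_0: "(\<lambda>m. tail_mean (2 ^ m * y)) \<longlonglongrightarrow> 0" if "y \<ge> 1"
proof -
  have "(\<lambda>m. tail_mean (2 ^ m * y)) \<longlonglongrightarrow> measure_pmf.expectation \<mu> (\<lambda>k. 0)"
    unfolding tail_mean_def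
  proof (rule integral_dominated_convergence[where w=real])
    show "AE k in measure_pmf \<mu>. (\<lambda>m. real k * indicator {k. 2 ^ m * y < real k} k) \<longlonglongrightarrow> 0"
    proof (rule AE_I2)
      fix k :: nat
      have "eventually (\<lambda>m. real k * indicator {k. 2 ^ m * y < real k} k = 0) sequentially"
        using eventually_ge_at_top[of k]
      proof eventually_elim
        case (elim m)
        have "real k \<le> 2 ^ k * 1" using less_exp[of k] by (metis mult.right_neutral of_nat_less_two_power less_imp_le)
        also have "\<dots> \<le> 2 ^ m * y" using that elim by (intro mult_mono power_increasing) auto
        finally show ?case by simp
      qed
      then show "(\<lambda>m. real k * indicator {k. 2 ^ m * y < real k} k) \<longlonglongrightarrow> 0"
        by (rule tendsto_eventually)
    qed
  qed (use integrable_mu in \<open>auto simp: indicator_def\<close>)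
  then show ?thesis by simp
qed

text \<open>On the dyadic piece from \<open>y\<close> to \<open>2 * y\<close> one has
  \<open>k \<le> k\<^sup>2 / y\<close>, so the truncated second moment at \<open>2 * y\<close>
  bounds its contribution by a multiple of \<open>y powr (1 - \<beta>)\<close>. These bounds form a
  geometric series of ratio \<open>r < 1\<close>.\<close>

lemma tail_mean_upper:
  obtains C where "C > 0" "\<And>y. 1 \<le> y \<Longrightarrow> tail_mean y \<le> C * y powr (1 - \<beta>)"
proof -
  obtain C where C: "C > 0"
    "\<And>y. 1 \<le> y \<Longrightarrow> measure_pmf.expectation \<mu> (\<lambda>k. (real k)\<^sup>2 * indicator {k. real k \<le> y} k) \<le> C * y powr (2 - \<beta>)"
    using truncated_second_moment by blast
  define r :: real where "r = 2 powr (1 - \<beta>)"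
  have r: "0 < r" "r < 1" unfolding r_def using beta_gt powr_less_mono[of "1 - \<beta>" 0 2] by auto
  define D where "D = C * 2 powr (2 - \<beta>) / (1 - r)"
  have D: "D > 0" unfolding D_def using C r by simp
  have rec: "tail_mean y \<le> D * (1 - r) * y powr (1 - \<beta>) + tail_mean (2 * y)" if "1 \<le> y" for y
  proof -
    have int: "integrable (measure_pmf \<mu>) (\<lambda>k. (real k)\<^sup>2 * indicator {k. real k \<le> 2 * y} k)"
    proof (intro measure_pmf.integrable_const_bound[where B="(2 * y)\<^sup>2"] AE_I2)
      fix k show "norm ((real k)\<^sup>2 * indicator {k. real k \<le> 2 * y} k) \<le> (2 * y)\<^sup>2"
        using power_mono[of "real k" "2 * y" 2] by (auto simp: indicator_def)
    qed auto
    have "tail_mean y \<le> measure_pmf.expectation \<mu> (\<lambda>k. (real k)\<^sup>2 * indicator {k. real k \<le> 2 * y} k / y + real k * indicator {k. 2 * y < real k} k)"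
      unfolding tail_mean_def
    proof (rule integral_mono)
      fix k
      have "real k * y \<le> (real k)\<^sup>2" if "y < real k"
        using that by (simp add: power2_eq_square mult_left_mono)
      then show "real k * indicator {k. y < real k} k \<le> (real k)\<^sup>2 * indicator {k. real k \<le> 2 * y} k / y + real k * indicator {k. 2 * y < real k} k"
        using \<open>1 \<le> y\<close> by (auto simp: indicator_def field_simps)
    qed (use int in \<open>auto intro!: integrable_tail_mean Bochner_Integration.integrable_add\<close>)
    also have "\<dots> = measure_pmf.expectation \<mu> (\<lambda>k. (real k)\<^sup>2 * indicator {k. real k \<le> 2 * y} k) / y + tail_mean (2 * y)"
      unfolding tail_mean_def using int by (subst Bochner_Integration.integral_add) (auto intro!: integrable_tail_mean)
    also have "measure_pmf.expectation \<mu> (\<lambda>k. (real k)\<^sup>2 * indicator {k. real k \<le> 2 * y} k) / y \<le> C * (2 * y) powr (2 - \<beta>) / y"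
      using C(2)[of "2 * y"] that by (intro divide_right_mono) auto
    also have "\<dots> = D * (1 - r) * (y powr (2 - \<beta>) / y powr 1)"
      using that r by (simp add: D_def powr_mult)
    also have "y powr (2 - \<beta>) / y powr 1 = y powr (1 - \<beta>)"
      unfolding powr_diff[symmetric] by simp
    finally show ?thesis by simp
  qed
  have "tail_mean y \<le> D * y powr (1 - \<beta>)" if y: "1 \<le> y" for y
  proof -
    \<comment> \<open>The constant \<open>D\<close> is such that the dyadic bound equals
      \<open>D * z powr (1 - \<beta>) - D * (2 * z) powr (1 - \<beta>)\<close>; the sum over pieces
      telescopes.\<close>
    have iter: "tail_mean y \<le> D * y powr (1 - \<beta>) - D * (2 ^ m * y) powr (1 - \<beta>) + tail_mean (2 ^ m * y)" for m
    proof (induction m)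
      case (Suc m)
      have "1 * 1 \<le> 2 ^ m * y" using y by (intro mult_mono) auto
      then have "tail_mean (2 ^ m * y) \<le> D * (1 - r) * (2 ^ m * y) powr (1 - \<beta>) + tail_mean (2 * (2 ^ m * y))"
        by (intro rec) simp
      moreover have "r * (2 ^ m * y) powr (1 - \<beta>) = (2 * (2 ^ m * y)) powr (1 - \<beta>)"
        unfolding r_def using y by (intro powr_mult[symmetric])
      ultimately show ?case using Suc by (simp add: algebra_simps)
    qed simp
    have "tail_mean y \<le> D * y powr (1 - \<beta>) + tail_mean (2 ^ m * y)" for m
    proof -
      have "0 \<le> D * (2 ^ m * y) powr (1 - \<beta>)" using D by simp
      then show ?thesis using iter[of m] by linarith
    qed
    moreover have "(\<lambda>m. D * y powr (1 - \<beta>) + tail_mean (2 ^ m * y)) \<longlonglongrightarrow> D * y powr (1 - \<beta>) + 0"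
      by (intro tendsto_intros tail_mean_tendsto_0 y)
    ultimately show ?thesis by (intro LIMSEQ_le_const[where X="\<lambda>m. D * y powr (1 - \<beta>) + tail_mean (2 ^ m * y)"]) auto
  qed
  with D that show ?thesis by blast
qed

lemma kap_eq:
  assumes "0 \<le> u" "u \<le> 1"
  shows "kap u = measure_pmf.expectation \<mu> (\<lambda>k. (1 - u) ^ k - 1 + u * real k)"
  using assms integrable_mu expectation_mu by (simp add: kap_def integrable_mu_power)

text \<open>Since the mean is 1, \<open>kap u\<close> is the mean of
  \<open>(1 - u) ^ k - 1 + u * k\<close>, which is at most both \<open>(u * k)\<^sup>2\<close> and
  \<open>u * k\<close>. Cutting at \<open>k = 1 / u\<close> and using the truncated second moment
  below and \<open>tail_mean\<close> above, both parts are of order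
  \<open>u powr \<beta>\<close>.\<close>

lemma kap_upper:
  obtains C where "C > 0" "\<And>u. 0 \<le> u \<Longrightarrow> u \<le> 1 \<Longrightarrow> kap u \<le> C * u powr \<beta>"
proof -
  obtain C where C: "C > 0"
    "\<And>y. 1 \<le> y \<Longrightarrow> measure_pmf.expectation \<mu> (\<lambda>k. (real k)\<^sup>2 * indicator {k. real k \<le> y} k) \<le> C * y powr (2 - \<beta>)"
    using truncated_second_moment by blast
  obtain D where D: "D > 0" "\<And>y. 1 \<le> y \<Longrightarrow> tail_mean y \<le> D * y powr (1 - \<beta>)"
    using tail_mean_upper by blast
  have "kap u \<le> (C + D) * u powr \<beta>" if u: "0 < u" "u \<le> 1" for u
  proof -
    define y where "y = 1 / u"
    have y: "1 \<le> y" using u by (simp add: y_def)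
    have int: "integrable (measure_pmf \<mu>) (\<lambda>k. (real k)\<^sup>2 * indicator {k. real k \<le> y} k)"
    proof (intro measure_pmf.integrable_const_bound[where B="y\<^sup>2"] AE_I2)
      fix k show "norm ((real k)\<^sup>2 * indicator {k. real k \<le> y} k) \<le> y\<^sup>2"
        using power_mono[of "real k" y 2] by (auto simp: indicator_def)
    qed auto
    have p2: "(1 - u) ^ k \<le> 1 - u * real k + u\<^sup>2 * (real k)\<^sup>2" for k
    proof (induction k)
      case (Suc k)
      have "(1 - u) ^ Suc k \<le> (1 - u) * (1 - u * real k + u\<^sup>2 * (real k)\<^sup>2)"
        using Suc u by (auto intro: mult_left_mono)
      also have "\<dots> = 1 - u * real (Suc k) + u\<^sup>2 * (real k + (real k)\<^sup>2) - u * (u\<^sup>2 * (real k)\<^sup>2)"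
        by (simp add: algebra_simps power2_eq_square)
      also have "\<dots> \<le> 1 - u * real (Suc k) + u\<^sup>2 * (real k + (real k)\<^sup>2)" using u by simp
      also have "\<dots> \<le> 1 - u * real (Suc k) + u\<^sup>2 * (real (Suc k))\<^sup>2"
        by (intro add_left_mono mult_left_mono) (auto simp: power2_eq_square algebra_simps)
      finally show ?case .
    qed simp
    have "kap u \<le> measure_pmf.expectation \<mu> (\<lambda>k. u\<^sup>2 * ((real k)\<^sup>2 * indicator {k. real k \<le> y} k) + u * (real k * indicator {k. y < real k} k))"
      unfolding kap_eq[OF less_imp_le[OF u(1)] u(2)]
    proof (rule integral_mono)
      fix k
      have "(1 - u) ^ k \<le> 1" using u by (intro power_le_one) auto
      then show "(1 - u) ^ k - 1 + u * real k \<le> u\<^sup>2 * ((real k)\<^sup>2 * indicator {k. real k \<le> y} k) + u * (real k * indicator {k. y < real k} k)"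
        using p2[of k] by (auto simp: indicator_def)
    qed (use int u in \<open>auto intro!: integrable_tail_mean Bochner_Integration.integrable_add Bochner_Integration.integrable_diff integrable_mu_power integrable_mult_right integrable_mu\<close>)
    also have "\<dots> = u\<^sup>2 * measure_pmf.expectation \<mu> (\<lambda>k. (real k)\<^sup>2 * indicator {k. real k \<le> y} k) + u * tail_mean y"
      unfolding tail_mean_def using int by (subst Bochner_Integration.integral_add) (auto intro!: integrable_tail_mean integrable_mult_right)
    also have "\<dots> \<le> u\<^sup>2 * (C * y powr (2 - \<beta>)) + u * (D * y powr (1 - \<beta>))"
      using C(2)[OF y] D(2)[OF y] u by (intro add_mono mult_left_mono) auto
    also have "\<dots> = C * (u powr 2 * y powr (2 - \<beta>)) + D * (u powr 1 * y powr (1 - \<beta>))"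
      using u by simp
    also have "u powr 2 * y powr (2 - \<beta>) = u powr \<beta>"
      using u powr_diff[of u 2 "2 - \<beta>"] by (simp add: y_def powr_divide)
    also have "u powr 1 * y powr (1 - \<beta>) = u powr \<beta>"
      using u powr_diff[of u 1 "1 - \<beta>"] by (simp add: y_def powr_divide)
    finally show ?thesis by (simp add: algebra_simps)
  qed
  then have "kap u \<le> (C + D) * u powr \<beta>" if "0 \<le> u" "u \<le> 1" for u
    using that kap_0 by (cases "u = 0") auto
  moreover have "C + D > 0" using C D by simp
  ultimately show ?thesis using that by blast
qed

text \<open>Convexity of the generating function \<open>f\<close>:
  \<open>u * f' (1 - u) \<le> 1 - f (1 - u)\<close>. A lower bound for \<open>kap\<close> thereby
  becomes an upper bound for the factor lost at each spine step.\<close>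

lemma mean_derivative_le:
  assumes "0 \<le> u" "u \<le> 1"
  shows "u * measure_pmf.expectation \<mu> (\<lambda>k. real k * (1 - u) ^ (k - 1)) \<le> u - kap u"
proof -
  have int: "integrable (measure_pmf \<mu>) (\<lambda>k. real k * (1 - u) ^ (k - 1))"
    using integrable_mu by (rule Bochner_Integration.integrable_bound)
      (use assms in \<open>auto simp: power_le_one mult_left_le\<close>)
  have p: "u * (real k * (1 - u) ^ (k - 1)) \<le> 1 - (1 - u) ^ k" for k
  proof (induction k)
    case (Suc k)
    have "u * (real (Suc k) * (1 - u) ^ k) = (1 - u) * (u * (real k * (1 - u) ^ (k - 1))) + u * (1 - u) ^ k"
      by (cases k) (auto simp: algebra_simps)
    also have "\<dots> \<le> (1 - u) * (1 - (1 - u) ^ k) + u * 1"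
      using Suc assms by (intro add_mono mult_left_mono power_le_one) auto
    finally show ?case by (simp add: algebra_simps)
  qed simp
  have "u * measure_pmf.expectation \<mu> (\<lambda>k. real k * (1 - u) ^ (k - 1))
      = measure_pmf.expectation \<mu> (\<lambda>k. u * (real k * (1 - u) ^ (k - 1)))" by simp
  also have "\<dots> \<le> measure_pmf.expectation \<mu> (\<lambda>k. 1 - (1 - u) ^ k)"
    using assms int p by (intro integral_mono integrable_mult_right Bochner_Integration.integrable_diff integrable_mu_power) auto
  also have "\<dots> = u - kap u" using assms by (simp add: kap_def integrable_mu_power)
  finally show ?thesis .
qed

end

section \<open>The tree and its subtrees at the root\<close>

lemma restrict_UNIV_eq [simp]: "restrict f UNIV = f"
  by (simp add: restrict_def)

lemma measurable_subtree:
  "(\<lambda>\<omega> v. \<omega> (i # v)) \<in> (\<Pi>\<^sub>M v\<in>(UNIV::nat list set). N) \<rightarrow>\<^sub>M (\<Pi>\<^sub>M v\<in>UNIV. N)"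
  by (rule measurable_PiM_single') (auto simp: space_PiM PiE_iff)

lemma distr_subtree:
  assumes "prob_space N"
  shows "distr (\<Pi>\<^sub>M v\<in>(UNIV::nat list set). N) (\<Pi>\<^sub>M v\<in>UNIV. N) (\<lambda>\<omega> v. \<omega> (i # v)) = (\<Pi>\<^sub>M v\<in>UNIV. N)"
  using distr_PiM_reindex[of UNIV "\<lambda>_::nat list. N" "\<lambda>v. i # v" UNIV] assms
  by (simp add: inj_on_def)

lemma indep_vars_coordinates:
  assumes N: "prob_space N"
  defines "P \<equiv> (\<Pi>\<^sub>M v\<in>(UNIV::nat list set). N)"
  shows "prob_space.indep_vars P (\<lambda>_. N) (\<lambda>v \<omega>. \<omega> v) UNIV"
proof -
  interpret P: prob_space P unfolding P_def by (intro prob_space_PiM N)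
  have "distr P N (\<lambda>\<omega>. \<omega> v) = N" for v
    using distr_PiM_component[of UNIV "\<lambda>_::nat list. N" v] N by (simp add: P_def)
  then show ?thesis
    by (subst P.indep_vars_iff_distr_eq_PiM) (auto simp: P_def distr_id)
qed

text \<open>The branching property. The root mark and the subtrees at different children read
  disjoint blocks of labels, and shifting a block back to the root preserves the i.i.d. law.\<close>

lemma prob_branching:
  fixes N :: "'a measure" and n :: nat
  defines "P \<equiv> (\<Pi>\<^sub>M v\<in>(UNIV::nat list set). N)"
  assumes N: "prob_space N" and A: "A \<in> sets N" and E: "\<And>i. i < n \<Longrightarrow> E i \<in> sets P"
  shows "measure P {\<omega> \<in> space P. \<omega> [] \<in> A \<and> (\<forall>i<n. (\<lambda>v. \<omega> (i # v)) \<in> E i)}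
       = measure N A * (\<Prod>i<n. measure P (E i))"
proof -
  interpret N: prob_space N by fact
  interpret P: prob_space P unfolding P_def by (intro prob_space_PiM N)
  \<comment> \<open>\<open>None\<close> stands for the block containing the root alone,
    \<open>Some i\<close> for the labels that begin with \<open>i\<close>.\<close>
  define J where "J = insert None (Some ` {..<n})"
  define K :: "nat option \<Rightarrow> nat list set" where "K j = (case j of None \<Rightarrow> {[]} | Some i \<Rightarrow> range ((#) i))" for j
  define Y where "Y j g = (case j of None \<Rightarrow> g [] \<in> A | Some i \<Rightarrow> (\<lambda>v. g (i # v)) \<in> E i)" for j g
  have "P.indep_vars (\<lambda>_. N) (\<lambda>v \<omega>. \<omega> v) UNIV"
    unfolding P_def by (rule indep_vars_coordinates[OF N])
  then have "P.indep_vars (\<lambda>j. \<Pi>\<^sub>M v\<in>K j. N) (\<lambda>j \<omega>. restrict (\<lambda>v. \<omega> v) (K j)) J"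
    by (rule P.indep_vars_restrict) (auto simp: disjoint_family_on_def K_def split: option.splits)
  then have ind: "P.indep_vars (\<lambda>j. count_space UNIV) (\<lambda>j \<omega>. Y j (restrict (\<lambda>v. \<omega> v) (K j))) J"
  proof (rule P.indep_vars_compose2)
    fix j assume j: "j \<in> J"
    show "Y j \<in> (\<Pi>\<^sub>M v\<in>K j. N) \<rightarrow>\<^sub>M count_space UNIV"
    proof (cases j)
      case None
      have "Measurable.pred (\<Pi>\<^sub>M v\<in>{[]}. N) (\<lambda>g. g [] \<in> A)"
        by (rule pred_sets2[OF A]) simp
      moreover have "Y None = (\<lambda>g. g [] \<in> A)" "K None = {[]}"
        by (simp_all add: Y_def K_def fun_eq_iff)
      ultimately show ?thesis by (simp only: None)
    next
      case (Some i)
      have E': "E i \<in> sets P" using E j unfolding Some J_def by blast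
      have "(\<lambda>g v. g (i # v)) \<in> (\<Pi>\<^sub>M v\<in>range ((#) i). N) \<rightarrow>\<^sub>M P"
        unfolding P_def by (rule measurable_PiM_single') (auto simp: space_PiM PiE_iff)
      then have "Measurable.pred (\<Pi>\<^sub>M v\<in>range ((#) i). N) (\<lambda>g. (\<lambda>v. g (i # v)) \<in> E i)"
        by (rule pred_sets2[OF E'])
      moreover have "Y (Some i) = (\<lambda>g. (\<lambda>v. g (i # v)) \<in> E i)" "K (Some i) = range ((#) i)"
        by (simp_all add: Y_def K_def fun_eq_iff)
      ultimately show ?thesis by (simp only: Some)
    qed
  qed
  have Y: "Y j (restrict \<omega> (K j)) = (case j of None \<Rightarrow> \<omega> [] \<in> A | Some i \<Rightarrow> (\<lambda>v. \<omega> (i # v)) \<in> E i)" for j \<omega>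
    by (auto simp: Y_def K_def split: option.splits)
  have "P.prob (\<Inter>j\<in>J. (\<lambda>\<omega>. Y j (restrict (\<lambda>v. \<omega> v) (K j))) -` {True} \<inter> space P)
      = (\<Prod>j\<in>J. P.prob ((\<lambda>\<omega>. Y j (restrict (\<lambda>v. \<omega> v) (K j))) -` {True} \<inter> space P))"
    by (rule P.indep_varsD_finite[OF ind]) (auto simp: J_def)
  moreover have "(\<Inter>j\<in>J. (\<lambda>\<omega>. Y j (restrict (\<lambda>v. \<omega> v) (K j))) -` {True} \<inter> space P)
      = {\<omega> \<in> space P. \<omega> [] \<in> A \<and> (\<forall>i<n. (\<lambda>v. \<omega> (i # v)) \<in> E i)}"
    unfolding J_def Y by (auto simp: Y)
  moreover have "(\<Prod>j\<in>J. P.prob ((\<lambda>\<omega>. Y j (restrict (\<lambda>v. \<omega> v) (K j))) -` {True} \<inter> space P))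
      = P.prob ((\<lambda>\<omega>. \<omega> []) -` A \<inter> space P) * (\<Prod>i<n. P.prob ((\<lambda>\<omega> v. \<omega> (i # v)) -` E i \<inter> space P))"
  proof -
    have "(\<lambda>\<omega>. Y j (restrict (\<lambda>v. \<omega> v) (K j))) -` {True} =
        (case j of None \<Rightarrow> (\<lambda>\<omega>. \<omega> []) -` A | Some i \<Rightarrow> (\<lambda>\<omega> v. \<omega> (i # v)) -` E i)" for j
      by (auto simp: Y split: option.splits)
    then show ?thesis unfolding J_def by (simp add: prod.reindex)
  qed
  moreover have "P.prob ((\<lambda>\<omega>. \<omega> []) -` A \<inter> space P) = measure N A"
    using measure_distr[of "\<lambda>\<omega>. \<omega> []" P N A] A distr_PiM_component[of UNIV "\<lambda>_::nat list. N" "[]"] N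
    by (simp add: P_def)
  moreover have "P.prob ((\<lambda>\<omega> v. \<omega> (i # v)) -` E i \<inter> space P) = P.prob (E i)" if "i < n" for i
    using measure_distr[OF measurable_subtree E[OF that, unfolded P_def], of i] distr_subtree[OF N, of i]
    by (simp add: P_def)
  ultimately show ?thesis by simp
qed

lemma prob_branching_single:
  fixes N :: "'a measure" and i :: nat
  defines "P \<equiv> (\<Pi>\<^sub>M v\<in>(UNIV::nat list set). N)"
  assumes N: "prob_space N" and A: "A \<in> sets N" and E: "E \<in> sets P"
  shows "measure P {\<omega> \<in> space P. \<omega> [] \<in> A \<and> (\<lambda>v. \<omega> (i # v)) \<in> E} = measure N A * measure P E"
proof -
  interpret P: prob_space P unfolding P_def by (intro prob_space_PiM N)
  define F where "F j = (if j = i then E else space P)" for j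
  have "{\<omega> \<in> space P. \<omega> [] \<in> A \<and> (\<lambda>v. \<omega> (i # v)) \<in> E}
      = {\<omega> \<in> space P. \<omega> [] \<in> A \<and> (\<forall>j<Suc i. (\<lambda>v. \<omega> (j # v)) \<in> F j)}"
    using measurable_space[OF measurable_subtree[of _ N]] by (auto simp: F_def P_def less_Suc_eq)
  also have "measure P \<dots> = measure N A * (\<Prod>j<Suc i. measure P (F j))"
    unfolding P_def using E by (intro prob_branching N A) (auto simp: F_def P_def)
  also have "(\<Prod>j<Suc i. measure P (F j)) = measure P E"
    by (simp add: F_def P.prob_space)
  finally show ?thesis .
qed

text \<open>Recursive forms of \<open>special\<close> and \<open>vertices\<close> for a tree whose root is special
  or normal according to \<open>b\<close>; the recursion is on the child of the root.\<close>

definition num_children :: "bool \<Rightarrow> nat \<times> (nat \<times> nat) \<times> real \<Rightarrow> nat" where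
  "num_children b m = (if b then fst (fst (snd m)) else fst m)"

definition spine_child :: "nat \<times> (nat \<times> nat) \<times> real \<Rightarrow> nat" where
  "spine_child m = snd (fst (snd m))"

fun on_spine :: "bool \<Rightarrow> env \<Rightarrow> nat list \<Rightarrow> bool" where
  "on_spine b \<omega> [] = b"
| "on_spine b \<omega> (i # v) = on_spine (b \<and> i = spine_child (\<omega> [])) (\<lambda>w. \<omega> (i # w)) v"

fun in_tree :: "bool \<Rightarrow> env \<Rightarrow> nat list \<Rightarrow> bool" where
  "in_tree b \<omega> [] = True"
| "in_tree b \<omega> (i # v) =
    (i < num_children b (\<omega> []) \<and> in_tree (b \<and> i = spine_child (\<omega> [])) (\<lambda>w. \<omega> (i # w)) v)"

lemma on_spine_snoc: "on_spine b \<omega> (v @ [i]) \<longleftrightarrow> on_spine b \<omega> v \<and> i = spine_child (\<omega> v)"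
  by (induction v arbitrary: b \<omega>) auto

lemma in_tree_snoc:
  "in_tree b \<omega> (v @ [i]) \<longleftrightarrow> in_tree b \<omega> v \<and> i < num_children (on_spine b \<omega> v) (\<omega> v)"
  by (induction v arbitrary: b \<omega>) auto

lemma special_iff: "special \<omega> v \<longleftrightarrow> on_spine True \<omega> v"
proof (induction v rule: rev_induct)
  case (snoc i v)
  then show ?case
    by (subst special.simps) (auto simp: on_spine_snoc special_child_def spine_child_def)
qed (auto intro: special.intros)

lemma offspring_eq: "offspring \<omega> v = num_children (on_spine True \<omega> v) (\<omega> v)"
  by (auto simp: offspring_def special_iff special_count_def normal_count_def num_children_def)

lemma vertices_iff: "v \<in> vertices \<omega> \<longleftrightarrow> in_tree True \<omega> v"
proof (induction v rule: rev_induct)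
  case (snoc i v)
  then show ?case
    by (subst vertices.simps) (auto simp: in_tree_snoc offspring_eq)
qed (auto intro: vertices.intros)

text \<open>Needed for the existence of maximisers: only a ball contains competitors above the
  winning level.\<close>

lemma finite_in_tree: "finite {v. in_tree b \<omega> v \<and> length v \<le> k}"
proof (induction k)
  case (Suc k)
  have "{v. in_tree b \<omega> v \<and> length v \<le> Suc k} \<subseteq> insert [] (\<Union>v\<in>{v. in_tree b \<omega> v \<and> length v \<le> k}.
      (\<lambda>i. v @ [i]) ` {..<num_children (on_spine b \<omega> v) (\<omega> v)})"
  proof
    fix v assume v: "v \<in> {v. in_tree b \<omega> v \<and> length v \<le> Suc k}"
    then show "v \<in> insert [] (\<Union>v\<in>{v. in_tree b \<omega> v \<and> length v \<le> k}.
      (\<lambda>i. v @ [i]) ` {..<num_children (on_spine b \<omega> v) (\<omega> v)})"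
      by (cases v rule: rev_cases) (auto simp: in_tree_snoc)
  qed
  then show ?case by (rule finite_subset) (use Suc in auto)
qed (auto intro: finite_subset[of _ "{[]}"])

text \<open>\<open>S\<close> may depend on the type of the vertex because a mark alone does not
  reveal whether its normal or its special entry is in force.\<close>

definition hit :: "(bool \<Rightarrow> (nat \<times> (nat \<times> nat) \<times> real) set) \<Rightarrow> bool \<Rightarrow> nat \<Rightarrow> env \<Rightarrow> bool" where
  "hit S b k \<omega> \<longleftrightarrow> (\<exists>v. in_tree b \<omega> v \<and> length v \<le> k \<and> \<omega> v \<in> S (on_spine b \<omega> v))"

lemma hit_0: "hit S b 0 \<omega> \<longleftrightarrow> \<omega> [] \<in> S b"
  by (auto simp: hit_def)

lemma hit_Suc: "hit S b (Suc k) \<omega> \<longleftrightarrow> \<omega> [] \<in> S b \<or>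
  (\<exists>i<num_children b (\<omega> []). hit S (b \<and> i = spine_child (\<omega> [])) k (\<lambda>v. \<omega> (i # v)))"
proof -
  have split: "(\<exists>v. P v) \<longleftrightarrow> P [] \<or> (\<exists>i v. P (i # v))" for P :: "nat list \<Rightarrow> bool"
    by (metis list.exhaust)
  show ?thesis unfolding hit_def by (subst split) auto
qed

definition mark :: "nat pmf \<Rightarrow> real \<Rightarrow> (nat \<times> (nat \<times> nat) \<times> real) measure" where
  "mark \<mu> \<alpha> = measure_pmf \<mu> \<Otimes>\<^sub>M (measure_pmf (special_offspring \<mu>) \<Otimes>\<^sub>M pareto \<alpha>)"

lemma sums_expectation:
  fixes f :: "nat \<Rightarrow> real"
  assumes "integrable (measure_pmf p) f"
  shows "(\<lambda>n. pmf p n * f n) sums measure_pmf.expectation p f"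
proof -
  have "integrable (count_space UNIV) (\<lambda>n. pmf p n * f n)"
    using assms unfolding measure_pmf_eq_density by (subst (asm) integrable_density) auto
  moreover have "measure_pmf.expectation p f = (\<integral>n. pmf p n * f n \<partial>count_space UNIV)"
    unfolding measure_pmf_eq_density by (subst integral_density) auto
  ultimately show ?thesis using sums_integral_count_space_nat by metis
qed

section \<open>The probability space and the law of a single mark\<close>

locale kesten_tree = stable_offspring +
  fixes \<alpha> :: real
  assumes alpha_gt: "\<alpha> > \<beta> / (\<beta> - 1)"
begin

definition P :: "env measure" where "P = kesten \<mu> \<alpha>"
definition N :: "(nat \<times> (nat \<times> nat) \<times> real) measure" where "N = mark \<mu> \<alpha>"

lemma alpha_pos: "\<alpha> > 0"
  using alpha_gt beta_gt by (meson divide_pos_pos less_trans diff_gt_0_iff_gt zero_less_one)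

lemma P_eq: "P = (\<Pi>\<^sub>M v\<in>UNIV. N)"
  by (simp add: P_def N_def kesten_def mark_def)

sublocale Par: real_distribution "pareto \<alpha>"
  by (rule real_distribution_pareto[OF alpha_pos])

sublocale SP: pair_prob_space "measure_pmf (special_offspring \<mu>)" "pareto \<alpha>" ..

sublocale NN: pair_prob_space "measure_pmf \<mu>" "measure_pmf (special_offspring \<mu>) \<Otimes>\<^sub>M pareto \<alpha>" ..

lemma prob_space_N: "prob_space N"
  unfolding N_def mark_def by (rule NN.prob_space_axioms)

sublocale N: prob_space N by (rule prob_space_N)

sublocale P: prob_space P
  unfolding P_def by (rule prob_space_kesten[OF alpha_pos])

lemma space_N [simp]: "space N = UNIV"
  by (simp add: N_def mark_def space_pair_measure)

lemma space_P [simp]: "space P = UNIV"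
  by (simp add: P_eq space_PiM)

lemma measurable_mark [measurable]:
  "fst \<in> N \<rightarrow>\<^sub>M count_space UNIV"
  "(\<lambda>m. fst (snd m)) \<in> N \<rightarrow>\<^sub>M count_space UNIV"
  "(\<lambda>m. snd (snd m)) \<in> N \<rightarrow>\<^sub>M borel"
proof -
  show "fst \<in> N \<rightarrow>\<^sub>M count_space UNIV"
    using measurable_fst[of "measure_pmf \<mu>"] by (auto simp: N_def mark_def)
  show "(\<lambda>m. fst (snd m)) \<in> N \<rightarrow>\<^sub>M count_space UNIV"
    using measurable_compose[OF measurable_snd measurable_fst, of "measure_pmf \<mu>" "measure_pmf (special_offspring \<mu>)" "pareto \<alpha>"]
    by (simp add: N_def mark_def)
  show "(\<lambda>m. snd (snd m)) \<in> N \<rightarrow>\<^sub>M borel"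
    using measurable_compose[OF measurable_snd measurable_snd, of "measure_pmf \<mu>" "measure_pmf (special_offspring \<mu>)" "pareto \<alpha>"]
    by (simp add: N_def mark_def cong: measurable_cong_sets)
qed

lemma measurable_coordinate [measurable]: "(\<lambda>\<omega>. \<omega> v) \<in> P \<rightarrow>\<^sub>M N"
  unfolding P_eq by simp

lemma measurable_num_children [measurable]: "num_children b \<in> N \<rightarrow>\<^sub>M count_space UNIV"
proof -
  have "(\<lambda>m. fst (fst (snd m))) \<in> N \<rightarrow>\<^sub>M count_space UNIV"
    by (rule measurable_compose[OF measurable_mark(2)]) simp
  then show ?thesis using measurable_mark(1) by (cases b) (simp_all add: num_children_def[abs_def])
qed

lemma measurable_spine_child [measurable]: "spine_child \<in> N \<rightarrow>\<^sub>M count_space UNIV"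
  unfolding spine_child_def[abs_def] by (rule measurable_compose[OF measurable_mark(2)]) simp

lemma pred_on_spine [measurable]: "Measurable.pred P (\<lambda>\<omega>. on_spine b \<omega> v)"
  by (induction v rule: rev_induct) (auto simp: on_spine_snoc)

lemma pred_in_tree [measurable]: "Measurable.pred P (\<lambda>\<omega>. in_tree b \<omega> v)"
proof (induction v rule: rev_induct)
  case (snoc i v)
  note [measurable] = snoc
  have "in_tree b \<omega> (v @ [i]) \<longleftrightarrow> in_tree b \<omega> v \<and>
      (on_spine b \<omega> v \<and> i < num_children True (\<omega> v) \<or> \<not> on_spine b \<omega> v \<and> i < num_children False (\<omega> v))" for \<omega>
    by (cases "on_spine b \<omega> v") (auto simp: in_tree_snoc)
  then show ?case by simp
qed simp

lemma pred_hit [measurable]: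
  assumes [measurable]: "S True \<in> sets N" "S False \<in> sets N"
  shows "Measurable.pred P (hit S b k)"
proof -
  have "hit S b k = (\<lambda>\<omega>. \<exists>v. in_tree b \<omega> v \<and> length v \<le> k \<and>
      (on_spine b \<omega> v \<and> \<omega> v \<in> S True \<or> \<not> on_spine b \<omega> v \<and> \<omega> v \<in> S False))"
    unfolding hit_def by (intro ext ex_cong1) (metis (full_types))
  then show ?thesis by simp
qed

lemma sets_hit:
  assumes "S True \<in> sets N" "S False \<in> sets N"
  shows "{\<omega>. hit S b k \<omega>} \<in> sets P" "{\<omega>. \<not> hit S b k \<omega>} \<in> sets P"
proof -
  show "{\<omega>. hit S b k \<omega>} \<in> sets P"
    using pred_hit[OF assms, of b k] by (simp add: pred_def)
  then show "{\<omega>. \<not> hit S b k \<omega>} \<in> sets P"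
    using sets.compl_sets[of "{\<omega>. hit S b k \<omega>}" P] by (simp add: Compl_eq_Diff_UNIV[symmetric] Collect_neg_eq)
qed

lemma measure_N:
  assumes "A \<in> sets borel"
  shows "measure N {m. fst m \<in> X \<and> fst (snd m) \<in> Y \<and> snd (snd m) \<in> A}
       = measure \<mu> X * measure (special_offspring \<mu>) Y * measure (pareto \<alpha>) A"
proof -
  have "{m. fst m \<in> X \<and> fst (snd m) \<in> Y \<and> snd (snd m) \<in> A} = X \<times> (Y \<times> A)" by auto
  moreover have "measure (measure_pmf (special_offspring \<mu>) \<Otimes>\<^sub>M pareto \<alpha>) (Y \<times> A)
     = measure (special_offspring \<mu>) Y * measure (pareto \<alpha>) A"
    using assms by (simp add: measure_def Par.emeasure_pair_measure_Times enn2real_mult)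
  moreover have "measure N (X \<times> (Y \<times> A)) = measure \<mu> X * measure (measure_pmf (special_offspring \<mu>) \<Otimes>\<^sub>M pareto \<alpha>) (Y \<times> A)"
    unfolding N_def mark_def using assms by (simp add: measure_def sigma_finite_measure.emeasure_pair_measure_Times[OF prob_space_imp_sigma_finite[OF SP.prob_space_axioms]] enn2real_mult)
  ultimately show ?thesis by simp
qed

lemma measure_N_fst: "measure N {m. fst m \<in> X} = measure \<mu> X"
  using measure_N[of UNIV X UNIV] Par.prob_space by simp

lemma measure_N_special: "measure N {m. fst (snd m) \<in> Y} = measure (special_offspring \<mu>) Y"
  using measure_N[of UNIV UNIV Y] Par.prob_space by simp

lemma measure_N_potential: "A \<in> sets borel \<Longrightarrow> measure N {m. snd (snd m) \<in> A} = measure (pareto \<alpha>) A"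
  using measure_N[of A UNIV UNIV] by simp

lemma measure_size_biased:
  "measure (size_biased \<mu>) X = measure_pmf.expectation \<mu> (\<lambda>k. real k * indicator X k)"
proof -
  have "(\<lambda>n. pmf (size_biased \<mu>) n * indicator X n) sums measure_pmf.expectation (size_biased \<mu>) (indicator X)"
    by (intro sums_expectation measure_pmf.integrable_const_bound[where B=1]) auto
  moreover have "(\<lambda>n. pmf \<mu> n * (real n * indicator X n)) sums measure_pmf.expectation \<mu> (\<lambda>k. real k * indicator X k)"
    by (rule sums_expectation) (rule integrable_tail_mean)
  ultimately show ?thesis
    by (auto simp: pmf_size_biased[OF critical] mult_ac dest: sums_unique2)
qed

lemma measure_special_fst: "measure (special_offspring \<mu>) {m. fst m \<in> X} = measure (size_biased \<mu>) X"
proof -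
  have "map_pmf fst (special_offspring \<mu>) = size_biased \<mu>"
    by (simp add: special_offspring_def map_bind_pmf pmf.map_comp comp_def map_pmf_const bind_return_pmf')
  then show ?thesis using measure_map_pmf[of fst "special_offspring \<mu>" X] by (simp add: vimage_def)
qed

section \<open>Large potentials in a ball\<close>

text \<open>The tail-sum formula for the mean. The \<open>i\<close>-th child of a normal vertex
  exists with probability \<open>measure \<mu> {k. i < k}\<close>, so a union bound over the
  subtrees of a normal root costs a factor of exactly 1.\<close>

lemma sums_children_tail: "(\<lambda>i. measure \<mu> {k. i < k}) sums 1"
proof -
  have "(\<Sum>i. ennreal (measure \<mu> {k. i < k})) = (\<Sum>i. emeasure \<mu> {k\<in>space (measure_pmf \<mu>). i < id k})"
    by (simp add: measure_pmf.emeasure_eq_measure)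
  also have "\<dots> = (\<integral>\<^sup>+ k. of_nat (id k) \<partial>measure_pmf \<mu>)"
    by (rule nn_integral_nat_function[symmetric]) simp
  also have "\<dots> = (\<integral>\<^sup>+ k. ennreal (real k) \<partial>measure_pmf \<mu>)"
    by (simp add: ennreal_of_nat_eq_real_of_nat)
  also have "\<dots> = ennreal 1"
    using integrable_mu expectation_mu by (subst nn_integral_eq_integral) auto
  finally have eq: "(\<Sum>i. ennreal (measure \<mu> {k. i < k})) = ennreal 1" .
  then have s: "summable (\<lambda>i. measure \<mu> {k. i < k})"
    by (intro summable_suminf_not_top) auto
  then have "ennreal (\<Sum>i. measure \<mu> {k. i < k}) = ennreal 1"
    using eq by (subst (asm) suminf_ennreal2) auto
  then have "(\<Sum>i. measure \<mu> {k. i < k}) = 1" using suminf_nonneg[OF s] by simp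
  with s show ?thesis by (simp add: sums_iff)
qed

text \<open>The mark designates one index for the spine, so a union over this index also costs a
  factor 1.\<close>

lemma sums_spine_child: "(\<lambda>i. N.prob {m. spine_child m = i}) sums 1"
proof -
  have "{m. spine_child m = i} \<in> N.events" for i
    using measurable_sets[OF measurable_spine_child, of "{i}"] by (simp add: vimage_def)
  then have "(\<lambda>i. N.prob {m. spine_child m = i}) sums N.prob (\<Union>i. {m. spine_child m = i})"
    by (intro N.finite_measure_UNION) (auto simp: disjoint_family_on_def)
  moreover have "(\<Union>i. {m. spine_child m = i}) = space N" by auto
  ultimately show ?thesis using N.prob_space by simp
qed

lemma root_subtree:
  assumes B: "B \<in> sets N" and E: "E \<in> sets P"
  shows "P.prob {\<omega>. \<omega> [] \<in> B \<and> (\<lambda>v. \<omega> (i # v)) \<in> E} = N.prob B * P.prob E"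
    and "{\<omega>. \<omega> [] \<in> B \<and> (\<lambda>v. \<omega> (i # v)) \<in> E} \<in> sets P"
proof -
  show "P.prob {\<omega>. \<omega> [] \<in> B \<and> (\<lambda>v. \<omega> (i # v)) \<in> E} = N.prob B * P.prob E"
    using prob_branching_single[OF prob_space_N B E[unfolded P_eq], of i] by (simp add: P_eq[symmetric])
  have "(\<lambda>\<omega>. \<omega> []) -` B \<inter> space P \<in> sets P" "(\<lambda>\<omega> v. \<omega> (i # v)) -` E \<inter> space P \<in> sets P"
    using measurable_sets[OF measurable_coordinate B] measurable_sets[OF measurable_subtree E[unfolded P_eq]]
    by (simp_all add: P_eq[symmetric])
  then have "((\<lambda>\<omega>. \<omega> []) -` B) \<inter> ((\<lambda>\<omega> v. \<omega> (i # v)) -` E) \<in> sets P"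
    by auto
  moreover have "((\<lambda>\<omega>. \<omega> []) -` B) \<inter> ((\<lambda>\<omega> v. \<omega> (i # v)) -` E) = {\<omega>. \<omega> [] \<in> B \<and> (\<lambda>v. \<omega> (i # v)) \<in> E}"
    by auto
  ultimately show "{\<omega>. \<omega> [] \<in> B \<and> (\<lambda>v. \<omega> (i # v)) \<in> E} \<in> sets P" by simp
qed

lemma root:
  assumes "B \<in> sets N"
  shows "P.prob {\<omega>. \<omega> [] \<in> B} = N.prob B" and "{\<omega>. \<omega> [] \<in> B} \<in> sets P"
  using root_subtree[OF assms sets.top[of P]] P.prob_space by simp_all

lemma prob_UN_le:
  assumes "\<And>i. X i \<in> sets P" "\<And>i. P.prob (X i) \<le> a i" "a sums s"
  shows "P.prob (\<Union>i::nat. X i) \<le> s"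
proof -
  have sm: "summable (\<lambda>i. P.prob (X i))"
    by (rule summable_comparison_test'[of a 0]) (use assms in \<open>auto simp: sums_iff\<close>)
  then have "P.prob (\<Union>i. X i) \<le> (\<Sum>i. P.prob (X i))"
    using assms by (intro P.finite_measure_subadditive_countably) auto
  also have "\<dots> \<le> (\<Sum>i. a i)" using assms sm by (intro suminf_le) (auto simp: sums_iff)
  finally show ?thesis using assms by (simp add: sums_iff)
qed

context
  fixes A :: "real set"
  assumes A [measurable]: "A \<in> sets borel"
begin

abbreviation (input) "pot \<equiv> (\<lambda>b::bool. {m :: nat \<times> (nat \<times> nat) \<times> real. snd (snd m) \<in> A})"

lemma sets_pot: "pot b \<in> sets N"
  using measurable_sets[OF measurable_mark(3) A] by (simp add: vimage_def)

text \<open>First-moment bound: each of the \<open>k + 1\<close> generations of a critical tree has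
  mean size 1.\<close>

lemma prob_hit_normal: "P.prob {\<omega>. hit pot False k \<omega>} \<le> real (Suc k) * measure (pareto \<alpha>) A"
proof (induction k)
  case 0
  show ?case using root(1)[OF sets_pot] measure_N_potential[OF A] by (simp add: hit_0)
next
  case (Suc k)
  define X where "X i = {\<omega>. \<omega> [] \<in> {m. i < num_children False m} \<and> (\<lambda>v. \<omega> (i # v)) \<in> {\<omega>. hit pot False k \<omega>}}" for i
  have sE: "{\<omega>. hit pot False k \<omega>} \<in> sets P" by (rule sets_hit) (rule sets_pot)+
  have sB: "{m. i < num_children False m} \<in> sets N" for i
    using measurable_sets[OF measurable_num_children, of "{i<..}" False] by (simp add: vimage_def)
  have X: "X i \<in> sets P" "P.prob (X i) = measure \<mu> {k. i < k} * P.prob {\<omega>. hit pot False k \<omega>}" for i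
    unfolding X_def using root_subtree[OF sB sE] measure_N_fst[of "{i<..}"]
    by (simp_all add: num_children_def greaterThan_def)
  have "P.prob {\<omega>. hit pot False (Suc k) \<omega>} \<le> P.prob ({\<omega>. \<omega> [] \<in> pot False} \<union> (\<Union>i. X i))"
  proof (rule P.finite_measure_mono)
    show "{\<omega>. hit pot False (Suc k) \<omega>} \<subseteq> {\<omega>. \<omega> [] \<in> pot False} \<union> (\<Union>i. X i)"
      by (auto simp: hit_Suc X_def)
    show "{\<omega>. \<omega> [] \<in> pot False} \<union> (\<Union>i. X i) \<in> sets P"
      using root(2)[OF sets_pot] X(1) by (intro sets.Un sets.countable_UN) auto
  qed
  also have "\<dots> \<le> P.prob {\<omega>. \<omega> [] \<in> pot False} + P.prob (\<Union>i. X i)"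
    using root(2)[OF sets_pot] X(1) by (intro measure_Un_le sets.countable_UN) auto
  also have "P.prob (\<Union>i. X i) \<le> 1 * P.prob {\<omega>. hit pot False k \<omega>}"
    by (rule prob_UN_le[OF X(1) _ sums_mult2[OF sums_children_tail]]) (simp add: X(2))
  also have "P.prob {\<omega>. \<omega> [] \<in> pot False} = measure (pareto \<alpha>) A"
    using root(1)[OF sets_pot] measure_N_potential[OF A] by simp
  finally show ?case using Suc by (simp add: algebra_simps)
qed

text \<open>
  Special offspring numbers have infinite mean when \<open>\<beta> < 2\<close>; hence those above \<open>y\<close> are paid for by their
  probability \<open>\<tau>\<close>, and \<open>M2\<close> is the mean of those below \<open>y\<close>.
\<close>

lemma prob_hit_special:
  fixes y :: real
  defines "\<tau> \<equiv> tail_mean y" and "M2 \<equiv> measure_pmf.expectation \<mu> (\<lambda>k. (real k)\<^sup>2 * indicator {k. real k \<le> y} k)"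
  shows "P.prob {\<omega>. hit pot True k \<omega>} \<le> real (Suc k) * measure (pareto \<alpha>) A + real k * \<tau> + real k * M2 * (real k * measure (pareto \<alpha>) A)"
proof (induction k)
  case 0
  show ?case using root(1)[OF sets_pot] measure_N_potential[OF A] by (simp add: hit_0)
next
  case (Suc k)
  define p where "p = measure (pareto \<alpha>) A"
  \<comment> \<open>When at most \<open>y\<close> children are present, their indices are below
    \<open>Y\<close>, so finitely many \<open>X i\<close> suffice.\<close>
  define Y where "Y = nat \<lfloor>y\<rfloor>"
  define B where "B i = {m. i < num_children True m \<and> real (num_children True m) \<le> y}" for i
  define X where "X i = {\<omega>. \<omega> [] \<in> B i \<and> (\<lambda>v. \<omega> (i # v)) \<in> {\<omega>. hit pot False k \<omega>}}" for i
  define W where "W i = {\<omega>. \<omega> [] \<in> {m. spine_child m = i} \<and> (\<lambda>v. \<omega> (i # v)) \<in> {\<omega>. hit pot True k \<omega>}}" for i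
  define V where "V = {m. y < real (num_children True m)}"
  have sE: "{\<omega>. hit pot b k \<omega>} \<in> sets P" for b by (rule sets_hit) (rule sets_pot)+
  have sets_nc: "{m. num_children True m \<in> Z} \<in> sets N" for Z
    using measurable_sets[OF measurable_num_children, of Z True] by (simp add: vimage_def)
  have sB: "B i \<in> sets N" for i
    using sets_nc[of "{n. i < n \<and> real n \<le> y}"] by (simp add: B_def)
  have sV: "V \<in> sets N" using sets_nc[of "{n. y < real n}"] by (simp add: V_def)
  have sC: "{m. spine_child m = i} \<in> sets N" for i
    using measurable_sets[OF measurable_spine_child, of "{i}"] by (simp add: vimage_def)
  have nc: "N.prob {m. num_children True m \<in> Z} = measure_pmf.expectation \<mu> (\<lambda>k. real k * indicator Z k)" for Z
    using measure_N_special[of "{m. fst m \<in> Z}"] by (simp add: num_children_def measure_special_fst measure_size_biased)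
  have X: "X i \<in> sets P" "P.prob (X i) = N.prob (B i) * P.prob {\<omega>. hit pot False k \<omega>}" for i
    unfolding X_def using root_subtree[OF sB sE] by simp_all
  have W: "W i \<in> sets P" "P.prob (W i) = N.prob {m. spine_child m = i} * P.prob {\<omega>. hit pot True k \<omega>}" for i
    unfolding W_def using root_subtree[OF sC sE] by simp_all
  \<comment> \<open>Four causes of a hit: the root itself, a root with more than \<open>y\<close>
    children (counted as a hit outright), a normal child of a root with at most \<open>y\<close>
    children, or the spine child.\<close>
  have "P.prob {\<omega>. hit pot True (Suc k) \<omega>}
      \<le> P.prob ({\<omega>. \<omega> [] \<in> pot False} \<union> ({\<omega>. \<omega> [] \<in> V} \<union> ((\<Union>i<Y. X i) \<union> (\<Union>i. W i))))"
  proof (rule P.finite_measure_mono)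
    have "\<omega> [] \<in> pot False \<or> \<omega> [] \<in> V \<or> (\<exists>i<Y. \<omega> \<in> X i) \<or> (\<exists>i. \<omega> \<in> W i)" if h: "hit pot True (Suc k) \<omega>" for \<omega>
    proof -
      consider "\<omega> [] \<in> pot False" | i where "i < num_children True (\<omega> [])" "hit pot (True \<and> i = spine_child (\<omega> [])) k (\<lambda>v. \<omega> (i # v))"
        using h unfolding hit_Suc by blast
      then show ?thesis
      proof cases
        case (2 i)
        show ?thesis
        proof (cases "\<omega> [] \<in> V \<or> i = spine_child (\<omega> [])")
          case False
          then have "i < Y" using 2(1) unfolding Y_def V_def by simp linarith
          moreover have "\<omega> \<in> X i" using False 2 by (simp add: X_def B_def V_def)
          ultimately show ?thesis by blast
        next
          case True
          then show ?thesis using 2(2) by (auto simp: W_def)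
        qed
      qed blast
    qed
    then show "{\<omega>. hit pot True (Suc k) \<omega>} \<subseteq> {\<omega>. \<omega> [] \<in> pot False} \<union> ({\<omega>. \<omega> [] \<in> V} \<union> ((\<Union>i<Y. X i) \<union> (\<Union>i. W i)))"
      by blast
    show "{\<omega>. \<omega> [] \<in> pot False} \<union> ({\<omega>. \<omega> [] \<in> V} \<union> ((\<Union>i<Y. X i) \<union> (\<Union>i. W i))) \<in> sets P"
      using root(2)[OF sets_pot] root(2)[OF sV] X(1) W(1) by (intro sets.Un sets.countable_UN sets.finite_UN) auto
  qed
  also have "\<dots> \<le> P.prob {\<omega>. \<omega> [] \<in> pot False} + (P.prob {\<omega>. \<omega> [] \<in> V} + (P.prob (\<Union>i<Y. X i) + P.prob (\<Union>i. W i)))"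
    using root(2)[OF sets_pot] root(2)[OF sV] X(1) W(1)
    by (intro order_trans[OF measure_Un_le] add_left_mono sets.Un sets.countable_UN sets.finite_UN order_refl) auto
  also have "P.prob {\<omega>. \<omega> [] \<in> pot False} = p"
    using root(1)[OF sets_pot] measure_N_potential[OF A] by (simp add: p_def)
  also have "P.prob {\<omega>. \<omega> [] \<in> V} = \<tau>"
    using root(1)[OF sV] nc[of "{n. y < real n}"] by (simp add: \<tau>_def tail_mean_def V_def)
  also have "P.prob (\<Union>i. W i) \<le> 1 * P.prob {\<omega>. hit pot True k \<omega>}"
    by (rule prob_UN_le[OF W(1) _ sums_mult2[OF sums_spine_child]]) (simp add: W(2))
  also have "P.prob (\<Union>i<Y. X i) \<le> M2 * P.prob {\<omega>. hit pot False k \<omega>}"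
  proof -
    have "P.prob (\<Union>i<Y. X i) \<le> (\<Sum>i<Y. P.prob (X i))"
      using X(1) by (intro P.finite_measure_subadditive_finite) auto
    also have "\<dots> = (\<Sum>i<Y. N.prob (B i)) * P.prob {\<omega>. hit pot False k \<omega>}"
      by (simp add: X(2) sum_distrib_right)
    also have "(\<Sum>i<Y. N.prob (B i)) = (\<Sum>i<Y. measure_pmf.expectation \<mu> (\<lambda>k. real k * indicator {n. i < n \<and> real n \<le> y} k))"
      using nc[of "{n. i < n \<and> real n \<le> y}" for i] by (simp add: B_def)
    also have "\<dots> = measure_pmf.expectation \<mu> (\<lambda>k. \<Sum>i<Y. real k * indicator {n. i < n \<and> real n \<le> y} k)"
      by (rule Bochner_Integration.integral_sum[symmetric]) (rule integrable_tail_mean)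
    \<comment> \<open>One factor \<open>k\<close> comes from size-biasing and the other from
      counting the children, which produces the truncated second moment.\<close>
    also have "\<dots> = M2"
      unfolding M2_def
    proof (rule Bochner_Integration.integral_cong[OF refl])
      fix k :: nat
      show "(\<Sum>i<Y. real k * indicator {n. i < n \<and> real n \<le> y} k) = (real k)\<^sup>2 * indicator {k. real k \<le> y} k"
      proof (cases "real k \<le> y")
        case True
        then have "{..<Y} \<inter> {i. i < k} = {..<k}" by (auto simp: Y_def) linarith
        then have "(\<Sum>i<Y. indicator {n. i < n \<and> real n \<le> y} k) = real k"
          using True by (simp add: indicator_def sum.If_cases flip: of_bool_def)
        then show ?thesis using True by (simp add: power2_eq_square flip: sum_distrib_left)
      qed simp
    qed
    finally show ?thesis .
  qed
  also have "M2 * P.prob {\<omega>. hit pot False k \<omega>} \<le> M2 * (real (Suc k) * p)"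
    unfolding p_def M2_def by (intro mult_left_mono prob_hit_normal) (auto intro!: integral_nonneg_AE)
  finally have "P.prob {\<omega>. hit pot True (Suc k) \<omega>} \<le> p + (\<tau> + (M2 * (real (Suc k) * p) + P.prob {\<omega>. hit pot True k \<omega>}))"
    by simp
  also have "P.prob {\<omega>. hit pot True k \<omega>} \<le> real (Suc k) * p + real k * \<tau> + real k * M2 * (real (Suc k) * p)"
  proof -
    have "M2 \<ge> 0" unfolding M2_def by (auto intro!: integral_nonneg_AE)
    then have "real k * M2 * (real k * p) \<le> real k * M2 * (real (Suc k) * p)"
      by (intro mult_left_mono mult_right_mono) (auto simp: p_def)
    then show ?thesis using Suc by (simp add: p_def)
  qed
  finally show ?case by (simp add: p_def algebra_simps)
qed

end

text \<open>With \<open>q = R powr d / x powr \<alpha>\<close>, the natural count of vertices above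
  \<open>x\<close>, the truncated recursion gives \<open>q powr (\<beta> - 1)\<close>. For
  \<open>q \<ge> 1\<close> the bound exceeds 1. For \<open>q < 1\<close> the term
  \<open>R * p\<close> is at most \<open>q\<close>, hence at most
  \<open>q powr (\<beta> - 1)\<close> because \<open>\<beta> \<le> 2\<close>.\<close>

lemma prob_potential_ge:
  defines "d \<equiv> \<beta> / (\<beta> - 1)"
  obtains C where "C > 0" "\<And>R x. 1 \<le> R \<Longrightarrow> 1 \<le> x \<Longrightarrow>
    P.prob {\<omega>. \<exists>v\<in>vertices \<omega>. real (length v) \<le> R \<and> x \<le> potential \<omega> v} \<le> C * (R powr d / x powr \<alpha>) powr (\<beta> - 1)"
proof -
  obtain C where C: "C > 0"
    "\<And>y. 1 \<le> y \<Longrightarrow> measure_pmf.expectation \<mu> (\<lambda>k. (real k)\<^sup>2 * indicator {k. real k \<le> y} k) \<le> C * y powr (2 - \<beta>)"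
    using truncated_second_moment by blast
  obtain D where D: "D > 0" "\<And>y. 1 \<le> y \<Longrightarrow> tail_mean y \<le> D * y powr (1 - \<beta>)"
    using tail_mean_upper by blast
  have main: "P.prob {\<omega>. \<exists>v\<in>vertices \<omega>. real (length v) \<le> R \<and> x \<le> potential \<omega> v} \<le> (2 + C + D) * (R powr d / x powr \<alpha>) powr (\<beta> - 1)"
    if R: "1 \<le> R" and x: "1 \<le> x" for R x
  proof -
    define q where "q = R powr d / x powr \<alpha>"
    have q: "q > 0" using R x by (simp add: q_def)
    show ?thesis
    proof (cases "q \<ge> 1")
      case True
      then have "1 * 1 \<le> (2 + C + D) * q powr (\<beta> - 1)"
        using C D beta_gt by (intro mult_mono ge_one_powr_ge_zero) auto
      then have "1 \<le> (2 + C + D) * (R powr d / x powr \<alpha>) powr (\<beta> - 1)" by (simp add: q_def)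
      then show ?thesis by (rule order_trans[OF P.prob_le_1])
    next
      case False
      define k where "k = nat \<lfloor>R\<rfloor>"
      have kR: "real k \<le> R" "real (Suc k) \<le> 2 * R" using R by (auto simp: k_def) linarith+
      \<comment> \<open>This truncation level balances the two remaining errors:
        \<open>R * y powr (1 - \<beta>)\<close> from large offspring numbers and
        \<open>R * R * p * y powr (2 - \<beta>)\<close> from the truncated mean both become
        \<open>q powr (\<beta> - 1)\<close>.\<close>
      define y where "y = R powr (1 / (\<beta> - 1)) / q"
      define p where "p = measure (pareto \<alpha>) {x..}"
      have p: "p = x powr (- \<alpha>)" unfolding p_def by (rule pareto_tail[OF alpha_pos x])
      have p0: "p > 0" using p x by simp
      have qp: "q = R powr d * p" unfolding q_def p by (simp add: powr_minus divide_inverse)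
      have "1 * 1 \<le> R powr (1 / (\<beta> - 1)) * (1 / q)"
        using q False R beta_gt by (intro mult_mono ge_one_powr_ge_zero) auto
      then have y: "1 \<le> y" by (simp add: y_def)
      have "P.prob {\<omega>. \<exists>v\<in>vertices \<omega>. real (length v) \<le> R \<and> x \<le> potential \<omega> v} = P.prob {\<omega>. hit (\<lambda>b. {m. snd (snd m) \<in> {x..}}) True k \<omega>}"
      proof -
        have "real n \<le> R \<longleftrightarrow> n \<le> k" for n using R by (simp add: k_def le_nat_floor le_nat_iff le_floor_iff)
        then show ?thesis
          by (intro arg_cong[where f=P.prob] Collect_cong) (auto simp: hit_def vertices_iff potential_def)
      qed
      also have "\<dots> \<le> real (Suc k) * p + real k * tail_mean y
          + real k * measure_pmf.expectation \<mu> (\<lambda>k. (real k)\<^sup>2 * indicator {k. real k \<le> y} k) * (real k * p)"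
        unfolding p_def by (rule prob_hit_special) simp
      also have "\<dots> \<le> (2 * R) * p + R * (D * y powr (1 - \<beta>)) + R * (C * y powr (2 - \<beta>)) * (R * p)"
      proof (intro add_mono mult_mono)
        show "0 \<le> tail_mean y" unfolding tail_mean_def by (auto intro!: integral_nonneg_AE)
      qed (use kR R p0 C D y in \<open>auto intro!: integral_nonneg_AE\<close>)
      also have "(2 * R) * p \<le> 2 * q powr (\<beta> - 1)"
      proof -
        have d1: "d \<ge> 1" using beta_gt by (simp add: d_def)
        have "R powr 1 \<le> R powr d" using d1 R by (intro powr_mono) auto
        then have "R * p \<le> q" unfolding qp using p0 R by simp
        also have "q = q powr 1" using q by simp
        also have "\<dots> \<le> q powr (\<beta> - 1)" using q False beta_le by (intro powr_mono') auto
        finally show ?thesis by simp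
      qed
      also have "R * (D * y powr (1 - \<beta>)) = D * q powr (\<beta> - 1)"
      proof -
        have "y powr (1 - \<beta>) = R powr (1 / (\<beta> - 1) * (1 - \<beta>)) / q powr (1 - \<beta>)"
          unfolding y_def using q by (simp add: powr_divide powr_powr)
        also have "1 / (\<beta> - 1) * (1 - \<beta>) = - 1" using beta_gt by (simp add: field_simps)
        also have "R powr (- 1) / q powr (1 - \<beta>) = q powr (\<beta> - 1) / R"
          using R q powr_minus[of q "1 - \<beta>"] by (simp add: powr_minus divide_simps)
        finally show ?thesis using R by simp
      qed
      also have "R * (C * y powr (2 - \<beta>)) * (R * p) = C * q powr (\<beta> - 1)"
      proof -
        have "R * R * y powr (2 - \<beta>) = R powr 2 * (R powr (1 / (\<beta> - 1) * (2 - \<beta>)) / q powr (2 - \<beta>))"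
          unfolding y_def using q R by (simp add: powr_divide powr_powr power2_eq_square)
        also have "\<dots> = R powr (2 + 1 / (\<beta> - 1) * (2 - \<beta>)) / q powr (2 - \<beta>)"
          by (simp add: powr_add)
        also have "2 + 1 / (\<beta> - 1) * (2 - \<beta>) = d"
          using beta_gt by (simp add: d_def field_simps)
        finally have "R * R * y powr (2 - \<beta>) * p = q powr 1 / q powr (2 - \<beta>)"
          using q by (simp add: qp)
        also have "\<dots> = q powr (\<beta> - 1)" unfolding powr_diff[symmetric] by simp
        finally show ?thesis by (simp add: mult_ac)
      qed
      finally show ?thesis unfolding q_def[symmetric] by (simp add: algebra_simps)
    qed
  qed
  show ?thesis by (rule that[of "2 + C + D"]) (use C D main in auto)
qed

end

section \<open>Leaves with potential in a prescribed set\<close>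

lemma hit_mono: "hit S b k \<omega> \<Longrightarrow> hit S b (Suc k) \<omega>"
  unfolding hit_def by (meson le_SucI)

context kesten_tree
begin

context
  fixes A :: "real set"
  assumes A [measurable]: "A \<in> sets borel"
begin

text \<open>Normal childless vertices: the root of the whole tree is special, so such a vertex has a
  parent and degree exactly 1. \<open>A\<close> is left arbitrary so that two disjoint windows of
  potential values can be inserted.\<close>

abbreviation (input) "leaf \<equiv> (\<lambda>b::bool. {m :: nat \<times> (nat \<times> nat) \<times> real. \<not> b \<and> fst m = 0 \<and> snd (snd m) \<in> A})"

lemma sets_leaf: "leaf b \<in> sets N"
proof -
  have "{m. fst m = 0} \<in> sets N" "{m. snd (snd m) \<in> A} \<in> sets N"
    using measurable_sets[OF measurable_mark(1), of "{0}"] measurable_sets[OF measurable_mark(3) A]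
    by (simp_all add: vimage_def)
  moreover have "leaf b = (if b then {} else {m. fst m = 0} \<inter> {m. snd (snd m) \<in> A})" by auto
  ultimately show ?thesis by auto
qed

definition hit_prob :: "nat \<Rightarrow> real" where
  "hit_prob k = P.prob {\<omega>. hit leaf False k \<omega>}"

definition miss_prob :: "nat \<Rightarrow> real" where
  "miss_prob k = P.prob {\<omega>. \<not> hit leaf True k \<omega>}"

lemma sets_hit_leaf: "{\<omega>. hit leaf b k \<omega>} \<in> sets P" "{\<omega>. \<not> hit leaf b k \<omega>} \<in> sets P"
  by (rule sets_hit; rule sets_leaf)+

lemma prob_not_hit: "P.prob {\<omega>. \<not> hit leaf False k \<omega>} = 1 - hit_prob k"
proof -
  have "{\<omega>. \<not> hit leaf False k \<omega>} = space P - {\<omega>. hit leaf False k \<omega>}" by auto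
  then show ?thesis using P.prob_compl[OF sets_hit_leaf(1)] by (simp add: hit_prob_def)
qed

lemma hit_prob_bounds: "0 \<le> hit_prob k" "hit_prob k \<le> 1"
  by (simp_all add: hit_prob_def)

lemma hit_prob_mono: "hit_prob k \<le> hit_prob (Suc k)"
  unfolding hit_prob_def
  by (intro P.finite_measure_mono sets_hit_leaf) (auto dest: hit_mono)

text \<open>A normal tree with \<open>n\<close> children at the root misses iff all \<open>n\<close>
  subtrees miss and, for \<open>n = 0\<close>, the potential of the root avoids \<open>A\<close>.
  Summing over \<open>n\<close> gives \<open>f (1 - u) - \<mu>\<^sub>0 * s\<close>, where
  \<open>f\<close> is the generating function and \<open>s\<close> the mass of
  \<open>A\<close>.\<close>

lemma hit_prob_Suc:
  "hit_prob (Suc k) = hit_prob k + pmf \<mu> 0 * measure (pareto \<alpha>) A - kap (hit_prob k)"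
proof -
  define s where "s = measure (pareto \<alpha>) A"
  define b where "b = 1 - hit_prob k"
  have b: "0 \<le> b" "b \<le> 1" using hit_prob_bounds[of k] by (auto simp: b_def)
  define B where "B n = {m. fst m = n} - leaf False" for n
  have sn: "{m. fst m = n} \<in> sets N" for n
    using measurable_sets[OF measurable_mark(1), of "{n}"] by (simp add: vimage_def)
  have sB: "B n \<in> sets N" for n unfolding B_def by (intro sets.Diff sn sets_leaf)
  define X where "X n = {\<omega>. \<omega> [] \<in> B n \<and> (\<forall>i<n. (\<lambda>v. \<omega> (i # v)) \<in> {\<omega>. \<not> hit leaf False k \<omega>})}" for n
  have X: "P.prob (X n) = N.prob (B n) * b ^ n" for n
    using prob_branching[OF prob_space_N sB, of n "\<lambda>_. {\<omega>. \<not> hit leaf False k \<omega>}" n] sets_hit_leaf(2)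
    by (simp add: X_def P_eq[symmetric] prob_not_hit b_def)
  have sX: "X n \<in> sets P" for n
  proof -
    have "X n = {\<omega>. \<omega> [] \<in> B n} \<inter> (\<Inter>i\<in>{..<n}. {\<omega>. \<omega> [] \<in> space N \<and> (\<lambda>v. \<omega> (i # v)) \<in> {\<omega>. \<not> hit leaf False k \<omega>}}) "
      by (auto simp: X_def)
    also have "\<dots> \<in> sets P"
    proof (cases "n = 0")
      case False
      then show ?thesis
        using root(2)[OF sB] root_subtree(2)[OF sets.top sets_hit_leaf(2)] by (intro sets.Int sets.finite_INT) auto
    qed (use root(2)[OF sB] in simp)
    finally show ?thesis .
  qed
  have "(\<lambda>n. P.prob (X n)) sums P.prob (\<Union>n. X n)"
    using sX by (intro P.finite_measure_UNION) (auto simp: disjoint_family_on_def X_def B_def)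
  moreover have "(\<Union>n. X n) = {\<omega>. \<not> hit leaf False (Suc k) \<omega>}"
    by (auto simp: X_def B_def hit_Suc num_children_def)
  ultimately have 1: "(\<lambda>n. N.prob (B n) * b ^ n) sums (1 - hit_prob (Suc k))"
    by (simp add: X prob_not_hit)
  have NB: "N.prob (B n) = pmf \<mu> n - (if n = 0 then pmf \<mu> 0 * s else 0)" for n
  proof -
    have "N.prob (B n) = N.prob {m. fst m = n} - N.prob ({m. fst m = n} \<inter> leaf False)"
      unfolding B_def by (rule N.finite_measure_Diff'[OF sn sets_leaf])
    also have "N.prob {m. fst m = n} = pmf \<mu> n"
      using measure_N_fst[of "{n}"] by (simp add: measure_pmf_single)
    also have "N.prob ({m. fst m = n} \<inter> leaf False) = (if n = 0 then pmf \<mu> 0 * s else 0)"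
    proof (cases "n = 0")
      case True
      then have "{m. fst m = n} \<inter> leaf False = {m. fst m \<in> {0} \<and> fst (snd m) \<in> UNIV \<and> snd (snd m) \<in> A}" by auto
      then show ?thesis using measure_N[OF A, of "{0}" UNIV] True by (simp add: s_def measure_pmf_single)
    next
      case False
      then have "{m. fst m = n} \<inter> leaf False = {}" by auto
      then show ?thesis using False by simp
    qed
    finally show ?thesis .
  qed
  have "(\<lambda>n. (pmf \<mu> n * b ^ n) - (if n = 0 then pmf \<mu> 0 * s else 0)) sums
      (measure_pmf.expectation \<mu> (\<lambda>n. b ^ n) - pmf \<mu> 0 * s)"
    using b by (intro sums_diff sums_expectation integrable_mu_power sums_single[of 0 "\<lambda>_. pmf \<mu> 0 * s", simplified])
  moreover have "(pmf \<mu> n * b ^ n) - (if n = 0 then pmf \<mu> 0 * s else 0) = N.prob (B n) * b ^ n" for n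
    by (auto simp: NB algebra_simps)
  ultimately have "1 - hit_prob (Suc k) = measure_pmf.expectation \<mu> (\<lambda>n. b ^ n) - pmf \<mu> 0 * s"
    using 1 by (metis (no_types, lifting) sums_cong sums_unique2)
  then show ?thesis by (simp add: kap_def b_def s_def)
qed

text \<open>
  With \<open>u\<^sub>k\<close> the hitting probability in a normal tree, the missing probability along the spine is multiplied
  by \<open>f'(1 - u\<^sub>k)\<close> at each step.
\<close>

lemma miss_prob_Suc:
  "miss_prob (Suc k) \<le> measure_pmf.expectation \<mu> (\<lambda>n. real n * (1 - hit_prob k) ^ (n - 1)) * miss_prob k"
proof -
  define b where "b = 1 - hit_prob k"
  have b: "0 \<le> b" "b \<le> 1" using hit_prob_bounds[of k] by (auto simp: b_def)
  define e where "e = miss_prob k"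
  have e: "e \<ge> 0" by (simp add: e_def miss_prob_def)
  define Q where "Q n j = {m :: nat \<times> (nat \<times> nat) \<times> real. fst (snd m) = (n, j)}" for n j :: nat
  have sQ: "Q n j \<in> sets N" for n j
    using measurable_sets[OF measurable_mark(2), of "{(n, j)}"] by (simp add: Q_def vimage_def)
  have NQ: "N.prob (Q n j) = pmf \<mu> n" if "j < n" for n j
    using measure_N_special[of "{(n, j)}"] that
    by (simp add: Q_def measure_pmf_single pmf_special_offspring[OF critical])
  \<comment> \<open>Pairs with \<open>n \<le> j\<close> designate no existing child. They have
    probability 0 but are points of the space, and the events \<open>X n j\<close> with
    \<open>j < n\<close> do not cover them.\<close>
  define Bad where "Bad = {m :: nat \<times> (nat \<times> nat) \<times> real. fst (snd m) \<in> {(n, j). n \<le> j}}"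
  have sBad: "Bad \<in> sets N"
    using measurable_sets[OF measurable_mark(2), of "{(n, j). n \<le> j}"] by (simp add: Bad_def vimage_def)
  have NBad: "N.prob Bad = 0"
  proof -
    have "measure (special_offspring \<mu>) {(n, j). n \<le> j} = 0"
    proof (subst measure_pmf_zero_iff, intro equals0I)
      fix x assume x: "x \<in> set_pmf (special_offspring \<mu>) \<inter> {(n, j). n \<le> j}"
      obtain n j where "x = (n, j)" by (cases x)
      then show False using x pmf_special_offspring[OF critical, of n j] by (auto simp: set_pmf_iff)
    qed
    then show ?thesis using measure_N_special[of "{(n, j). n \<le> j}"] by (simp add: Bad_def)
  qed
  define E where "E j i = (if i = j then {\<omega>. \<not> hit leaf True k \<omega>} else {\<omega>. \<not> hit leaf False k \<omega>})" for i j :: nat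
  have sE: "E j i \<in> sets P" for i j using sets_hit_leaf(2) by (simp add: E_def)
  \<comment> \<open>A special root is itself never a leaf in this sense, so a miss means a miss in
    the subtree \<open>j\<close> carrying the spine and in \<open>n - 1\<close> normal ones. Each of
    the \<open>n\<close> positions of \<open>j\<close> has mass \<open>pmf \<mu> n\<close>; their
    sum produces the derivative of the generating function.\<close>
  define X where "X n j = {\<omega>. \<omega> [] \<in> Q n j \<and> (\<forall>i<n. (\<lambda>v. \<omega> (i # v)) \<in> E j i)}" for n j
  have X: "P.prob (X n j) = pmf \<mu> n * (e * b ^ (n - 1))" if j: "j < n" for n j
  proof -
    have "P.prob (X n j) = N.prob (Q n j) * (\<Prod>i<n. P.prob (E j i))"
      using prob_branching[OF prob_space_N sQ, of n "E j" n j] sE by (simp add: X_def P_eq[symmetric])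
    also have "(\<Prod>i<n. P.prob (E j i)) = P.prob (E j j) * (\<Prod>i\<in>{..<n} - {j}. P.prob (E j i))"
      using j by (intro prod.remove) auto
    also have "(\<Prod>i\<in>{..<n} - {j}. P.prob (E j i)) = (\<Prod>i\<in>{..<n} - {j}. b)"
      by (intro prod.cong) (auto simp: E_def prob_not_hit b_def)
    also have "\<dots> = b ^ (n - 1)" using j by simp
    also have "P.prob (E j j) = e" by (simp add: E_def e_def miss_prob_def)
    finally show ?thesis by (simp add: NQ j)
  qed
  have sX: "X n j \<in> sets P" for n j
  proof -
    have "X n j = {\<omega>. \<omega> [] \<in> Q n j} \<inter> (\<Inter>i\<in>{..<n}. {\<omega>. \<omega> [] \<in> space N \<and> (\<lambda>v. \<omega> (i # v)) \<in> E j i}) "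
      by (auto simp: X_def)
    also have "\<dots> \<in> sets P"
    proof (cases "n = 0")
      case False
      then show ?thesis
        using root(2)[OF sQ] root_subtree(2)[OF sets.top sE] by (intro sets.Int sets.finite_INT) auto
    qed (use root(2)[OF sQ] in simp)
    finally show ?thesis .
  qed
  have "miss_prob (Suc k) \<le> P.prob ({\<omega>. \<omega> [] \<in> Bad} \<union> (\<Union>n. \<Union>j<n. X n j))"
    unfolding miss_prob_def
  proof (rule P.finite_measure_mono)
    show "{\<omega>. \<not> hit leaf True (Suc k) \<omega>} \<subseteq> {\<omega>. \<omega> [] \<in> Bad} \<union> (\<Union>n. \<Union>j<n. X n j)"
    proof safe
      fix \<omega> assume h: "\<not> hit leaf True (Suc k) \<omega>" and nX: "\<omega> \<notin> (\<Union>n. \<Union>j<n. X n j)"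
      obtain n j where nj: "fst (snd (\<omega> [])) = (n, j)" by (cases "fst (snd (\<omega> []))")
      have "\<omega> \<in> X n j"
        using h nj by (auto simp: X_def Q_def E_def hit_Suc num_children_def spine_child_def)
      with nX have "\<not> j < n" by blast
      then show "\<omega> [] \<in> Bad" using nj by (simp add: Bad_def)
    qed
    show "{\<omega>. \<omega> [] \<in> Bad} \<union> (\<Union>n. \<Union>j<n. X n j) \<in> sets P"
      using root(2)[OF sBad] sX by (intro sets.Un sets.countable_UN sets.finite_UN) auto
  qed
  also have "\<dots> \<le> P.prob {\<omega>. \<omega> [] \<in> Bad} + P.prob (\<Union>n. \<Union>j<n. X n j)"
    using root(2)[OF sBad] sX by (intro measure_Un_le sets.countable_UN sets.finite_UN) auto
  also have "P.prob {\<omega>. \<omega> [] \<in> Bad} = 0" using root(1)[OF sBad] NBad by simp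
  also have "P.prob (\<Union>n. \<Union>j<n. X n j) \<le> measure_pmf.expectation \<mu> (\<lambda>n. real n * b ^ (n - 1)) * e"
  proof (rule prob_UN_le)
    show "(\<Union>j<n. X n j) \<in> sets P" for n using sX by (intro sets.finite_UN) auto
    show "P.prob (\<Union>j<n. X n j) \<le> pmf \<mu> n * (real n * b ^ (n - 1)) * e" for n
    proof -
      have "P.prob (\<Union>j<n. X n j) \<le> (\<Sum>j<n. P.prob (X n j))"
        using sX by (intro P.finite_measure_subadditive_finite) auto
      also have "\<dots> = (\<Sum>j<n. pmf \<mu> n * (e * b ^ (n - 1)))" by (intro sum.cong) (auto simp: X)
      finally show ?thesis by (simp add: mult_ac)
    qed
    have "integrable (measure_pmf \<mu>) (\<lambda>n. real n * b ^ (n - 1))"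
      using integrable_mu by (rule Bochner_Integration.integrable_bound)
        (use b in \<open>auto simp: power_le_one mult_left_le\<close>)
    then show "(\<lambda>n. pmf \<mu> n * (real n * b ^ (n - 1)) * e) sums (measure_pmf.expectation \<mu> (\<lambda>n. real n * b ^ (n - 1)) * e)"
      by (intro sums_mult2 sums_expectation)
  qed
  finally show ?thesis by (simp add: b_def e_def)
qed

end

text \<open>Let \<open>M = measure (pareto \<alpha>) A * R powr d\<close>. A normal subtree with
  \<open>m\<close> generations left, where \<open>m \<ge> R / 6\<close>, is hit with probability at
  least \<open>T\<close>, of order
  \<open>M powr (1 / \<beta>) * R powr (- 1 / (\<beta> - 1))\<close>. While \<open>m\<close>
  generations remain, each spine step multiplies the missing probability by at most
  \<open>1 - c1 * T powr (\<beta> - 1)\<close>, and at least \<open>R / 4\<close> such steps are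
  available.\<close>

lemma prob_no_leaf:
  defines "d \<equiv> \<beta> / (\<beta> - 1)"
  obtains K where "K > 0" "\<And>A R. A \<in> sets borel \<Longrightarrow> 2 \<le> R \<Longrightarrow> 1 \<le> measure (pareto \<alpha>) A * R powr d \<Longrightarrow>
    P.prob {\<omega>. \<not> (\<exists>v\<in>vertices \<omega>. real (length v) \<le> R \<and> \<not> special \<omega> v \<and> offspring \<omega> v = 0 \<and> potential \<omega> v \<in> A)}
      \<le> exp (- K * (measure (pareto \<alpha>) A * R powr d) powr ((\<beta> - 1) / \<beta>))"
proof -
  obtain c1 where c1: "c1 > 0" "\<And>u. 0 \<le> u \<Longrightarrow> u \<le> 1 \<Longrightarrow> kap u \<ge> c1 * u powr \<beta>"
    using kap_lower by blast
  obtain c2 where c2: "c2 > 0" "\<And>u. 0 \<le> u \<Longrightarrow> u \<le> 1 \<Longrightarrow> kap u \<le> c2 * u powr \<beta>"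
    using kap_upper by blast
  define p0 where "p0 = pmf \<mu> 0"
  have p0: "p0 > 0" using pmf_mu_0_pos by (simp add: p0_def)
  \<comment> \<open>The two terms match the two regimes of \<open>hit_prob\<close>: saturation at
    \<open>us\<close>, which carries \<open>p0 / (2 * c2)\<close>, and linear growth over at least
    \<open>R / 6\<close> steps of size \<open>p0 * s / 2\<close>, whence
    \<open>p0 / 12\<close>.\<close>
  define L where "L = min ((p0 / (2 * c2)) powr (1 / \<beta>)) (p0 / 12)"
  have L: "L > 0" using p0 c2 by (simp add: L_def)
  define K where "K = c1 / 4 * L powr (\<beta> - 1)"
  have K: "K > 0" using c1 L by (simp add: K_def)
  have main: "P.prob {\<omega>. \<not> (\<exists>v\<in>vertices \<omega>. real (length v) \<le> R \<and> \<not> special \<omega> v \<and> offspring \<omega> v = 0 \<and> potential \<omega> v \<in> A)}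
      \<le> exp (- K * (measure (pareto \<alpha>) A * R powr d) powr ((\<beta> - 1) / \<beta>))"
    if A: "A \<in> sets borel" and R: "2 \<le> R" and M: "1 \<le> measure (pareto \<alpha>) A * R powr d" for A R
  proof -
    define s where "s = measure (pareto \<alpha>) A"
    define M where "M = s * R powr d"
    have M1: "M \<ge> 1" using M by (simp add: M_def s_def)
    have s: "s > 0" using M1 R unfolding M_def by (smt (verit) mult_nonpos_nonneg powr_ge_zero)
    define g where "g = p0 * s / 2"
    have g: "g > 0" using p0 s by (simp add: g_def)
    \<comment> \<open>Up to \<open>us\<close> the loss \<open>kap\<close> is at most
      \<open>g\<close>, half of the gain \<open>p0 * s\<close>, so every generation adds at least
      \<open>g\<close>.\<close>
    define us where "us = (g / c2) powr (1 / \<beta>)"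
    note u01 = hit_prob_bounds[OF A]
    let ?u = "hit_prob A" and ?e = "miss_prob A"
    have u_lower: "?u j \<ge> min us (real j * g)" for j
    proof (induction j)
      case 0
      then show ?case using u01 by (simp add: min.coboundedI2)
    next
      case (Suc j)
      show ?case
      proof (cases "?u j \<ge> us")
        case True
        then show ?thesis using hit_prob_mono[OF A, of j] by simp
      next
        case False
        have "?u j powr \<beta> \<le> us powr \<beta>" using False u01 beta_gt by (intro powr_mono2) auto
        also have "\<dots> = g / c2" using g c2 beta_gt by (simp add: us_def powr_powr)
        finally have "c2 * ?u j powr \<beta> \<le> g" using c2 by (simp add: field_simps)
        then have "kap (?u j) \<le> g" using c2(2)[OF u01, of j] by linarith
        then have "?u (Suc j) \<ge> ?u j + g"
          unfolding hit_prob_Suc[OF A] by (simp add: g_def p0_def s_def)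
        then show ?thesis using Suc False g by (simp add: algebra_simps min_def split: if_splits)
      qed
    qed
    define k where "k = nat \<lfloor>R\<rfloor>"
    have k: "real k \<le> R" "R \<le> real k + 1" "k \<ge> 2" using R by (auto simp: k_def le_nat_iff le_floor_iff)
    define m where "m = k div 2"
    have m: "real m \<ge> R / 6" "m \<le> k" "real (k - m) \<ge> R / 4"
    proof -
      have "2 * m \<le> k" "k \<le> 2 * m + 1" by (simp_all add: m_def)
      then have "2 * real m \<le> real k" "real k \<le> 2 * real m + 1" by linarith+
      then show "real m \<ge> R / 6" "m \<le> k" "real (k - m) \<ge> R / 4"
        using k R by (auto simp: of_nat_diff m_def[symmetric])
    qed
    define T where "T = L * M powr (1 / \<beta>) * R powr (- (1 / (\<beta> - 1)))"
    have T: "T > 0" using L M1 R by (simp add: T_def)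
    have um: "?u m \<ge> T"
    proof -
      have sM: "s = M * R powr (- d)" using R by (simp add: M_def mult.assoc flip: powr_add)
      define a where "a = p0 / (2 * c2)"
      have a: "a > 0" using p0 c2 by (simp add: a_def)
      have "us = (a * M * R powr (- d)) powr (1 / \<beta>)"
        by (simp add: us_def g_def sM a_def ac_simps)
      also have "\<dots> = a powr (1 / \<beta>) * M powr (1 / \<beta>) * R powr (- d * (1 / \<beta>))"
        using a M1 R by (simp add: powr_mult powr_powr)
      also have "- d * (1 / \<beta>) = - (1 / (\<beta> - 1))" using beta_gt by (simp add: d_def)
      also have "a powr (1 / \<beta>) * M powr (1 / \<beta>) * R powr (- (1 / (\<beta> - 1))) \<ge> T"
        unfolding T_def by (intro mult_right_mono) (auto simp: L_def a_def)
      finally have 1: "T \<le> us" .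
      \<comment> \<open>Linear growth yields \<open>M\<close> rather than
        \<open>M powr (1 / \<beta>)\<close>; this is where \<open>M \<ge> 1\<close> is used.\<close>
      have "M powr (1 / \<beta>) \<le> M powr 1" using M1 beta_gt by (intro powr_mono) auto
      then have "L * M powr (1 / \<beta>) \<le> p0 / 12 * M" using M1 p0 by (intro mult_mono) (auto simp: L_def)
      then have "T \<le> p0 / 12 * M * R powr (- (1 / (\<beta> - 1)))"
        unfolding T_def by (intro mult_right_mono) auto
      also have "- (1 / (\<beta> - 1)) = 1 + - d" using beta_gt by (simp add: d_def field_simps)
      also have "R powr (1 + - d) = R * R powr (- d)" unfolding powr_add using R by simp
      also have "p0 / 12 * M * (R * R powr (- d)) = R / 6 * g" by (simp add: g_def sM)
      also have "\<dots> \<le> real m * g" using m g by (intro mult_right_mono) auto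
      finally show ?thesis using 1 u_lower[of m] by linarith
    qed
    define w where "w = c1 * T powr (\<beta> - 1)"
    have e_step: "?e (Suc j) \<le> ?e j * exp (- w)" if "m \<le> j" for j
    proof -
      have "?u m \<le> ?u j" using that by (induction rule: dec_induct) (auto intro: order_trans hit_prob_mono[OF A])
      then have uj: "T \<le> ?u j" "?u j > 0" using um T by linarith+
      let ?D = "measure_pmf.expectation \<mu> (\<lambda>n. real n * (1 - ?u j) ^ (n - 1))"
      have "?u j * ?D \<le> ?u j - c1 * ?u j powr \<beta>"
        using mean_derivative_le[OF u01, of j] c1(2)[OF u01, of j] by linarith
      also have "?u j powr \<beta> = ?u j * ?u j powr (\<beta> - 1)" using uj powr_add[of "?u j" 1 "\<beta> - 1"] by simp
      also have "?u j - c1 * (?u j * ?u j powr (\<beta> - 1)) = ?u j * (1 - c1 * ?u j powr (\<beta> - 1))" by (simp add: algebra_simps)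
      finally have "?D \<le> 1 - c1 * ?u j powr (\<beta> - 1)" using uj by simp
      also have "\<dots> \<le> 1 - w" unfolding w_def using uj T c1 beta_gt by (auto intro!: mult_left_mono powr_mono2)
      also have "\<dots> \<le> exp (- w)" using exp_ge_add_one_self[of "- w"] by simp
      finally have "?D * ?e j \<le> exp (- w) * ?e j" by (intro mult_right_mono) (simp_all add: miss_prob_def[OF A])
      then show ?thesis using miss_prob_Suc[OF A, of j] by (simp add: mult.commute)
    qed
    have e_iter: "?e (m + i) \<le> exp (- w) ^ i" for i
    proof (induction i)
      case 0
      show ?case by (simp add: miss_prob_def[OF A])
    next
      case (Suc i)
      have "?e (m + Suc i) \<le> ?e (m + i) * exp (- w)" using e_step[of "m + i"] by simp
      also have "\<dots> \<le> exp (- w) ^ i * exp (- w)" using Suc by (intro mult_right_mono) auto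
      finally show ?case by (simp add: mult.commute)
    qed
    have "?e k \<le> exp (- w) ^ (k - m)" using e_iter[of "k - m"] m by simp
    also have "\<dots> = exp (- w * real (k - m))" using exp_of_nat_mult[of "k - m" "- w"] by (simp only: mult.commute)
    also have "\<dots> \<le> exp (- w * (R / 4))"
      using m T c1 by (auto simp: w_def intro!: mult_left_mono)
    also have "- w * (R / 4) = - K * M powr ((\<beta> - 1) / \<beta>)"
    proof -
      have "T powr (\<beta> - 1) = L powr (\<beta> - 1) * M powr (1 / \<beta> * (\<beta> - 1)) * R powr (- (1 / (\<beta> - 1)) * (\<beta> - 1))"
        unfolding T_def using L M1 R by (simp add: powr_mult powr_powr)
      also have "- (1 / (\<beta> - 1)) * (\<beta> - 1) = - 1" using beta_gt by simp
      also have "R powr (- 1) = 1 / R" using R by (simp add: powr_minus divide_inverse)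
      finally show ?thesis using R by (simp add: w_def K_def)
    qed
    finally have "?e k \<le> exp (- K * M powr ((\<beta> - 1) / \<beta>))" .
    moreover have "?e k = P.prob {\<omega>. \<not> (\<exists>v\<in>vertices \<omega>. real (length v) \<le> R \<and> \<not> special \<omega> v \<and> offspring \<omega> v = 0 \<and> potential \<omega> v \<in> A)}"
    proof -
      have "real n \<le> R \<longleftrightarrow> n \<le> k" for n using R by (simp add: k_def le_nat_floor le_nat_iff le_floor_iff)
      then show ?thesis
        unfolding miss_prob_def[OF A]
        by (intro arg_cong[where f=P.prob] Collect_cong)
          (auto simp: hit_def vertices_iff potential_def special_iff offspring_eq num_children_def)
    qed
    ultimately show ?thesis by (simp add: M_def s_def)
  qed
  show ?thesis by (rule that[OF K main])
qed

end

section \<open>The functional\<close>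

text \<open>With \<open>x = n / t\<close>, the optimal \<rho> is \<open>x / D\<close> if
  \<open>x < D\<close> and 1 otherwise, and the two formulas agree at \<open>D = x\<close>. At the
  root the expression is linear in \<rho>, so the larger endpoint value is taken.\<close>

definition psi_val :: "real \<Rightarrow> nat \<Rightarrow> real \<Rightarrow> real" where
  "psi_val t n D = (if n = 0 then max D 0
     else if D \<le> real n / t then real n / t - real n / t * ln (real n / t)
     else D - real n / t * ln D)"

text \<open>Away from the root both upper bounds are instances of \<open>ln z \<le> z - 1\<close>:
  with \<open>z = \<rho>\<close> where \<rho> = 1 is optimal, and with
  \<open>z = \<rho> * D / x\<close> where \<open>x / D\<close> is, so that equality holds at the
  maximiser.\<close>

lemma psi_eq:
  assumes t: "t > 0"
  shows "psi \<omega> t v = ereal (psi_val t (height \<omega> v) (potential \<omega> v - real (deg \<omega> v)))"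
proof (cases "height \<omega> v = 0")
  case True
  define D where "D = potential \<omega> v - real (deg \<omega> v)"
  have "(SUP \<rho>\<in>{0..1}. ereal ((1 - \<rho>) * D)) = ereal (max D 0)"
  proof (rule antisym)
    show "(SUP \<rho>\<in>{0..1}. ereal ((1 - \<rho>) * D)) \<le> ereal (max D 0)"
    proof (rule SUP_least)
      fix \<rho> :: real assume "\<rho> \<in> {0..1}"
      then have "(1 - \<rho>) * D \<le> (1 - \<rho>) * max D 0" by (intro mult_left_mono) auto
      also have "\<dots> \<le> 1 * max D 0" using \<open>\<rho> \<in> {0..1}\<close> by (intro mult_right_mono) auto
      finally show "ereal ((1 - \<rho>) * D) \<le> ereal (max D 0)" by (simp only: ereal_less_eq mult_1)
    qed
    show "ereal (max D 0) \<le> (SUP \<rho>\<in>{0..1}. ereal ((1 - \<rho>) * D))"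
      by (rule SUP_upper2[of "if D \<ge> 0 then 0 else 1"]) auto
  qed
  then show ?thesis using True by (simp add: psi_def psi_at_def psi_val_def D_def)
next
  case False
  define D where "D = potential \<omega> v - real (deg \<omega> v)"
  define x where "x = real (height \<omega> v) / t"
  have x: "x > 0" using False t by (simp add: x_def)
  have val: "psi_at \<omega> t v \<rho> = ereal ((1 - \<rho>) * D - x * ln x + x * ln \<rho> + x)" if "\<rho> > 0" for \<rho>
  proof -
    have "ln (real (height \<omega> v) / (\<rho> * exp 1 * t)) = ln (x / (\<rho> * exp 1))" by (simp add: x_def mult_ac)
    also have "\<dots> = ln x - ln \<rho> - 1" using that x by (simp add: ln_div ln_mult)
    finally have e: "ln (real (height \<omega> v) / (\<rho> * exp 1 * t)) = ln x - ln \<rho> - 1" .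
    have "psi_at \<omega> t v \<rho> = ereal ((1 - \<rho>) * D - x * ln (real (height \<omega> v) / (\<rho> * exp 1 * t)))"
      using False that by (simp add: psi_at_def D_def x_def)
    then show ?thesis unfolding e by (simp add: algebra_simps)
  qed
  have psi0: "psi_at \<omega> t v 0 = - \<infinity>" using False by (simp add: psi_at_def)
  show ?thesis
  proof (cases "D \<le> x")
    case True
    have "(SUP \<rho>\<in>{0..1}. psi_at \<omega> t v \<rho>) = ereal (x - x * ln x)"
    proof (rule antisym)
      show "(SUP \<rho>\<in>{0..1}. psi_at \<omega> t v \<rho>) \<le> ereal (x - x * ln x)"
      proof (rule SUP_least)
        fix \<rho> :: real assume \<rho>: "\<rho> \<in> {0..1}"
        show "psi_at \<omega> t v \<rho> \<le> ereal (x - x * ln x)"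
        proof (cases "\<rho> = 0")
          case False
          then have r: "0 < \<rho>" "\<rho> \<le> 1" using \<rho> by auto
          have "(1 - \<rho>) * D \<le> (1 - \<rho>) * x" using True r by (intro mult_left_mono) auto
          moreover have "x * ln \<rho> \<le> x * (\<rho> - 1)" using r x ln_le_minus_one[of \<rho>] by (intro mult_left_mono) auto
          ultimately have "(1 - \<rho>) * D + x * ln \<rho> \<le> 0" by (simp add: algebra_simps)
          then show ?thesis using val[OF r(1)] by simp
        qed (simp add: psi0)
      qed
      show "ereal (x - x * ln x) \<le> (SUP \<rho>\<in>{0..1}. psi_at \<omega> t v \<rho>)"
        by (rule SUP_upper2[of 1]) (auto simp: val)
    qed
    then show ?thesis using True False by (simp add: psi_def psi_val_def D_def x_def)
  next
    case F: False
    then have D: "D > x" "D > 0" using x by auto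
    have "(SUP \<rho>\<in>{0..1}. psi_at \<omega> t v \<rho>) = ereal (D - x * ln D)"
    proof (rule antisym)
      show "(SUP \<rho>\<in>{0..1}. psi_at \<omega> t v \<rho>) \<le> ereal (D - x * ln D)"
      proof (rule SUP_least)
        fix \<rho> :: real assume \<rho>: "\<rho> \<in> {0..1}"
        show "psi_at \<omega> t v \<rho> \<le> ereal (D - x * ln D)"
        proof (cases "\<rho> = 0")
          case False
          then have r: "0 < \<rho>" "\<rho> \<le> 1" using \<rho> by auto
          have "x * ln (\<rho> * D / x) \<le> x * (\<rho> * D / x - 1)"
            using r x D by (intro mult_left_mono ln_le_minus_one) auto
          also have "\<dots> = \<rho> * D - x" using x by (simp add: field_simps)
          also have "ln (\<rho> * D / x) = ln \<rho> + ln D - ln x" using r x D by (simp add: ln_div ln_mult)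
          finally show ?thesis using val[OF r(1)] by (simp add: algebra_simps)
        qed (simp add: psi0)
      qed
      have "ereal (D - x * ln D) = psi_at \<omega> t v (x / D)"
        using x D by (subst val) (auto simp: ln_div field_simps)
      also have "\<dots> \<le> (SUP \<rho>\<in>{0..1}. psi_at \<omega> t v \<rho>)"
        using x D by (intro SUP_upper) auto
      finally show "ereal (D - x * ln D) \<le> (SUP \<rho>\<in>{0..1}. psi_at \<omega> t v \<rho>)" .
    qed
    then show ?thesis using F False by (simp add: psi_def psi_val_def D_def x_def)
  qed
qed

text \<open>Origin of the threshold 1 for ties: away from the root, a value of
  \<open>psi_val\<close> above 1 can only come from the branch \<open>D > n / t\<close>, where it
  depends strictly on \<open>D\<close>.\<close>

lemma minus_mult_ln_le: "x - x * ln x \<le> (1::real)" if "x > 0"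
proof -
  have "x * ln (1 / x) \<le> x * (1 / x - 1)" using that by (intro mult_left_mono ln_le_minus_one) auto
  then show ?thesis using that by (simp add: ln_div algebra_simps)
qed

text \<open>The derivative in \<open>D\<close> is \<open>1 - x / D\<close>, nonnegative from
  \<open>x\<close> on; the bound \<open>ln z \<le> z - 1\<close> at \<open>z = E / D\<close>
  replaces it.\<close>

lemma sub_mult_ln_mono:
  assumes "0 < x" "x \<le> D" "D \<le> (E::real)"
  shows "D - x * ln D \<le> E - x * ln E" and "x < D \<Longrightarrow> D < E \<Longrightarrow> D - x * ln D < E - x * ln E"
proof -
  have "x * (ln E - ln D) = x * ln (E / D)" using assms by (simp add: ln_div)
  also have "\<dots> \<le> x * (E / D - 1)" using assms by (intro mult_left_mono ln_le_minus_one) auto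
  also have "\<dots> = x / D * (E - D)" using assms by (simp add: field_simps)
  finally have 1: "x * (ln E - ln D) \<le> x / D * (E - D)" .
  have "x / D * (E - D) \<le> 1 * (E - D)" using assms by (intro mult_right_mono) auto
  with 1 show "D - x * ln D \<le> E - x * ln E" by (simp add: algebra_simps)
  assume "x < D" "D < E"
  then have "x / D * (E - D) < 1 * (E - D)" using assms by (intro mult_strict_right_mono) auto
  with 1 show "D - x * ln D < E - x * ln E" by (simp add: algebra_simps)
qed

lemma psi_val_mono:
  assumes "t > 0" "D \<le> E"
  shows "psi_val t n D \<le> psi_val t n E"
proof (cases "n = 0")
  case False
  define x where "x = real n / t"
  have x: "x > 0" using False assms by (simp add: x_def)
  consider "E \<le> x" | "D \<le> x" "x < E" | "x < D" by linarith
  then show ?thesis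
  proof cases
    case 2
    then show ?thesis using False sub_mult_ln_mono(1)[OF x, of x E] by (simp add: psi_val_def x_def[symmetric])
  next
    case 3
    then show ?thesis using False assms sub_mult_ln_mono(1)[OF x, of D E] by (simp add: psi_val_def x_def[symmetric])
  qed (use False assms in \<open>simp add: psi_val_def x_def[symmetric]\<close>)
qed (use assms in \<open>auto simp: psi_val_def\<close>)

lemma psi_val_inj:
  assumes "t > 0" "psi_val t n D > 1" "psi_val t n D = psi_val t n E"
  shows "D = E"
proof (cases "n = 0")
  case False
  define x where "x = real n / t"
  have x: "x > 0" using False assms by (simp add: x_def)
  have gt: "x < F" if "psi_val t n F > 1" for F
    using that minus_mult_ln_le[OF x] False by (auto simp: psi_val_def x_def[symmetric] split: if_splits)
  have "x < D" "x < E" using gt assms by auto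
  then have "D - x * ln D = E - x * ln E" using False assms by (simp add: psi_val_def x_def[symmetric])
  then show ?thesis
    using sub_mult_ln_mono(2)[OF x, of D E] sub_mult_ln_mono(2)[OF x, of E D] \<open>x < D\<close> \<open>x < E\<close> by linarith
qed (use assms in \<open>auto simp: psi_val_def max_def split: if_splits\<close>)

text \<open>The first bound is for vertices near the root, where the cost of distance is given up.
  The second is for distant ones: replacing \<open>ln D\<close> by \<open>ln (n / t)\<close> makes
  the cost independent of the potential.\<close>

lemma psi_val_le:
  assumes "t > 0"
  shows "psi_val t n D \<le> max D 0 + 1"
    and "n > 0 \<Longrightarrow> psi_val t n D \<le> max D 0 - real n / t * (ln (real n / t) - 1)"
proof -
  define x where "x = real n / t"
  have le: "psi_val t n D \<le> max D 0 - x * (ln x - 1)" if "n > 0"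
  proof -
    have x: "x > 0" using that assms by (simp add: x_def)
    show ?thesis
    proof (cases "D \<le> x")
      case True
      then show ?thesis using that by (simp add: psi_val_def x_def[symmetric] algebra_simps)
    next
      case False
      then have "x * ln x \<le> x * ln D" using x by (intro mult_left_mono) auto
      moreover have "psi_val t n D = D - x * ln D" using that False by (simp add: psi_val_def x_def)
      moreover have "x * (ln x - 1) = x * ln x - x" by (simp add: algebra_simps)
      ultimately show ?thesis using x by linarith
    qed
  qed
  then show "n > 0 \<Longrightarrow> psi_val t n D \<le> max D 0 - real n / t * (ln (real n / t) - 1)"
    by (simp add: x_def)
  show "psi_val t n D \<le> max D 0 + 1"
  proof (cases "n = 0")
    case False
    then have "x > 0" using assms by (simp add: x_def)
    from minus_mult_ln_le[OF this] le False show ?thesis by (simp add: algebra_simps)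
  qed (simp add: psi_val_def)
qed

lemma psi_val_ge:
  assumes "t > 0" "n > 0" "real n / t \<le> E" "E \<le> D"
  shows "psi_val t n D \<ge> E - real n / t * ln E"
proof -
  have "real n / t > 0" using assms by simp
  show ?thesis
  proof (cases "D \<le> real n / t")
    case True
    then have "D = real n / t" "E = real n / t" using assms by linarith+
    then show ?thesis using assms by (simp add: psi_val_def)
  next
    case False
    then show ?thesis using sub_mult_ln_mono(1)[OF \<open>real n / t > 0\<close> assms(3,4)] assms by (simp add: psi_val_def)
  qed
qed

lemma borel_measurable_psi_val [measurable]: "t > 0 \<Longrightarrow> psi_val t n \<in> borel_measurable borel"
  by (intro borel_measurable_mono monoI psi_val_mono)

text \<open>Built from quantities that make sense for every label and are measurable in the
  environment, unlike the graph distance and degree of a random vertex set at face value; on the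
  vertices of the tree it is \<open>psi\<close>.\<close>

definition score :: "env \<Rightarrow> real \<Rightarrow> nat list \<Rightarrow> real" where
  "score \<omega> t v = psi_val t (length v) (potential \<omega> v - real (offspring \<omega> v + (if v = [] then 0 else 1)))"

lemma psi_eq_score: "t > 0 \<Longrightarrow> v \<in> vertices \<omega> \<Longrightarrow> psi \<omega> t v = ereal (score \<omega> t v)"
  by (simp add: psi_eq score_def height_eq_length deg_eq_offspring)

lemma measure_pareto_singleton:
  assumes "\<alpha> > 0"
  shows "measure (pareto \<alpha>) {x} = 0"
proof -
  interpret real_distribution "pareto \<alpha>" by (rule real_distribution_pareto[OF assms])
  show ?thesis
  proof (cases "x < 1")
    case True
    have "measure (pareto \<alpha>) {x} \<le> measure (pareto \<alpha>) (space (pareto \<alpha>) - {1..})"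
      using True by (intro finite_measure_mono) auto
    also have "\<dots> = 1 - measure (pareto \<alpha>) {1..}" by (rule prob_compl) simp
    also have "\<dots> = 0" using pareto_tail[OF assms, of 1] by simp
    finally show ?thesis by (simp add: measure_le_0_iff)
  next
    case False
    have le: "measure (pareto \<alpha>) {x} \<le> x powr (- \<alpha>) - (x + e) powr (- \<alpha>)" if "e > 0" for e
    proof -
      have "measure (pareto \<alpha>) {x} \<le> measure (pareto \<alpha>) ({x..} - {x + e..})"
        using that by (intro finite_measure_mono) auto
      also have "\<dots> = measure (pareto \<alpha>) {x..} - measure (pareto \<alpha>) {x + e..}"
        using that by (intro finite_measure_Diff) auto
      finally show ?thesis using False that by (simp add: pareto_tail[OF assms])
    qed
    have "((\<lambda>e. x powr (- \<alpha>) - (x + e) powr (- \<alpha>)) \<longlongrightarrow> x powr (- \<alpha>) - (x + 0) powr (- \<alpha>)) (at_right 0)"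
      using False by (intro tendsto_intros) auto
    then have "measure (pareto \<alpha>) {x} \<le> x powr (- \<alpha>) - (x + 0) powr (- \<alpha>)"
      using eventually_at_right_less[of 0]
      by (intro tendsto_lowerbound[where F="at_right 0"]) (auto elim: eventually_mono intro: le)
    then show ?thesis by (simp add: measure_le_0_iff)
  qed
qed

section \<open>Measurability of the score and absence of ties\<close>

context kesten_tree
begin

lemma pred_vertex [measurable]: "Measurable.pred P (\<lambda>\<omega>. v \<in> vertices \<omega>)"
  unfolding vertices_iff by measurable

lemma measurable_potential [measurable]: "(\<lambda>\<omega>. potential \<omega> v) \<in> borel_measurable P"
  unfolding potential_def by (rule measurable_compose[OF measurable_coordinate measurable_mark(3)])

lemma measurable_offspring [measurable]: "(\<lambda>\<omega>. offspring \<omega> v) \<in> P \<rightarrow>\<^sub>M count_space UNIV"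
proof -
  have "(\<lambda>\<omega>. offspring \<omega> v) = (\<lambda>\<omega>. if on_spine True \<omega> v then num_children True (\<omega> v) else num_children False (\<omega> v))"
    by (auto simp: offspring_eq)
  then show ?thesis by simp
qed

lemma pred_special [measurable]: "Measurable.pred P (\<lambda>\<omega>. special \<omega> v)"
  unfolding special_iff by measurable

lemma measurable_score [measurable]:
  assumes "t > 0"
  shows "(\<lambda>\<omega>. score \<omega> t v) \<in> borel_measurable P"
  unfolding score_def using assms by measurable

text \<open>The potentials at two labels are independent. Given the value at \<open>v\<close>,
  injectivity of \<open>h\<close> above 1 leaves at most one value at \<open>w\<close> that produces
  a tie, and points have Pareto mass 0; Fubini concludes.\<close>

lemma tie_null:
  fixes g h :: "real \<Rightarrow> real"
  assumes [measurable]: "g \<in> borel_measurable borel" "h \<in> borel_measurable borel"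
    and inj: "\<And>a b. h a > 1 \<Longrightarrow> h a = h b \<Longrightarrow> a = b" and "v \<noteq> w"
  shows "emeasure P {\<omega>. g (potential \<omega> v) = h (potential \<omega> w) \<and> h (potential \<omega> w) > 1} = 0"
proof -
  define Q where "Q = pareto \<alpha>"
  define Z where "Z = {(a, b). g a = h b \<and> h b > 1}"
  have [measurable]: "Z \<in> sets (borel \<Otimes>\<^sub>M borel)"
  proof -
    have "Measurable.pred (borel \<Otimes>\<^sub>M borel) (\<lambda>x. g (fst x) = h (snd x) \<and> h (snd x) > 1)" by measurable
    then show ?thesis by (simp add: pred_def space_pair_measure Z_def case_prod_unfold)
  qed
  have "P.indep_var (\<Pi>\<^sub>M i\<in>{v}. N) (\<lambda>\<omega>. restrict (\<lambda>i. \<omega> i) {v}) (\<Pi>\<^sub>M i\<in>{w}. N) (\<lambda>\<omega>. restrict (\<lambda>i. \<omega> i) {w})"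
    using \<open>v \<noteq> w\<close> by (intro P.indep_var_restrict[OF indep_vars_coordinates[OF prob_space_N, folded P_eq]]) auto
  moreover have pr: "(\<lambda>f. snd (snd (f u))) \<in> (\<Pi>\<^sub>M i\<in>{u}. N) \<rightarrow>\<^sub>M borel" for u :: "nat list"
    by (rule measurable_compose[OF _ measurable_mark(3)]) simp
  ultimately have "P.indep_var borel ((\<lambda>f. snd (snd (f v))) \<circ> (\<lambda>\<omega>. restrict (\<lambda>i. \<omega> i) {v}))
      borel ((\<lambda>f. snd (snd (f w))) \<circ> (\<lambda>\<omega>. restrict (\<lambda>i. \<omega> i) {w}))"
    by (rule P.indep_var_compose) (rule pr)+
  then have ind: "P.indep_var borel (\<lambda>\<omega>. potential \<omega> v) borel (\<lambda>\<omega>. potential \<omega> w)"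
    by (simp add: comp_def potential_def)
  have dist: "distr P borel (\<lambda>\<omega>. potential \<omega> u) = Q" for u :: "nat list"
  proof (rule measure_eqI)
    fix B assume "B \<in> sets (distr P borel (\<lambda>\<omega>. potential \<omega> u))"
    then have B: "B \<in> sets borel" by simp
    have "distr P N (\<lambda>\<omega>. \<omega> u) = N"
      using distr_PiM_component[of UNIV "\<lambda>_::nat list. N" u] prob_space_N by (simp add: P_eq)
    then have "distr N borel (\<lambda>m. snd (snd m)) = distr P borel (\<lambda>\<omega>. potential \<omega> u)"
      using distr_distr[OF measurable_mark(3) measurable_coordinate, of u] by (simp add: comp_def potential_def)
    then have "emeasure (distr P borel (\<lambda>\<omega>. potential \<omega> u)) B = emeasure N {m. snd (snd m) \<in> B}"
      using B emeasure_distr[OF measurable_mark(3) B] by (simp add: vimage_def)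
    also have "\<dots> = emeasure Q B"
      using measure_N_potential[OF B] by (simp add: N.emeasure_eq_measure Par.emeasure_eq_measure Q_def)
    finally show "emeasure (distr P borel (\<lambda>\<omega>. potential \<omega> u)) B = emeasure Q B" .
  qed (simp add: Q_def)
  have "{\<omega>. g (potential \<omega> v) = h (potential \<omega> w) \<and> h (potential \<omega> w) > 1}
      = (\<lambda>\<omega>. (potential \<omega> v, potential \<omega> w)) -` Z \<inter> space P" by (auto simp: Z_def)
  then have "emeasure P {\<omega>. g (potential \<omega> v) = h (potential \<omega> w) \<and> h (potential \<omega> w) > 1}
      = emeasure (distr P (borel \<Otimes>\<^sub>M borel) (\<lambda>\<omega>. (potential \<omega> v, potential \<omega> w))) Z"
    by (subst emeasure_distr) auto
  also have "distr P (borel \<Otimes>\<^sub>M borel) (\<lambda>\<omega>. (potential \<omega> v, potential \<omega> w)) = Q \<Otimes>\<^sub>M Q"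
    using ind unfolding P.indep_var_distribution_eq dist by simp
  also have "emeasure (Q \<Otimes>\<^sub>M Q) Z = (\<integral>\<^sup>+a. emeasure Q (Pair a -` Z) \<partial>Q)"
    unfolding Q_def by (rule Par.emeasure_pair_measure_alt) (simp cong: sets_pair_measure_cong)
  also have "\<dots> = (\<integral>\<^sup>+a. 0 \<partial>Q)"
  proof (rule nn_integral_cong)
    fix a
    have "Pair a -` Z = {} \<or> (\<exists>b. Pair a -` Z = {b})"
      unfolding Z_def using inj by (auto simp: set_eq_iff) metis
    then show "emeasure Q (Pair a -` Z) = 0"
      using measure_pareto_singleton[OF alpha_pos] by (auto simp: Q_def Par.emeasure_eq_measure)
  qed
  finally show ?thesis by simp
qed

text \<open>The scores also depend on offspring numbers, which need not be independent of one
  another. Freezing these at \<open>k\<close> and \<open>l\<close> leaves functions of the two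
  potentials alone, and there are only countably many choices of \<open>v\<close>, \<open>w\<close>,
  \<open>k\<close>, \<open>l\<close>.\<close>

lemma AE_no_tie:
  assumes t: "t > 0"
  shows "AE \<omega> in P. \<forall>v\<in>vertices \<omega>. \<forall>w\<in>vertices \<omega>. score \<omega> t v = score \<omega> t w \<longrightarrow> score \<omega> t w > 1 \<longrightarrow> v = w"
proof -
  define G where "G v k a = psi_val t (length v) (a - real (k + (if v = [] then 0 else 1)))" for v :: "nat list" and k a
  have G [measurable]: "G v k \<in> borel_measurable borel" for v k
    unfolding G_def[abs_def] using t by measurable
  have G': "(\<lambda>\<omega>. G v k (potential \<omega> v)) \<in> borel_measurable P" for v k
    by (rule measurable_compose[OF measurable_potential G])
  have null: "AE \<omega> in P. \<not> (G v k (potential \<omega> v) = G w l (potential \<omega> w) \<and> G w l (potential \<omega> w) > 1)"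
    if "v \<noteq> w" for v w :: "nat list" and k l
  proof (rule AE_I[where N="{\<omega>. G v k (potential \<omega> v) = G w l (potential \<omega> w) \<and> G w l (potential \<omega> w) > 1}"])
    show "emeasure P {\<omega>. G v k (potential \<omega> v) = G w l (potential \<omega> w) \<and> G w l (potential \<omega> w) > 1} = 0"
    proof (intro tie_null G that)
      fix a b assume "1 < G w l a" "G w l a = G w l b"
      then have "a - real (l + (if w = [] then 0 else 1)) = b - real (l + (if w = [] then 0 else 1))"
        unfolding G_def by (rule psi_val_inj[OF t])
      then show "a = b" by simp
    qed
    define f1 f2 where "f1 = (\<lambda>\<omega>. G v k (potential \<omega> v))" and "f2 = (\<lambda>\<omega>. G w l (potential \<omega> w))"
    have f: "f1 \<in> borel_measurable P" "f2 \<in> borel_measurable P"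
      unfolding f1_def f2_def by (rule G')+
    have "Measurable.pred P (\<lambda>\<omega>. f1 \<omega> = f2 \<omega>)" "Measurable.pred P (\<lambda>\<omega>. f2 \<omega> > 1)"
      using borel_measurable_eq[OF f] borel_measurable_less[OF borel_measurable_const f(2), of 1]
      unfolding pred_def by simp_all
    then have "Measurable.pred P (\<lambda>\<omega>. f1 \<omega> = f2 \<omega> \<and> f2 \<omega> > 1)"
      by (rule pred_intros_logic)
    then have "Measurable.pred P (\<lambda>\<omega>. G v k (potential \<omega> v) = G w l (potential \<omega> w) \<and> G w l (potential \<omega> w) > 1)"
      unfolding f1_def f2_def .
    then show "{\<omega>. G v k (potential \<omega> v) = G w l (potential \<omega> w) \<and> G w l (potential \<omega> w) > 1} \<in> sets P"
      by (simp add: pred_def)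
  qed auto
  have "AE \<omega> in P. \<forall>v w k l. v \<noteq> w \<longrightarrow> \<not> (G v k (potential \<omega> v) = G w l (potential \<omega> w) \<and> G w l (potential \<omega> w) > 1)"
    using null by (simp add: AE_all_countable)
  then show ?thesis
  proof eventually_elim
    case (elim \<omega>)
    then show ?case using G_def unfolding score_def by metis
  qed
qed

end

section \<open>The maximisers\<close>

text \<open>\<open>E\<close> holds the vertices already removed: \<open>{}\<close> for
  \<open>Z1\<close> and \<open>{Z1 \<omega> t}\<close> for \<open>Z2\<close>.\<close>

definition is_best :: "env \<Rightarrow> real \<Rightarrow> nat list set \<Rightarrow> nat list \<Rightarrow> bool" where
  "is_best \<omega> t E z \<longleftrightarrow> z \<in> vertices \<omega> - E \<and> (\<forall>y. y \<in> vertices \<omega> - E \<longrightarrow> score \<omega> t y \<le> score \<omega> t z)"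

lemma is_arg_max_psi:
  assumes "t > 0"
  shows "is_arg_max (psi \<omega> t) (\<lambda>v. v \<in> vertices \<omega> - E) z \<longleftrightarrow> is_best \<omega> t E z"
  using assms by (auto simp: is_arg_max_def is_best_def psi_eq_score not_less)

lemma Z1_defined_iff: "t > 0 \<Longrightarrow> Z1_defined \<omega> t \<longleftrightarrow> (\<exists>!z. is_best \<omega> t {} z)"
  using is_arg_max_psi[of t \<omega> "{}"] by (simp add: Z1_defined_def)

lemma Z1_eq:
  assumes "t > 0" "is_best \<omega> t {} z" "\<And>y. is_best \<omega> t {} y \<Longrightarrow> y = z"
  shows "Z1 \<omega> t = z"
proof -
  have "(\<lambda>y. is_arg_max (psi \<omega> t) (\<lambda>v. v \<in> vertices \<omega>) y) = is_best \<omega> t {}"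
    using is_arg_max_psi[OF assms(1), of \<omega> "{}"] by auto
  then have "Z1 \<omega> t = (SOME y. is_best \<omega> t {} y)"
    by (simp add: Z1_def arg_max_on_def arg_max_def)
  also have "\<dots> = z" using assms(2,3) by (rule some_equality)
  finally show ?thesis .
qed

lemma Z2_defined_iff: "t > 0 \<Longrightarrow> Z2_defined \<omega> t \<longleftrightarrow> Z1_defined \<omega> t \<and> (\<exists>!z. is_best \<omega> t {Z1 \<omega> t} z)"
  using is_arg_max_psi[of t \<omega> "{Z1 \<omega> t}"] by (simp add: Z2_defined_def)

lemma Z2_eq:
  assumes "t > 0" "is_best \<omega> t {Z1 \<omega> t} z" "\<And>y. is_best \<omega> t {Z1 \<omega> t} y \<Longrightarrow> y = z"
  shows "Z2 \<omega> t = z"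
proof -
  have "(\<lambda>y. is_arg_max (psi \<omega> t) (\<lambda>v. v \<in> vertices \<omega> - {Z1 \<omega> t}) y) = is_best \<omega> t {Z1 \<omega> t}"
    using is_arg_max_psi[OF assms(1), of \<omega> "{Z1 \<omega> t}"] by auto
  then have "Z2 \<omega> t = (SOME y. is_best \<omega> t {Z1 \<omega> t} y)"
    by (simp add: Z2_def arg_max_on_def arg_max_def)
  also have "\<dots> = z" using assms(2,3) by (rule some_equality)
  finally show ?thesis .
qed

text \<open>The right-hand side quantifies over the countably many labels and no longer mentions the
  arbitrary choice inside \<open>arg_max_on\<close>; this is what makes the event
  measurable.\<close>

lemma Z1_event_iff:
  assumes t: "t > 0"
  shows "Z1_defined \<omega> t \<and> real (height \<omega> (Z1 \<omega> t)) \<in> I \<longleftrightarrow>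
    (\<exists>z. is_best \<omega> t {} z \<and> (\<forall>y. is_best \<omega> t {} y \<longrightarrow> y = z) \<and> real (length z) \<in> I)"
proof -
  have h: "height \<omega> (Z1 \<omega> t) = length z" if "is_best \<omega> t {} z" "\<forall>y. is_best \<omega> t {} y \<longrightarrow> y = z" for z
  proof -
    have "Z1 \<omega> t = z" using Z1_eq[OF t that(1)] that(2) by blast
    moreover have "z \<in> vertices \<omega>" using that(1) by (simp add: is_best_def)
    ultimately show ?thesis by (simp add: height_eq_length)
  qed
  show ?thesis
  proof
    assume L: "Z1_defined \<omega> t \<and> real (height \<omega> (Z1 \<omega> t)) \<in> I"
    then obtain z where z: "is_best \<omega> t {} z" "\<forall>y. is_best \<omega> t {} y \<longrightarrow> y = z"
      unfolding Z1_defined_iff[OF t] Ex1_def by blast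
    moreover have "real (length z) \<in> I" using L h[OF z] by simp
    ultimately show "\<exists>z. is_best \<omega> t {} z \<and> (\<forall>y. is_best \<omega> t {} y \<longrightarrow> y = z) \<and> real (length z) \<in> I"
      by blast
  next
    assume "\<exists>z. is_best \<omega> t {} z \<and> (\<forall>y. is_best \<omega> t {} y \<longrightarrow> y = z) \<and> real (length z) \<in> I"
    then obtain z where z: "is_best \<omega> t {} z" "\<forall>y. is_best \<omega> t {} y \<longrightarrow> y = z" "real (length z) \<in> I"
      by blast
    have "Z1_defined \<omega> t" unfolding Z1_defined_iff[OF t] using z(1,2) by blast
    then show "Z1_defined \<omega> t \<and> real (height \<omega> (Z1 \<omega> t)) \<in> I" using h[OF z(1,2)] z(3) by simp
  qed
qed

lemma Z2_event_iff:
  assumes t: "t > 0"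
  shows "Z2_defined \<omega> t \<and> real (height \<omega> (Z2 \<omega> t)) \<in> I \<longleftrightarrow>
    (\<exists>x. is_best \<omega> t {} x \<and> (\<forall>y. is_best \<omega> t {} y \<longrightarrow> y = x) \<and>
      (\<exists>z. is_best \<omega> t {x} z \<and> (\<forall>y. is_best \<omega> t {x} y \<longrightarrow> y = z) \<and> real (length z) \<in> I))"
    (is "?L \<longleftrightarrow> ?R")
proof -
  have h: "height \<omega> (Z2 \<omega> t) = length z"
    if "is_best \<omega> t {Z1 \<omega> t} z" "\<forall>y. is_best \<omega> t {Z1 \<omega> t} y \<longrightarrow> y = z" for z
  proof -
    have "Z2 \<omega> t = z" using Z2_eq[OF t that(1)] that(2) by blast
    moreover have "z \<in> vertices \<omega>" using that(1) by (simp add: is_best_def)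
    ultimately show ?thesis by (simp add: height_eq_length)
  qed
  show ?thesis
  proof
    assume L: ?L
    then obtain x where x: "is_best \<omega> t {} x" "\<forall>y. is_best \<omega> t {} y \<longrightarrow> y = x"
      unfolding Z2_defined_iff[OF t] Z1_defined_iff[OF t] Ex1_def by blast
    have e: "Z1 \<omega> t = x" using Z1_eq[OF t x(1)] x(2) by blast
    obtain z where z: "is_best \<omega> t {Z1 \<omega> t} z" "\<forall>y. is_best \<omega> t {Z1 \<omega> t} y \<longrightarrow> y = z"
      using L unfolding Z2_defined_iff[OF t] Ex1_def by blast
    have "real (length z) \<in> I" using L h[OF z] by simp
    with x z show ?R unfolding e by blast
  next
    assume ?R
    then obtain x z where x: "is_best \<omega> t {} x" "\<forall>y. is_best \<omega> t {} y \<longrightarrow> y = x"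
      and z: "is_best \<omega> t {x} z" "\<forall>y. is_best \<omega> t {x} y \<longrightarrow> y = z" "real (length z) \<in> I"
      by blast
    have e: "Z1 \<omega> t = x" using Z1_eq[OF t x(1)] x(2) by blast
    have "Z1_defined \<omega> t" unfolding Z1_defined_iff[OF t] using x by blast
    then have "Z2_defined \<omega> t" unfolding Z2_defined_iff[OF t] e using z(1,2) by blast
    moreover have "height \<omega> (Z2 \<omega> t) = length z" using h[of z] z(1,2) unfolding e by blast
    ultimately show ?L using z(3) by simp
  qed
qed

text \<open>Only finitely many vertices reach the level \<open>B\<close>, so a largest score exists
  among them; vertices below \<open>B\<close> cannot compete, and ties are excluded from
  \<open>B\<close> on.\<close>

lemma ex_best:
  assumes fin: "finite {v \<in> vertices \<omega>. B \<le> score \<omega> t v}"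
    and tie: "\<forall>v\<in>vertices \<omega>. \<forall>w\<in>vertices \<omega>. score \<omega> t v = score \<omega> t w \<longrightarrow> score \<omega> t w \<ge> B \<longrightarrow> v = w"
    and v: "v \<in> vertices \<omega> - E" "B \<le> score \<omega> t v"
  obtains z where "is_best \<omega> t E z" "\<And>y. is_best \<omega> t E y \<Longrightarrow> y = z" "B \<le> score \<omega> t z"
proof -
  define S where "S = {v \<in> vertices \<omega> - E. B \<le> score \<omega> t v}"
  have S: "finite S" "S \<noteq> {}" using v by (auto simp: S_def intro: finite_subset[OF _ fin])
  have "Max (score \<omega> t ` S) \<in> score \<omega> t ` S" using S by (intro Max_in) auto
  then obtain z where z: "z \<in> S" "score \<omega> t z = Max (score \<omega> t ` S)" by auto
  have zB: "B \<le> score \<omega> t z" "z \<in> vertices \<omega> - E" using z by (auto simp: S_def)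
  have le: "score \<omega> t y \<le> score \<omega> t z" if "y \<in> vertices \<omega> - E" for y
  proof (cases "B \<le> score \<omega> t y")
    case True
    then show ?thesis using that S unfolding z(2) by (intro Max_ge) (auto simp: S_def)
  qed (use zB in linarith)
  then have best: "is_best \<omega> t E z" using zB by (auto simp: is_best_def)
  moreover have "y = z" if "is_best \<omega> t E y" for y
  proof -
    have y: "y \<in> vertices \<omega> - E" using that by (simp add: is_best_def)
    have "score \<omega> t y = score \<omega> t z" using that best y zB by (auto simp: is_best_def intro: antisym)
    then show ?thesis using tie y zB by blast
  qed
  ultimately show ?thesis using that zB by blast
qed

text \<open>Two vertices at level \<open>B\<close> are required so that one is left after the best
  has been removed. The assumption \<open>far\<close> also confines the vertices reaching
  \<open>B\<close> to a finite ball.\<close>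

lemma Z_in_window:
  assumes t: "t > 0"
    and near: "\<And>v. v \<in> vertices \<omega> \<Longrightarrow> real (length v) < lo \<Longrightarrow> score \<omega> t v < B"
    and far: "\<And>v. v \<in> vertices \<omega> \<Longrightarrow> real (length v) > hi \<Longrightarrow> score \<omega> t v < B"
    and tie: "\<forall>v\<in>vertices \<omega>. \<forall>w\<in>vertices \<omega>. score \<omega> t v = score \<omega> t w \<longrightarrow> score \<omega> t w \<ge> B \<longrightarrow> v = w"
    and two: "v1 \<in> vertices \<omega>" "v2 \<in> vertices \<omega>" "v1 \<noteq> v2" "B \<le> score \<omega> t v1" "B \<le> score \<omega> t v2"
  shows "Z1_defined \<omega> t \<and> real (height \<omega> (Z1 \<omega> t)) \<in> {lo..hi}"
    and "Z2_defined \<omega> t \<and> real (height \<omega> (Z2 \<omega> t)) \<in> {lo..hi}"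
proof -
  have "{v \<in> vertices \<omega>. B \<le> score \<omega> t v} \<subseteq> {v. in_tree True \<omega> v \<and> length v \<le> nat \<lfloor>hi\<rfloor>}"
  proof
    fix v assume v: "v \<in> {v \<in> vertices \<omega>. B \<le> score \<omega> t v}"
    then have "real (length v) \<le> hi" using far[of v] by force
    then show "v \<in> {v. in_tree True \<omega> v \<and> length v \<le> nat \<lfloor>hi\<rfloor>}" using v by (simp add: vertices_iff le_nat_floor)
  qed
  then have fin: "finite {v \<in> vertices \<omega>. B \<le> score \<omega> t v}" by (rule finite_subset[OF _ finite_in_tree])
  have window: "real (length v) \<in> {lo..hi}" if "v \<in> vertices \<omega>" "B \<le> score \<omega> t v" for v
    using near[OF that(1)] far[OF that(1)] that(2) by force
  obtain z where z: "is_best \<omega> t {} z" "\<And>y. is_best \<omega> t {} y \<Longrightarrow> y = z" "B \<le> score \<omega> t z"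
    using ex_best[OF fin tie, of v1 "{}"] two by blast
  have "\<exists>v \<in> vertices \<omega> - {z}. B \<le> score \<omega> t v" using two by auto
  then obtain v where v: "v \<in> vertices \<omega> - {z}" "B \<le> score \<omega> t v" by blast
  obtain y where y: "is_best \<omega> t {z} y" "\<And>x. is_best \<omega> t {z} x \<Longrightarrow> x = y" "B \<le> score \<omega> t y"
    using ex_best[OF fin tie v] by blast
  have "z \<in> vertices \<omega>" "y \<in> vertices \<omega>" using z(1) y(1) by (simp_all add: is_best_def)
  then have len: "real (length z) \<in> {lo..hi}" "real (length y) \<in> {lo..hi}"
    using window z(3) y(3) by blast+
  show "Z1_defined \<omega> t \<and> real (height \<omega> (Z1 \<omega> t)) \<in> {lo..hi}"
    unfolding Z1_event_iff[OF t] using z(1,2) len(1) by blast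
  show "Z2_defined \<omega> t \<and> real (height \<omega> (Z2 \<omega> t)) \<in> {lo..hi}"
    unfolding Z2_event_iff[OF t] using z(1,2) y(1,2) len(2) by blast
qed

section \<open>Measurability of the events and asymptotics of the scale\<close>

context kesten_tree
begin

lemma pred_score_le:
  assumes t: "t > 0"
  shows "Measurable.pred P (\<lambda>\<omega>. score \<omega> t y \<le> score \<omega> t z)"
  using borel_measurable_le[OF measurable_score[OF t, of y] measurable_score[OF t, of z]] by (simp add: pred_def)

lemma pred_is_best [measurable]:
  assumes t: "t > 0"
  shows "Measurable.pred P (\<lambda>\<omega>. is_best \<omega> t E z)"
proof -
  note [measurable] = pred_score_le[OF t]
  show ?thesis unfolding is_best_def by simp
qed

lemma sets_Z_events:
  assumes t: "t > 0"
  shows "{\<omega>. Z1_defined \<omega> t \<and> real (height \<omega> (Z1 \<omega> t)) \<in> I} \<in> sets P"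
    and "{\<omega>. Z2_defined \<omega> t \<and> real (height \<omega> (Z2 \<omega> t)) \<in> I} \<in> sets P"
proof -
  note [measurable] = pred_is_best[OF t]
  have "Measurable.pred P (\<lambda>\<omega>. Z1_defined \<omega> t \<and> real (height \<omega> (Z1 \<omega> t)) \<in> I)"
    unfolding Z1_event_iff[OF t] by simp
  then show "{\<omega>. Z1_defined \<omega> t \<and> real (height \<omega> (Z1 \<omega> t)) \<in> I} \<in> sets P" by (simp add: pred_def)
  have "Measurable.pred P (\<lambda>\<omega>. Z2_defined \<omega> t \<and> real (height \<omega> (Z2 \<omega> t)) \<in> I)"
    unfolding Z2_event_iff[OF t] by simp
  then show "{\<omega>. Z2_defined \<omega> t \<and> real (height \<omega> (Z2 \<omega> t)) \<in> I} \<in> sets P" by (simp add: pred_def)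
qed

lemma score_le:
  assumes t: "t > 0" and pot: "potential \<omega> v \<le> x" and x: "x \<ge> 0"
  shows "score \<omega> t v \<le> x + 1"
    and "v \<noteq> [] \<Longrightarrow> score \<omega> t v \<le> x - real (length v) / t * (ln (real (length v) / t) - 1)"
proof -
  define D where "D = potential \<omega> v - real (offspring \<omega> v + (if v = [] then 0 else 1))"
  have "max D 0 \<le> x" using pot x by (auto simp: D_def)
  then show "score \<omega> t v \<le> x + 1"
    and "v \<noteq> [] \<Longrightarrow> score \<omega> t v \<le> x - real (length v) / t * (ln (real (length v) / t) - 1)"
    using psi_val_le[OF t, of "length v" D] unfolding score_def D_def[symmetric] by fastforce+
qed

end

text \<open>All asymptotics of the final argument. The logarithm of \<open>(t / ln t) powr q\<close>
  is \<open>q * ln t\<close> up to an iterated logarithm; the factor 1/2 in the lower bound absorbs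
  that term and the constant.\<close>

lemma eventually_scale:
  assumes "q > (0::real)"
  shows "\<forall>\<^sub>F t in at_top. t > 1 \<and> ln t \<ge> c0 \<and> (t / ln t) powr q \<ge> c1 \<and> (t / ln t) powr (q + 1) \<ge> c2
    \<and> ln ((t / ln t) powr q / ln t) - 1 \<ge> q * ln t / 2 \<and> ln ((t / ln t) powr q) \<le> q * ln (t::real)"
proof -
  have w: "filterlim (\<lambda>t::real. t / ln t) at_top at_top" by real_asymp
  have 1: "\<forall>\<^sub>F t in at_top. (t / ln t) powr p \<ge> c" if "p > 0" for p c :: real
  proof -
    have "filterlim (\<lambda>t::real. (t / ln t) powr p) at_top at_top" using that by real_asymp
    then show ?thesis by (simp add: filterlim_at_top)
  qed
  have 2: "\<forall>\<^sub>F t::real in at_top. ln t \<ge> c0" by real_asymp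
  have 3: "\<forall>\<^sub>F t::real in at_top. q * (ln t - ln (ln t)) - ln (ln t) - 1 \<ge> q * ln t / 2"
    using assms by real_asymp
  have 4: "\<forall>\<^sub>F t::real in at_top. t > exp 1" by real_asymp
  have "q + 1 > 0" using assms by simp
  show ?thesis
    using 1[OF assms, of c1] 1[OF \<open>q + 1 > 0\<close>, of c2] 2 3 4
  proof (eventually_elim)
    case (elim t)
    have t1: "t > 1" using elim(5) exp_ge_add_one_self[of 1] by linarith
    have L: "ln t > 1" using elim(5) t1 by (metis exp_less_cancel_iff exp_ln less_trans zero_less_one)
    have "ln ((t / ln t) powr q) = q * (ln t - ln (ln t))" using t1 L by (simp add: ln_powr ln_div)
    moreover have "ln ((t / ln t) powr q / ln t) = ln ((t / ln t) powr q) - ln (ln t)"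
      using t1 L by (subst ln_div) auto
    moreover have "q * (ln t - ln (ln t)) \<le> q * ln t" using assms L by (intro mult_left_mono) auto
    ultimately show ?case using elim t1 assms by simp
  qed
qed

section \<open>The window for both maximisers\<close>

context kesten_tree
begin

text \<open>Two disjoint windows whose masses are both proportional to
  \<open>x powr (- \<alpha>)\<close>: leaves found in each of them are automatically
  different.\<close>

lemma pareto_interval:
  assumes "x \<ge> 1"
  shows "measure (pareto \<alpha>) {x..<2 * x} = (1 - 2 powr (- \<alpha>)) * x powr (- \<alpha>)"
    and "measure (pareto \<alpha>) {2 * x..} = 2 powr (- \<alpha>) * x powr (- \<alpha>)"
proof -
  show 2: "measure (pareto \<alpha>) {2 * x..} = 2 powr (- \<alpha>) * x powr (- \<alpha>)"
    using assms by (simp add: pareto_tail[OF alpha_pos] powr_mult)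
  have "{x..<2 * x} = {x..} - {2 * x..}" by auto
  then have "measure (pareto \<alpha>) {x..<2 * x} = measure (pareto \<alpha>) {x..} - measure (pareto \<alpha>) {2 * x..}"
    using assms by (simp add: Par.finite_measure_Diff)
  then show "measure (pareto \<alpha>) {x..<2 * x} = (1 - 2 powr (- \<alpha>)) * x powr (- \<alpha>)"
    unfolding 2 using assms by (simp add: pareto_tail[OF alpha_pos] algebra_simps)
qed

definition "high_potential R x = {\<omega>. \<exists>v\<in>vertices \<omega>. real (length v) \<le> R \<and> x \<le> potential \<omega> v}"

definition "no_leaf R A = {\<omega>. \<not> (\<exists>v\<in>vertices \<omega>. real (length v) \<le> R \<and> \<not> special \<omega> v \<and> offspring \<omega> v = 0 \<and> potential \<omega> v \<in> A)}"

lemma sets_high_potential: "high_potential R x \<in> sets P"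
proof -
  have [measurable]: "Measurable.pred P (\<lambda>\<omega>. x \<le> potential \<omega> v)" for v
    using borel_measurable_le[OF borel_measurable_const measurable_potential, of x v] by (simp add: pred_def)
  have "Measurable.pred P (\<lambda>\<omega>. \<exists>v. v \<in> vertices \<omega> \<and> real (length v) \<le> R \<and> x \<le> potential \<omega> v)" by simp
  then show ?thesis by (simp add: high_potential_def pred_def Bex_def)
qed

lemma sets_no_leaf:
  assumes "A \<in> sets borel"
  shows "no_leaf R A \<in> sets P"
proof -
  have [measurable]: "Measurable.pred P (\<lambda>\<omega>. potential \<omega> v \<in> A)" for v
    by (rule pred_sets2[OF assms measurable_potential])
  have [measurable]: "Measurable.pred P (\<lambda>\<omega>. offspring \<omega> v = 0)" for v
    by (rule measurable_compose[OF measurable_offspring]) simp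
  have "Measurable.pred P (\<lambda>\<omega>. \<not> (\<exists>v. v \<in> vertices \<omega> \<and> real (length v) \<le> R \<and> \<not> special \<omega> v \<and> offspring \<omega> v = 0 \<and> potential \<omega> v \<in> A))" by simp
  then show ?thesis by (simp add: no_leaf_def pred_def Bex_def)
qed

text \<open>The order of choices matters: \<delta> depends on \<epsilon> only, \<open>l\<close> on
  \<delta>, and \<open>t\<close> on all of them. The winning level \<open>\<delta> * a / 4\<close>
  does not involve \<open>l\<close>, so widening the window makes the near and far events rare
  without affecting the two leaves.\<close>

lemma window_probability:
  fixes \<epsilon> :: real
  defines "d \<equiv> \<beta> / (\<beta> - 1)"
  assumes eps: "\<epsilon> > 0"
  shows "\<forall>\<^sub>F l in at_top. \<forall>\<^sub>F t in at_top.
    1 - \<epsilon> \<le> P.prob {\<omega>. Z1_defined \<omega> t \<and> real (height \<omega> (Z1 \<omega> t)) \<in> {inverse l * scale d \<alpha> t .. l * scale d \<alpha> t}} \<and>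
    1 - \<epsilon> \<le> P.prob {\<omega>. Z2_defined \<omega> t \<and> real (height \<omega> (Z2 \<omega> t)) \<in> {inverse l * scale d \<alpha> t .. l * scale d \<alpha> t}}"
proof -
  have d: "d > 0" "\<alpha> > d" using beta_gt alpha_gt by (simp_all add: d_def)
  define q where "q = d / (\<alpha> - d)"
  have q: "q > 0" using d by (simp add: q_def)
  have qd: "q * \<alpha> = (q + 1) * d" using d by (simp add: q_def field_simps)
  have b1: "\<beta> - 1 > 0" using beta_gt by simp
  obtain C where C: "C > 0" "\<And>R x. 1 \<le> R \<Longrightarrow> 1 \<le> x \<Longrightarrow> P.prob (high_potential R x) \<le> C * (R powr d / x powr \<alpha>) powr (\<beta> - 1)"
    using prob_potential_ge unfolding high_potential_def d_def by blast
  obtain K where K: "K > 0" "\<And>A R. A \<in> sets borel \<Longrightarrow> 2 \<le> R \<Longrightarrow> 1 \<le> measure (pareto \<alpha>) A * R powr d \<Longrightarrow>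
      P.prob (no_leaf R A) \<le> exp (- K * (measure (pareto \<alpha>) A * R powr d) powr ((\<beta> - 1) / \<beta>))"
    using prob_no_leaf unfolding no_leaf_def d_def by blast
  define \<eta> where "\<eta> = (\<beta> - 1) / \<beta>"
  have \<eta>: "\<eta> > 0" using beta_gt by (simp add: \<eta>_def)
  have "\<forall>\<^sub>F M in at_top. exp (- K * M powr \<eta>) < \<epsilon> / 8"
  proof -
    have "((\<lambda>M. exp (- K * M powr \<eta>)) \<longlongrightarrow> 0) at_top" using K(1) \<eta> by real_asymp
    then show ?thesis using eps by (intro order_tendstoD) auto
  qed
  then obtain M0 where M0: "\<And>M. M \<ge> M0 \<Longrightarrow> exp (- K * M powr \<eta>) < \<epsilon> / 8"
    by (auto simp: eventually_at_top_linorder)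
  define \<kappa>1 where "\<kappa>1 = 1 - 2 powr (- \<alpha>)"
  define \<kappa>2 where "\<kappa>2 = 2 powr (- \<alpha>)"
  have "2 powr (- \<alpha>) < 2 powr 0" using alpha_pos by (intro powr_less_mono) auto
  then have \<kappa>: "\<kappa>1 > 0" "\<kappa>2 > 0" by (simp_all add: \<kappa>1_def \<kappa>2_def)
  \<comment> \<open>Once \<open>k\<close> is fixed as \<open>\<delta> / (4 * q)\<close>, the
    right-hand side is the mass of a window times \<open>(k * r) powr d\<close>. The 1 in
    \<open>max 1 M0\<close> is the hypothesis of the leaf estimate and \<open>M0\<close> makes its
    error small.\<close>
  have small: "\<forall>\<^sub>F \<delta> in at_right 0. max 1 M0 \<le> \<kappa> * (4 * q) powr (- d) * \<delta> powr (d - \<alpha>)" if "\<kappa> > 0" for \<kappa>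
  proof -
    have "filterlim (\<lambda>\<delta>::real. \<kappa> * (4 * q) powr (- d) * \<delta> powr (d - \<alpha>)) at_top (at_right 0)"
    proof -
      define A where "A = \<kappa> * (4 * q) powr (- d)"
      define e where "e = \<alpha> - d"
      have "A > 0" "e > 0" using that q d by (simp_all add: A_def e_def)
      then have "filterlim (\<lambda>\<delta>::real. A * \<delta> powr (- e)) at_top (at_right 0)" by real_asymp
      then show ?thesis by (simp add: A_def e_def)
    qed
    then show ?thesis unfolding filterlim_at_top by blast
  qed
  have "\<forall>\<^sub>F \<delta> in at_right (0::real). \<delta> > 0 \<and> \<delta> < 1 \<and> max 1 M0 \<le> \<kappa>1 * (4 * q) powr (- d) * \<delta> powr (d - \<alpha>)
      \<and> max 1 M0 \<le> \<kappa>2 * (4 * q) powr (- d) * \<delta> powr (d - \<alpha>)"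
    using eventually_at_right_less[of 0] small[OF \<kappa>(1)] small[OF \<kappa>(2)] eventually_at_right_real[OF zero_less_one]
    by eventually_elim auto
  then obtain \<delta> where \<delta>: "\<delta> > 0" "\<delta> < 1" "max 1 M0 \<le> \<kappa>1 * (4 * q) powr (- d) * \<delta> powr (d - \<alpha>)"
      "max 1 M0 \<le> \<kappa>2 * (4 * q) powr (- d) * \<delta> powr (d - \<alpha>)"
    using eventually_happens'[OF trivial_limit_at_right_real] by blast
  define k where "k = \<delta> / (4 * q)"
  have k: "k > 0" using \<delta> q by (simp add: k_def)
  \<comment> \<open>\<open>c1\<close> and \<open>c2\<close> come from the ratios
    \<open>R powr d / x powr \<alpha>\<close> for the near ball and for the dyadic shells; \<rho> is
    the factor by which the bound decreases from one shell to the next.\<close>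
  define c1 where "c1 = (8 / \<delta>) powr \<alpha>"
  define c2 where "c2 = 2 powr d * (2 / q) powr \<alpha>"
  define \<rho> where "\<rho> = (2 powr (- (\<alpha> - d))) powr (\<beta> - 1)"
  have c: "c1 > 0" "c2 > 0" using \<delta> q by (simp_all add: c1_def c2_def)
  have "(\<alpha> - d) * (\<beta> - 1) > 0" using d b1 by simp
  then have "2 powr (- (\<alpha> - d) * (\<beta> - 1)) < 2 powr 0"
    by (intro powr_less_mono) (simp_all only: mult_minus_left neg_less_0_iff_less)
  then have \<rho>: "0 < \<rho>" "\<rho> < 1" by (simp_all add: \<rho>_def powr_powr)
  define B1 where "B1 l = C * (c1 * l powr (- d)) powr (\<beta> - 1)" for l
  define B2 where "B2 l = C * (c2 * l powr (- (\<alpha> - d))) powr (\<beta> - 1)" for l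
  have lim: "((\<lambda>l. C * (c * l powr (- e)) powr (\<beta> - 1)) \<longlongrightarrow> 0) at_top" if "c > 0" "e > 0" for c e :: real
  proof -
    have "((\<lambda>l. C * (c * l powr (- e)) powr (\<beta> - 1)) \<longlongrightarrow> C * (c * 0) powr (\<beta> - 1)) at_top"
      using that b1 by (intro tendsto_intros tendsto_powr2 tendsto_neg_powr filterlim_ident) auto
    then show ?thesis by simp
  qed
  have "\<forall>\<^sub>F l in at_top. B1 l < \<epsilon> / 8 \<and> B2 l < \<epsilon> / 8 * (1 - \<rho>) \<and> l \<ge> 1"
  proof -
    have "\<forall>\<^sub>F l in at_top. B1 l < \<epsilon> / 8" unfolding B1_def
      by (rule order_tendstoD(2)[OF lim]) (use c d eps in auto)
    moreover have "\<forall>\<^sub>F l in at_top. B2 l < \<epsilon> / 8 * (1 - \<rho>)" unfolding B2_def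
      by (rule order_tendstoD(2)[OF lim]) (use c d eps \<rho> in auto)
    ultimately show ?thesis using eventually_ge_at_top[of 1] by eventually_elim auto
  qed
  then show ?thesis
  proof eventually_elim
    case (elim l)
    then have l: "B1 l < \<epsilon> / 8" "B2 l < \<epsilon> / 8 * (1 - \<rho>)" "l \<ge> 1" by auto
    \<comment> \<open>The thresholds: \<open>2 * k / \<delta>\<close> ensures
      \<open>k * a / L \<le> \<delta> * a / 2\<close> for the leaves, \<open>16 / \<delta>\<close>
      ensures \<open>\<delta> * a \<ge> 16\<close>, \<open>2 / q\<close> makes the potential levels
      of the shells at least 1, and \<open>l\<close> and \<open>2 / k\<close> make the radii
      \<open>r / l\<close> and \<open>k * r\<close> at least 1 and 2.\<close>
    show ?case
      using eventually_scale[OF q, where ?c0.0="2 * k / \<delta>" and ?c1.0="max (16 / \<delta>) (max 1 (2 / q))" and ?c2.0="max l (2 / k)"]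
    proof eventually_elim
      case (elim t)
      define a where "a = (t / ln t) powr q"
      define r where "r = (t / ln t) powr (q + 1)"
      define L where "L = ln t"
      have t: "t > 1" "L \<ge> 2 * k / \<delta>" "a \<ge> 16 / \<delta>" "a \<ge> 1" "a \<ge> 2 / q" "r \<ge> l" "r \<ge> 2 / k"
        "ln (a / L) - 1 \<ge> q * L / 2" "ln a \<le> q * L"
        using elim by (simp_all add: a_def r_def L_def)
      have t0: "t > 0" and L0: "L > 0" using t by (simp_all add: L_def)
      have r0: "r > 0" and a0: "a > 0" using t l by linarith+
      have scale: "scale d \<alpha> t = r" by (simp add: scale_def Let_def q_def r_def)
      have w: "t / ln t > 0" using t0 L0 by (simp add: L_def)
      have rt: "r / t = a / L"
        unfolding r_def a_def powr_add L_def using w t0 L0 by (simp add: L_def field_simps)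
      have ra: "r powr d = a powr \<alpha>"
        unfolding r_def a_def powr_powr qd ..
      have da: "\<delta> * a \<ge> 16" using t(3) \<delta> by (simp add: field_simps)
      have qa: "q / 2 * a \<ge> 1" using t(5) q by (simp add: field_simps)
      define Near where "Near = high_potential (r / l) (\<delta> * a / 8)"
      \<comment> \<open>A vertex higher than \<open>2 ^ j * l * r\<close> pays at least
        \<open>2 ^ j * l * (a / L) * (q * L / 2)\<close> for its distance, which is the potential
        level chosen here.\<close>
      define Far where "Far j = high_potential (2 ^ (j + 1) * l * r) (2 ^ j * l * (q / 2) * a)" for j :: nat
      define L1 where "L1 = no_leaf (k * r) {\<delta> * a..<2 * (\<delta> * a)}"
      define L2 where "L2 = no_leaf (k * r) {2 * (\<delta> * a)..}"
      obtain T where T: "{\<omega> \<in> space P. \<not> (\<forall>v\<in>vertices \<omega>. \<forall>w\<in>vertices \<omega>. score \<omega> t v = score \<omega> t w \<longrightarrow> score \<omega> t w > 1 \<longrightarrow> v = w)} \<subseteq> T"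
          "emeasure P T = 0" "T \<in> sets P"
        using AE_E[OF AE_no_tie[OF t0]] by blast
      have pT: "P.prob T = 0" using T(2) by (simp add: measure_def)
      have pNear: "P.prob Near \<le> \<epsilon> / 8"
      proof -
        have "P.prob Near \<le> C * ((r / l) powr d / (\<delta> * a / 8) powr \<alpha>) powr (\<beta> - 1)"
          unfolding Near_def using t(6) l da by (intro C) auto
        also have "(r / l) powr d / (\<delta> * a / 8) powr \<alpha> = c1 * l powr (- d)"
        proof -
          have "(r / l) powr d = a powr \<alpha> * l powr (- d)"
            using r0 l by (simp add: powr_divide ra powr_minus_divide)
          moreover have "(\<delta> * a / 8) powr \<alpha> = a powr \<alpha> / c1"
            using \<delta> a0 by (simp add: c1_def powr_divide powr_mult)
          ultimately show ?thesis using a0 c by simp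
        qed
        finally show ?thesis using l(1) by (simp add: B1_def)
      qed
      have pFar: "P.prob (\<Union>j. Far j) \<le> \<epsilon> / 8"
      proof -
        have bound: "P.prob (Far j) \<le> B2 l * \<rho> ^ j" for j
        proof -
          have 2: "1 \<le> (2::real) ^ j" by simp
          have "1 * 1 \<le> 2 ^ j * l" using 2 l by (intro mult_mono) auto
          then have jl: "1 \<le> 2 ^ j * l" by simp
          have "1 * 1 \<le> (2 ^ j * l) * (q / 2 * a)" using jl qa by (intro mult_mono) auto
          then have x1: "1 \<le> 2 ^ j * l * (q / 2) * a" by (simp add: mult.assoc)
          have "1 * 1 \<le> (2 * (2 ^ j * l)) * r" using jl t(6) l by (intro mult_mono) auto
          then have R1: "1 \<le> 2 ^ (j + 1) * l * r" by (simp add: mult.assoc)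
          have "P.prob (Far j) \<le> C * ((2 ^ (j + 1) * l * r) powr d / (2 ^ j * l * (q / 2) * a) powr \<alpha>) powr (\<beta> - 1)"
            unfolding Far_def using x1 R1 by (intro C)
          also have "(2 ^ (j + 1) * l * r) powr d / (2 ^ j * l * (q / 2) * a) powr \<alpha>
              = c2 * l powr (- (\<alpha> - d)) * (2 ^ j) powr (- (\<alpha> - d))"
          proof -
            define h where "h = q / 2"
            have h: "h > 0" using q by (simp add: h_def)
            have "(2 ^ (j + 1) * l * r) powr d = 2 powr d * (2 ^ j) powr d * l powr d * a powr \<alpha>"
              using l r0 by (simp add: powr_mult ra)
            moreover have "(2 ^ j * l * h * a) powr \<alpha> = (2 ^ j) powr \<alpha> * l powr \<alpha> * h powr \<alpha> * a powr \<alpha>"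
              using l a0 h by (simp add: powr_mult)
            moreover have "c2 = 2 powr d * (1 / h powr \<alpha>)" using q by (simp add: c2_def h_def powr_divide)
            moreover have "y powr (- (\<alpha> - d)) = y powr d / y powr \<alpha>" for y :: real
              by (simp add: powr_diff[symmetric])
            ultimately show ?thesis unfolding h_def[symmetric] using a0 by (simp add: ac_simps)
          qed
          also have "(c2 * l powr (- (\<alpha> - d)) * (2 ^ j) powr (- (\<alpha> - d))) powr (\<beta> - 1)
              = (c2 * l powr (- (\<alpha> - d))) powr (\<beta> - 1) * \<rho> ^ j"
          proof -
            have "((2 ^ j) powr (- (\<alpha> - d))) powr (\<beta> - 1) = \<rho> ^ j"
            proof -
              have "(2::real) ^ j = 2 powr real j" by (simp add: powr_realpow)
              then show ?thesis by (simp add: \<rho>_def powr_powr powr_power mult_ac)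
            qed
            then show ?thesis using c l by (simp add: powr_mult)
          qed
          finally show ?thesis by (simp add: B2_def mult.assoc)
        qed
        have "(\<lambda>j. B2 l * \<rho> ^ j) sums (B2 l * (1 / (1 - \<rho>)))"
          using \<rho> by (intro sums_mult geometric_sums) auto
        then have "P.prob (\<Union>j. Far j) \<le> B2 l * (1 / (1 - \<rho>))"
          using bound by (intro prob_UN_le[of Far "\<lambda>j. B2 l * \<rho> ^ j"]) (auto simp: Far_def intro: sets_high_potential)
        also have "\<dots> \<le> \<epsilon> / 8" using l(2) \<rho> by (simp add: field_simps)
        finally show ?thesis .
      qed
      have kr: "2 \<le> k * r" using t(7) k by (simp add: field_simps)
      have leaf: "P.prob (no_leaf (k * r) A) \<le> \<epsilon> / 8"
        if "A \<in> sets borel" "measure (pareto \<alpha>) A = \<kappa> * (\<delta> * a) powr (- \<alpha>)" "max 1 M0 \<le> \<kappa> * (4 * q) powr (- d) * \<delta> powr (d - \<alpha>)" for A \<kappa>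
      proof -
        have "measure (pareto \<alpha>) A * (k * r) powr d = \<kappa> * (4 * q) powr (- d) * \<delta> powr (d - \<alpha>)"
        proof -
          have "(\<delta> * a) powr (- \<alpha>) = \<delta> powr (- \<alpha>) / a powr \<alpha>"
            using \<delta>(1) a0 by (simp add: powr_mult powr_minus_divide)
          moreover have "(k * r) powr d = \<delta> powr d * (4 * q) powr (- d) * a powr \<alpha>"
            using \<delta>(1) q r0 by (simp add: powr_mult ra k_def powr_divide powr_minus_divide)
          moreover have "\<delta> powr (d - \<alpha>) = \<delta> powr d * \<delta> powr (- \<alpha>)" by (simp flip: powr_add)
          ultimately show ?thesis using that(2) a0 by simp
        qed
        then have M: "max 1 M0 \<le> measure (pareto \<alpha>) A * (k * r) powr d" using that(3) by simp
        then have "P.prob (no_leaf (k * r) A) \<le> exp (- K * (measure (pareto \<alpha>) A * (k * r) powr d) powr \<eta>)"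
          unfolding \<eta>_def using that(1) kr by (intro K) auto
        also have "\<dots> < \<epsilon> / 8" using M by (intro M0) auto
        finally show ?thesis by simp
      qed
      have x1: "\<delta> * a \<ge> 1" using da by simp
      have pL1: "P.prob L1 \<le> \<epsilon> / 8" unfolding L1_def
        using pareto_interval(1)[OF x1] \<delta>(3) by (intro leaf[of _ \<kappa>1]) (auto simp: \<kappa>1_def)
      have pL2: "P.prob L2 \<le> \<epsilon> / 8" unfolding L2_def
        using pareto_interval(2)[OF x1] \<delta>(4) by (intro leaf[of _ \<kappa>2]) (auto simp: \<kappa>2_def)
      have sets: "Near \<in> sets P" "(\<Union>j. Far j) \<in> sets P" "L1 \<in> sets P" "L2 \<in> sets P"
        unfolding Near_def Far_def L1_def L2_def
        by (auto intro!: sets_high_potential sets_no_leaf sets.countable_UN)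
      define Bad where "Bad = Near \<union> ((\<Union>j. Far j) \<union> (L1 \<union> (L2 \<union> T)))"
      have sBad: "Bad \<in> sets P" unfolding Bad_def using sets T(3) by auto
      have pBad: "P.prob Bad \<le> \<epsilon>"
      proof -
        have "P.prob Bad \<le> P.prob Near + (P.prob (\<Union>j. Far j) + (P.prob L1 + (P.prob L2 + P.prob T)))"
          unfolding Bad_def using sets T(3)
          by (intro order_trans[OF measure_Un_le] add_left_mono sets.Un order_refl)
        then show ?thesis using pNear pFar pL1 pL2 pT eps by linarith
      qed
      have window: "(Z1_defined \<omega> t \<and> real (height \<omega> (Z1 \<omega> t)) \<in> {inverse l * r .. l * r})
          \<and> (Z2_defined \<omega> t \<and> real (height \<omega> (Z2 \<omega> t)) \<in> {inverse l * r .. l * r})"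
        if \<omega>: "\<omega> \<notin> Bad" for \<omega>
      proof -
        have near: "score \<omega> t v < \<delta> * a / 4" if v: "v \<in> vertices \<omega>" "real (length v) < inverse l * r" for v
        proof -
          have "real (length v) \<le> r / l" using v(2) by (simp add: divide_inverse mult.commute)
          then have "\<not> \<delta> * a / 8 \<le> potential \<omega> v" using \<omega> v(1) by (auto simp: Bad_def Near_def high_potential_def)
          then have "score \<omega> t v \<le> \<delta> * a / 8 + 1" using da by (intro score_le(1)[OF t0]) auto
          then show ?thesis using da by linarith
        qed
        have far: "score \<omega> t v < \<delta> * a / 4" if v: "v \<in> vertices \<omega>" "real (length v) > l * r" for v
        proof -
          have lr: "l * r > 0" using l r0 by simp
          have "\<exists>j. real (length v) \<le> 2 ^ (j + 1) * l * r"
          proof -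
            obtain j where "real (length v) / (l * r) < 2 ^ j" using real_arch_pow[of 2] by auto
            then have "real (length v) < 2 ^ j * (l * r)" using lr by (simp add: field_simps)
            also have "\<dots> \<le> 2 ^ (j + 1) * (l * r)" using lr by simp
            finally show ?thesis by (intro exI[of _ j]) (simp add: mult.assoc)
          qed
          \<comment> \<open>The dyadic shell that contains \<open>v\<close>; minimality gives the
            lower bound on the height, and for \<open>j = 0\<close> that bound is the assumption on
            \<open>v\<close>.\<close>
          define j where "j = (LEAST j. real (length v) \<le> 2 ^ (j + 1) * l * r)"
          have j: "real (length v) \<le> 2 ^ (j + 1) * l * r"
            unfolding j_def by (rule LeastI_ex) fact
          have j': "real (length v) > 2 ^ j * l * r"
          proof (cases j)
            case (Suc i)
            then have "i < j" by simp
            then have "\<not> real (length v) \<le> 2 ^ (i + 1) * l * r" unfolding j_def by (rule not_less_Least)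
            then show ?thesis using Suc by simp
          qed (use v in simp)
          have "\<not> 2 ^ j * l * (q / 2) * a \<le> potential \<omega> v"
            using \<omega> v(1) j by (auto simp: Bad_def Far_def high_potential_def)
          moreover have "v \<noteq> []" using v lr by auto
          moreover define x where "x = real (length v) / t"
          ultimately have s: "score \<omega> t v \<le> 2 ^ j * l * (q / 2) * a - x * (ln x - 1)"
            unfolding x_def using l q a0 by (intro score_le(2)[OF t0]) auto
          have "2 ^ j * l * r / t < x" unfolding x_def using j' t0 by (intro divide_strict_right_mono) auto
          moreover have "2 ^ j * l * r / t = 2 ^ j * l * (a / L)" using rt by (simp add: mult.assoc flip: times_divide_eq_right)
          ultimately have x: "2 ^ j * l * (a / L) < x" by simp
          have "1 * 1 \<le> 2 ^ j * l" using l by (intro mult_mono) auto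
          then have "1 * (a / L) \<le> 2 ^ j * l * (a / L)" using a0 L0 by (intro mult_right_mono) auto
          then have "a / L < x" using x by simp
          moreover have "a / L > 0" using a0 L0 by simp
          ultimately have "ln (a / L) < ln x" by simp
          then have lnx: "q * L / 2 < ln x - 1" using t(8) by linarith
          have x0: "x > 0" unfolding x_def by (rule divide_pos_pos) (use v(2) lr t0 in linarith)+
          \<comment> \<open>The cost exceeds the largest potential available in this shell, so the
            score is even negative.\<close>
          have "2 ^ j * l * (a / L) * (q * L / 2) < x * (ln x - 1)"
            using x x0 lnx l a0 L0 q by (intro mult_strict_mono) auto
          moreover have "2 ^ j * l * (a / L) * (q * L / 2) = 2 ^ j * l * (q / 2) * a" using L0 by simp
          ultimately show ?thesis using s da by linarith
        qed
        have big: "\<delta> * a / 4 \<le> score \<omega> t v"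
          if v: "v \<in> vertices \<omega>" "real (length v) \<le> k * r" "\<not> special \<omega> v" "offspring \<omega> v = 0" "\<delta> * a \<le> potential \<omega> v" for v
        proof -
          have "v \<noteq> []" using v(3) special.root by metis
          then have n: "length v > 0" by simp
          \<comment> \<open>Giving away half of \<open>\<delta> * a\<close> absorbs the degree 1;
            the distance then costs at most another quarter.\<close>
          define E where "E = \<delta> * a / 2"
          define x where "x = real (length v) / t"
          have E: "E \<ge> 1" "E \<le> a" using da \<delta> a0 by (auto simp: E_def intro: order_trans[of _ "1 * a / 2"])
          have "x \<le> k * r / t" unfolding x_def using v(2) t0 by (intro divide_right_mono) auto
          also have "k * r / t = k * (a / L)" using rt by (simp flip: times_divide_eq_right)
          finally have x: "x \<le> k * (a / L)" .
          have "k / L \<le> \<delta> / 2" using t(2) \<delta> L0 by (simp add: field_simps)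
          then have "k / L * a \<le> \<delta> / 2 * a" using a0 by (intro mult_right_mono) auto
          moreover have "k / L * a = k * (a / L)" by simp
          moreover have "\<delta> / 2 * a = E" by (simp add: E_def)
          ultimately have xE: "x \<le> E" using x by linarith
          have "score \<omega> t v = psi_val t (length v) (potential \<omega> v - 1)"
            using v(4) n by (simp add: score_def)
          moreover have "E \<le> potential \<omega> v - 1" using v(5) da by (simp add: E_def)
          ultimately have "score \<omega> t v \<ge> E - x * ln E"
            using psi_val_ge[OF t0 n, of E "potential \<omega> v - 1"] xE by (simp add: x_def)
          moreover have "x * ln E \<le> k * (a / L) * (q * L)"
          proof (rule mult_mono)
            show "ln E \<le> q * L" using E t(9) by (intro order_trans[OF _ t(9)]) simp
          qed (use x E k a0 L0 in auto)
          moreover have "k * (a / L) * (q * L) = \<delta> * a / 4" using L0 q by (simp add: k_def)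
          ultimately show ?thesis by (simp add: E_def)
        qed
        obtain v1 where v1: "v1 \<in> vertices \<omega>" "real (length v1) \<le> k * r" "\<not> special \<omega> v1" "offspring \<omega> v1 = 0"
            "potential \<omega> v1 \<in> {\<delta> * a..<2 * (\<delta> * a)}"
          using \<omega> unfolding Bad_def L1_def no_leaf_def by blast
        obtain v2 where v2: "v2 \<in> vertices \<omega>" "real (length v2) \<le> k * r" "\<not> special \<omega> v2" "offspring \<omega> v2 = 0"
            "potential \<omega> v2 \<in> {2 * (\<delta> * a)..}"
          using \<omega> unfolding Bad_def L2_def no_leaf_def by blast
        have "v1 \<noteq> v2" using v1(5) v2(5) by auto
        moreover have "\<delta> * a / 4 \<le> score \<omega> t v1" using v1 by (intro big) auto
        moreover have "\<delta> * a / 4 \<le> score \<omega> t v2" using v2 da by (intro big) auto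
        moreover have "\<forall>v\<in>vertices \<omega>. \<forall>w\<in>vertices \<omega>. score \<omega> t v = score \<omega> t w \<longrightarrow> score \<omega> t w \<ge> \<delta> * a / 4 \<longrightarrow> v = w"
        proof -
          have "\<omega> \<notin> T" using \<omega> by (simp add: Bad_def)
          then have "\<forall>v\<in>vertices \<omega>. \<forall>w\<in>vertices \<omega>. score \<omega> t v = score \<omega> t w \<longrightarrow> score \<omega> t w > 1 \<longrightarrow> v = w"
            using T(1) by auto
          \<comment> \<open>The winning level lies in the range where ties have been
            excluded.\<close>
          moreover have "\<delta> * a / 4 > 1" using da by simp
          ultimately show ?thesis by (meson less_le_trans)
        qed
        ultimately show ?thesis
          using Z_in_window[OF t0 near far, where ?v1.0=v1 and ?v2.0=v2] v1(1) v2(1) by blast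
      qed
      have final: "1 - \<epsilon> \<le> P.prob E" if "E \<in> sets P" "\<And>\<omega>. \<omega> \<notin> Bad \<Longrightarrow> \<omega> \<in> E" for E
      proof -
        have "1 = P.prob (space P)" by (rule P.prob_space[symmetric])
        also have "\<dots> \<le> P.prob (E \<union> Bad)" using that sBad by (intro P.finite_measure_mono) auto
        also have "\<dots> \<le> P.prob E + P.prob Bad" using that sBad by (intro measure_Un_le)
        finally show ?thesis using pBad by linarith
      qed
      show ?case unfolding scale
        by (intro conjI final sets_Z_events[OF t0]) (use window in auto)
    qed
  qed
qed

end

text \<open>Only lower bounds carry information, since the values, and hence their lower limits, are
  at most 1.\<close>

lemma tendsto_Liminf_prob:
  fixes p :: "real \<Rightarrow> real \<Rightarrow> real"
  assumes le: "\<And>l t. p l t \<le> 1"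
    and ev: "\<And>\<epsilon>. \<epsilon> > 0 \<Longrightarrow> \<forall>\<^sub>F l in at_top. \<forall>\<^sub>F t in at_top. 1 - \<epsilon> \<le> p l t"
  shows "((\<lambda>l. Liminf at_top (\<lambda>t. ereal (p l t))) \<longlongrightarrow> 1) at_top"
proof (rule order_tendstoI)
  fix a :: ereal assume "a < 1"
  then obtain x where x: "a < ereal x" "ereal x < 1" using ereal_dense2 by blast
  have "1 - x > 0" using x(2) by simp
  from ev[OF this] show "\<forall>\<^sub>F l in at_top. a < Liminf at_top (\<lambda>t. ereal (p l t))"
  proof eventually_elim
    case (elim l)
    then have "\<forall>\<^sub>F t in at_top. ereal x \<le> ereal (p l t)" by simp
    then have "ereal x \<le> Liminf at_top (\<lambda>t. ereal (p l t))" by (rule Liminf_bounded)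
    with x(1) show ?case by (rule less_le_trans)
  qed
next
  fix a :: ereal assume a: "1 < a"
  have "Liminf at_top (\<lambda>t. ereal (p l t)) \<le> 1" for l
  proof -
    have "Liminf at_top (\<lambda>t. ereal (p l t)) \<le> Limsup at_top (\<lambda>t. ereal (p l t))"
      by (rule Liminf_le_Limsup) simp
    also have "\<dots> \<le> 1" using le by (intro Limsup_bounded always_eventually) simp
    finally show ?thesis .
  qed
  then show "\<forall>\<^sub>F l in at_top. Liminf at_top (\<lambda>t. ereal (p l t)) < a"
    using a by (intro always_eventually allI) (rule le_less_trans)
qed

theorem theorem1p7:
  fixes \<mu> :: "nat pmf" and \<nu> :: "real measure" and \<alpha> \<beta> c d :: real
  assumes "critical_offspring \<mu>"
    and "1 < \<beta>" "\<beta> \<le> 2" and "c > 0"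
    and "stable_law \<beta> \<nu>" and "weak_conv_m (rescaled_walk \<mu> \<beta> c) \<nu>"
    and "d = \<beta> / (\<beta> - 1)" and "\<alpha> > d"
  shows
    "((\<lambda>l::real. Liminf at_top (\<lambda>t::real. ereal (measure (kesten \<mu> \<alpha>)
        {\<omega> \<in> space (kesten \<mu> \<alpha>). Z1_defined \<omega> t \<and>
           real (height \<omega> (Z1 \<omega> t)) \<in> {inverse l * scale d \<alpha> t .. l * scale d \<alpha> t}})))
      \<longlongrightarrow> 1) at_top
   \<and> ((\<lambda>l::real. Liminf at_top (\<lambda>t::real. ereal (measure (kesten \<mu> \<alpha>)
        {\<omega> \<in> space (kesten \<mu> \<alpha>). Z2_defined \<omega> t \<and>
           real (height \<omega> (Z2 \<omega> t)) \<in> {inverse l * scale d \<alpha> t .. l * scale d \<alpha> t}})))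
      \<longlongrightarrow> 1) at_top"
proof -
  interpret kesten_tree \<mu> \<nu> \<beta> c \<alpha>
    using assms by unfold_locales auto
  have sp: "space (kesten \<mu> \<alpha>) = UNIV" using space_P by (simp add: P_def)
  note W = window_probability[folded \<open>d = \<beta> / (\<beta> - 1)\<close>]
  show ?thesis
    unfolding sp P_def[symmetric]
    by (intro conjI tendsto_Liminf_prob)
      (auto elim!: eventually_mono[OF W] eventually_mono)
qed

end
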